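(* There exist $\rho>\tfrac\pi2$ (with $\rho<\pi$) and an embedded free boundary minimal annulus $\Sigma\subset B(\rho)\subset\mathbb{S}^3$ whose Jacobi--Robin kernel contains an element that is not induced by any Killing field of $\mathbb{S}^3$ preserving $B(\rho)$. Consequently, the property that all Jacobi--Robin fields of every embedded free boundary minimal annulus in a geodesic ball of $\mathbb{S}^3$ of radius $r$ be Killing-induced cannot hold for all radii $r\in(0,\pi)$.
   Context: $\mathbb{S}^3$ is the round unit 3-sphere, $p_0\in\mathbb{S}^3$ fixed, $B(r)$ the closed geodesic ball of radius $r\in(0,\pi)$ centred at $p_0$. A free boundary minimal surface $\Sigma\subset B(r)$ is a compact two-sided minimal surface in $B(r)$ with nonempty boundary contained in $\partial B(r)$, meeting $\partial B(r)$ orthogonally, i.e. its outward unit conormal $\eta$ equals the gradient of $\operatorname{dist}(p_0,\cdot)$ along $\partial\Sigma$. With unit normal $\nu$ and second fundamental form $A$, its Jacobi--Robin kernel is $\mathcal{K}(\Sigma,r)=\{u\in C^\infty(\Sigma):\Delta u+(|A|^2+2)u=0,\ \partial_\eta u-\cot(r)u=0\text{ on }\partial\Sigma\}$; its elements are the Jacobi--Robin fields. An element is Killing-induced (induced by $Z$) if it equals $\langle Z,\nu\rangle$ for a Killing field $Z$ of $\mathbb{S}^3$ whose flow preserves $B(r)$. *)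

theory Defs
  imports "HOL-Analysis.Analysis"
begin

section \<open>The round 3-sphere, geodesic balls and Killing fields\<close>

definition S3 :: "(real^4) set" where
  "S3 = sphere 0 1"

text \<open>The Riemannian distance of the round unit sphere is the angle between position vectors.\<close>

definition S3_dist :: "real^4 \<Rightarrow> real^4 \<Rightarrow> real" where
  "S3_dist p q = arccos (p \<bullet> q)"

definition geodesic_ball :: "real^4 \<Rightarrow> real \<Rightarrow> (real^4) set" where
  "geodesic_ball p r = {q \<in> S3. S3_dist p q \<le> r}"

definition geodesic_sphere :: "real^4 \<Rightarrow> real \<Rightarrow> (real^4) set" where
  "geodesic_sphere p r = {q \<in> S3. S3_dist p q = r}"

text \<open>\<open>w\<close> is the gradient at \<open>q\<close> of the function \<open>f\<close> on the sphere. A derivative within the sphere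
  is determined only on tangent vectors; the requirement \<open>w \<bullet> q = 0\<close> makes \<open>w\<close> unique.\<close>

definition S3_gradient :: "(real^4 \<Rightarrow> real) \<Rightarrow> real^4 \<Rightarrow> real^4 \<Rightarrow> bool" where
  "S3_gradient f q w \<longleftrightarrow> w \<bullet> q = 0 \<and> (f has_derivative (\<lambda>v. w \<bullet> v)) (at q within S3)"

text \<open>The Killing equation \<open>\<langle>\<nabla>\<^sub>v Z, w\<rangle> + \<langle>\<nabla>\<^sub>w Z, v\<rangle> = 0\<close>. The Levi-Civita derivative is the tangential
  part of the derivative in the ambient space, so testing against tangent vectors needs no projection.
  Differentiable solutions are automatically smooth.\<close>

definition killing_field :: "(real^4 \<Rightarrow> real^4) \<Rightarrow> bool" where
  "killing_field Z \<longleftrightarrow>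
     (\<forall>q\<in>S3. Z q \<bullet> q = 0 \<and>
        (\<exists>Z'. (Z has_derivative Z') (at q within S3) \<and>
              (\<forall>v w. v \<bullet> q = 0 \<longrightarrow> w \<bullet> q = 0 \<longrightarrow> Z' v \<bullet> w + Z' w \<bullet> v = 0)))"

text \<open>Every integral curve (over the whole real line, Killing fields of the compact sphere being
  complete) that starts in \<open>B\<close> stays in \<open>B\<close>.\<close>

definition flow_preserves :: "(real^4 \<Rightarrow> real^4) \<Rightarrow> (real^4) set \<Rightarrow> bool" where
  "flow_preserves Z B \<longleftrightarrow>
     (\<forall>c :: real \<Rightarrow> real^4.
        (\<forall>t. c t \<in> S3 \<and> (c has_vector_derivative Z (c t)) (at t)) \<longrightarrow> c 0 \<in> B \<longrightarrow> (\<forall>t. c t \<in> B))"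

section \<open>Smooth functions on the closed half-plane\<close>

definition half_plane :: "(real^2) set" where
  "half_plane = {x. 0 \<le> x $ 2}"

text \<open>Derivatives are taken within the half-plane: they are the usual ones at interior points and
  one-sided ones on the boundary line, where the half-plane still determines them uniquely.\<close>

definition Dhp :: "(real^2 \<Rightarrow> 'b::real_normed_vector) \<Rightarrow> real^2 \<Rightarrow> real^2 \<Rightarrow> 'b" where
  "Dhp f x = frechet_derivative f (at x within half_plane)"

definition pd :: "2 \<Rightarrow> (real^2 \<Rightarrow> 'b::real_normed_vector) \<Rightarrow> real^2 \<Rightarrow> 'b" where
  "pd i f x = Dhp f x (axis i 1)"

text \<open>Used only for relatively open subsets \<open>W\<close> of the half-plane.\<close>

primrec Ck_on :: "nat \<Rightarrow> (real^2) set \<Rightarrow> (real^2 \<Rightarrow> 'b::real_normed_vector) \<Rightarrow> bool" where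
  "Ck_on 0 W f \<longleftrightarrow> continuous_on W f"
| "Ck_on (Suc k) W f \<longleftrightarrow> f differentiable_on W \<and> (\<forall>i. Ck_on k W (pd i f))"

definition smooth_on :: "(real^2) set \<Rightarrow> (real^2 \<Rightarrow> 'b::real_normed_vector) \<Rightarrow> bool" where
  "smooth_on W f \<longleftrightarrow> (\<forall>k. Ck_on k W f)"

section \<open>Embedded surfaces with boundary\<close>

text \<open>A local parametrization of \<open>\<Sigma>\<close> on the relatively open subset \<open>W\<close> of the half-plane. Points of
  \<open>W\<close> on the line \<open>x $ 2 = 0\<close> parametrize boundary points.\<close>

definition surface_chart :: "(real^4) set \<Rightarrow> (real^2) set \<Rightarrow> (real^2 \<Rightarrow> real^4) \<Rightarrow> bool" where
  "surface_chart \<Sigma> W \<phi> \<longleftrightarrow>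
     openin (top_of_set half_plane) W \<and>
     smooth_on W \<phi> \<and>
     (\<forall>x\<in>W. inj (Dhp \<phi> x)) \<and>
     openin (top_of_set \<Sigma>) (\<phi> ` W) \<and>
     (\<exists>\<psi>. homeomorphism W (\<phi> ` W) \<phi> \<psi>)"

definition chart_at ::
  "(real^4) set \<Rightarrow> real^4 \<Rightarrow> (real^2) set \<Rightarrow> (real^2 \<Rightarrow> real^4) \<Rightarrow> real^2 \<Rightarrow> bool" where
  "chart_at \<Sigma> p W \<phi> x \<longleftrightarrow> surface_chart \<Sigma> W \<phi> \<and> x \<in> W \<and> \<phi> x = p"

definition smooth_surface :: "(real^4) set \<Rightarrow> bool" where
  "smooth_surface \<Sigma> \<longleftrightarrow> (\<forall>p\<in>\<Sigma>. \<exists>W \<phi> x. chart_at \<Sigma> p W \<phi> x)"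

definition surface_boundary :: "(real^4) set \<Rightarrow> (real^4) set" where
  "surface_boundary \<Sigma> = {p. \<exists>W \<phi> x. chart_at \<Sigma> p W \<phi> x \<and> x $ 2 = 0}"

definition tangent_space :: "(real^4) set \<Rightarrow> real^4 \<Rightarrow> (real^4) set" where
  "tangent_space \<Sigma> p = {v. \<exists>W \<phi> x. chart_at \<Sigma> p W \<phi> x \<and> v \<in> range (Dhp \<phi> x)}"

definition smooth_function :: "(real^4) set \<Rightarrow> (real^4 \<Rightarrow> real) \<Rightarrow> bool" where
  "smooth_function \<Sigma> u \<longleftrightarrow>
     (\<forall>p\<in>\<Sigma>. \<exists>W \<phi> x. chart_at \<Sigma> p W \<phi> x \<and> smooth_on W (u \<circ> \<phi>))"

text \<open>A continuous unit normal field of \<open>\<Sigma>\<close> in the sphere; it exists iff \<open>\<Sigma>\<close> is two-sided.\<close>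

definition unit_normal :: "(real^4) set \<Rightarrow> (real^4 \<Rightarrow> real^4) \<Rightarrow> bool" where
  "unit_normal \<Sigma> \<nu> \<longleftrightarrow>
     continuous_on \<Sigma> \<nu> \<and>
     (\<forall>p\<in>\<Sigma>. norm (\<nu> p) = 1 \<and> \<nu> p \<bullet> p = 0 \<and> (\<forall>v\<in>tangent_space \<Sigma> p. \<nu> p \<bullet> v = 0))"

text \<open>\<open>pd 1 \<phi> x\<close> spans the tangent line of the boundary and \<open>pd 2 \<phi> x\<close> points into the surface.\<close>

definition outward_conormal :: "(real^4) set \<Rightarrow> real^4 \<Rightarrow> real^4 \<Rightarrow> bool" where
  "outward_conormal \<Sigma> p \<eta> \<longleftrightarrow>
     (\<exists>W \<phi> x. chart_at \<Sigma> p W \<phi> x \<and> x $ 2 = 0 \<and>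
        \<eta> \<in> range (Dhp \<phi> x) \<and> norm \<eta> = 1 \<and> \<eta> \<bullet> pd 1 \<phi> x = 0 \<and> \<eta> \<bullet> pd 2 \<phi> x < 0)"

section \<open>Curvature and the Laplace--Beltrami operator in local coordinates\<close>

definition first_form :: "(real^2 \<Rightarrow> real^4) \<Rightarrow> real^2 \<Rightarrow> real^2^2" where
  "first_form \<phi> x = (\<chi> i j. pd i \<phi> x \<bullet> pd j \<phi> x)"

text \<open>Since \<open>\<nu>\<close> is tangent to the sphere, the ambient second derivative may replace the covariant
  one in \<open>A(\<partial>\<^sub>i, \<partial>\<^sub>j) = \<langle>\<nabla>\<^sub>i \<partial>\<^sub>j \<phi>, \<nu>\<rangle>\<close>.\<close>

definition second_form :: "(real^4 \<Rightarrow> real^4) \<Rightarrow> (real^2 \<Rightarrow> real^4) \<Rightarrow> real^2 \<Rightarrow> real^2^2" where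
  "second_form \<nu> \<phi> x = (\<chi> i j. pd i (pd j \<phi>) x \<bullet> \<nu> (\<phi> x))"

definition shape_operator :: "(real^4 \<Rightarrow> real^4) \<Rightarrow> (real^2 \<Rightarrow> real^4) \<Rightarrow> real^2 \<Rightarrow> real^2^2" where
  "shape_operator \<nu> \<phi> x = matrix_inv (first_form \<phi> x) ** second_form \<nu> \<phi> x"

definition mean_curvature :: "(real^4 \<Rightarrow> real^4) \<Rightarrow> (real^2 \<Rightarrow> real^4) \<Rightarrow> real^2 \<Rightarrow> real" where
  "mean_curvature \<nu> \<phi> x = trace (shape_operator \<nu> \<phi> x)"

text \<open>\<open>|A|\<^sup>2 = \<Sum> g\<^sup>i\<^sup>k g\<^sup>j\<^sup>l A\<^sub>i\<^sub>j A\<^sub>k\<^sub>l\<close>, the trace of the squared shape operator.\<close>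

definition norm_A_sq :: "(real^4 \<Rightarrow> real^4) \<Rightarrow> (real^2 \<Rightarrow> real^4) \<Rightarrow> real^2 \<Rightarrow> real" where
  "norm_A_sq \<nu> \<phi> x = trace (shape_operator \<nu> \<phi> x ** shape_operator \<nu> \<phi> x)"

definition laplace_beltrami :: "(real^2 \<Rightarrow> real^4) \<Rightarrow> (real^2 \<Rightarrow> real) \<Rightarrow> real^2 \<Rightarrow> real" where
  "laplace_beltrami \<phi> f x =
     (\<Sum>i\<in>UNIV. \<Sum>j\<in>UNIV.
        pd i (\<lambda>y. sqrt (det (first_form \<phi> y)) * matrix_inv (first_form \<phi> y) $ i $ j * pd j f y) x)
     / sqrt (det (first_form \<phi> x))"

section \<open>Free boundary minimal surfaces and Jacobi--Robin fields\<close>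

text \<open>Mean curvature, Laplacian, \<open>|A|\<^sup>2\<close>, conormal and conormal derivative do not depend on the
  parametrization, so below each equation is required at every point in some local
  parametrization around it.\<close>

definition minimal_surface :: "(real^4) set \<Rightarrow> (real^4 \<Rightarrow> real^4) \<Rightarrow> bool" where
  "minimal_surface \<Sigma> \<nu> \<longleftrightarrow>
     (\<forall>p\<in>\<Sigma>. \<exists>W \<phi> x. chart_at \<Sigma> p W \<phi> x \<and> mean_curvature \<nu> \<phi> x = 0)"

definition free_boundary_minimal_surface ::
  "real^4 \<Rightarrow> real \<Rightarrow> (real^4) set \<Rightarrow> (real^4 \<Rightarrow> real^4) \<Rightarrow> bool" where
  "free_boundary_minimal_surface p0 r \<Sigma> \<nu> \<longleftrightarrow>
     compact \<Sigma> \<and> smooth_surface \<Sigma> \<and> \<Sigma> \<subseteq> geodesic_ball p0 r \<and>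
     unit_normal \<Sigma> \<nu> \<and> minimal_surface \<Sigma> \<nu> \<and>
     surface_boundary \<Sigma> \<noteq> {} \<and> surface_boundary \<Sigma> \<subseteq> geodesic_sphere p0 r \<and>
     (\<forall>p\<in>surface_boundary \<Sigma>. \<exists>\<eta>. outward_conormal \<Sigma> p \<eta> \<and> S3_gradient (S3_dist p0) p \<eta>)"

definition embedded_free_boundary_minimal_annulus ::
  "real^4 \<Rightarrow> real \<Rightarrow> (real^4) set \<Rightarrow> (real^4 \<Rightarrow> real^4) \<Rightarrow> bool" where
  "embedded_free_boundary_minimal_annulus p0 r \<Sigma> \<nu> \<longleftrightarrow>
     free_boundary_minimal_surface p0 r \<Sigma> \<nu> \<and>
     \<Sigma> homeomorphic ((sphere 0 1 :: (real^2) set) \<times> {0..1::real})"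

text \<open>The derivative of \<open>u\<close> in the direction \<open>\<eta> = d\<phi>(a)\<close> is \<open>d(u \<circ> \<phi>)(a)\<close>.\<close>

definition robin_condition :: "(real^4) set \<Rightarrow> real \<Rightarrow> (real^4 \<Rightarrow> real) \<Rightarrow> real^4 \<Rightarrow> bool" where
  "robin_condition \<Sigma> r u p \<longleftrightarrow>
     (\<exists>W \<phi> x \<eta> a. chart_at \<Sigma> p W \<phi> x \<and> outward_conormal \<Sigma> p \<eta> \<and> Dhp \<phi> x a = \<eta> \<and>
        Dhp (u \<circ> \<phi>) x a - cot r * u p = 0)"

text \<open>Functions on \<open>\<Sigma>\<close> are represented by functions on the ambient space of which only the
  values on \<open>\<Sigma>\<close> matter.\<close>

definition jacobi_robin_kernel ::
  "(real^4) set \<Rightarrow> (real^4 \<Rightarrow> real^4) \<Rightarrow> real \<Rightarrow> (real^4 \<Rightarrow> real) set" where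
  "jacobi_robin_kernel \<Sigma> \<nu> r =
     {u. smooth_function \<Sigma> u \<and>
         (\<forall>p\<in>\<Sigma>. \<exists>W \<phi> x. chart_at \<Sigma> p W \<phi> x \<and>
            laplace_beltrami \<phi> (u \<circ> \<phi>) x + (norm_A_sq \<nu> \<phi> x + 2) * u p = 0) \<and>
         (\<forall>p\<in>surface_boundary \<Sigma>. robin_condition \<Sigma> r u p)}"

definition killing_induced ::
  "real^4 \<Rightarrow> real \<Rightarrow> (real^4) set \<Rightarrow> (real^4 \<Rightarrow> real^4) \<Rightarrow> (real^4 \<Rightarrow> real) \<Rightarrow> bool" where
  "killing_induced p0 r \<Sigma> \<nu> u \<longleftrightarrow>
     (\<exists>Z. killing_field Z \<and> flow_preserves Z (geodesic_ball p0 r) \<and> (\<forall>p\<in>\<Sigma>. u p = Z p \<bullet> \<nu> p))"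

definition all_jacobi_robin_fields_killing_induced :: "real^4 \<Rightarrow> real \<Rightarrow> bool" where
  "all_jacobi_robin_fields_killing_induced p0 r \<longleftrightarrow>
     (\<forall>\<Sigma> \<nu>. embedded_free_boundary_minimal_annulus p0 r \<Sigma> \<nu> \<longrightarrow>
        (\<forall>u\<in>jacobi_robin_kernel \<Sigma> \<nu> r. killing_induced p0 r \<Sigma> \<nu> u))"

end

theory Submission
  imports Defs
begin

text \<open>
  The annulus is a piece of a rotational minimal surface, and the field is the normal speed of a
  variation through rotational minimal surfaces, taken where the radius of the ball that such
  surfaces meet orthogonally is stationary.

  Write points of the sphere as \<open>(sqrt (1 - R\<^sup>2) e\<^sup>i\<^sup>\<theta>, R e\<^sup>i\<^sup>\<phi>)\<close>, with \<open>R = 0\<close> the axis of rotation. If \<open>s\<close>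
  is the arc length of a profile curve, minimality amounts to the conservation of
  \<open>c = R (1 - R\<^sup>2) \<theta>'\<close>, and this integrates to \<open>R\<^sup>2 = (1 + B cos 2s) / 2\<close> with \<open>c\<^sup>2 = (1 - B\<^sup>2) / 4\<close>.
  For \<open>0 \<le> B < 1\<close> the parallel \<open>s = 0\<close> is a widest one; \<open>B = 0\<close> is the Clifford torus, and for
  \<open>B \<rightarrow> 1\<close> the surface breaks up into great spheres. The surface is symmetric about the point \<open>p\<^sub>0\<close> of the
  axis with \<open>\<theta> = 0\<close>. It meets a sphere around \<open>p\<^sub>0\<close> orthogonally at \<open>s\<close> iff the
  geodesic tangent to the profile at \<open>s\<close> passes through \<open>p\<^sub>0\<close>. With \<open>w = 1 + B e\<^sup>2\<^sup>i\<^sup>s\<close> this happens when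
  \<open>J(B, s) = \<pi>/2\<close> for \<open>J(B, s) = \<integral>\<^sub>0\<^sup>s 4 c R / |w|\<^sup>2\<close> (the function \<open>foot\<close>), and then the radius of the ball is
  \<open>\<pi>/2 + arg w\<close>.

  On the curve \<open>J = \<pi>/2\<close> the angle \<open>arg w\<close> vanishes at \<open>B = 0\<close>, is positive for \<open>0 < B < 1\<close> and
  tends to \<open>0\<close> as \<open>B \<rightarrow> 1\<close>. Hence it has an interior maximum, at which the
  differentials of \<open>J\<close> and of \<open>arg w\<close> are linearly dependent (\<open>exists_critical_bulge\<close>). The normal
  component \<open>u\<close> of the variation in \<open>B\<close> solves the Jacobi equation on every surface of the family
  (\<open>DERIV_jacobi'\<close>), and the linear dependence is exactly the Robin condition for \<open>u\<close>
  (\<open>jacobi_robin\<close>). Since the radius there exceeds \<open>\<pi>/2\<close>, this is the required annulus.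

  The field \<open>u\<close> is invariant under rotation and does not vanish on the parallel \<open>s = 0\<close>. A Killing
  field of the sphere is the restriction of a skew linear map (\<open>killing_skew\<close>), and for such a
  field \<open>Z\<close> the function \<open>\<langle>Z, \<nu>\<rangle>\<close> takes opposite values at opposite points of that parallel. So
  \<open>u\<close> is induced by no Killing field of the sphere.

  Boundary and tangent spaces of a surface are defined through arbitrary charts. Two
  general facts reduce them to explicit charts: all charts at a point have the same tangent plane
  (\<open>chart_range_subset\<close>), and invariance of domain keeps interior points off the
  boundary (\<open>interior_not_surface_boundary\<close>).
\<close>

section \<open>Smooth functions on the half-plane\<close>

text \<open>Every point of the half-plane is approached inside it along both coordinate axes, so a
  derivative within the half-plane is unique.\<close>

lemma Dhp_eqI:
  assumes "(f has_derivative f') (at x within half_plane)" "x \<in> half_plane"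
  shows "Dhp f x = f'"
proof -
  have "f' = Dhp f x"
  proof (rule frechet_derivative_unique_within[OF assms(1)])
    show "(f has_derivative Dhp f x) (at x within half_plane)"
      using assms(1) unfolding Dhp_def
      by (metis differentiableI frechet_derivative_works)
    fix i :: "real^2" and e :: real
    assume i: "i \<in> Basis" and "e > 0"
    then have "0 < \<bar>e/2\<bar> \<and> \<bar>e/2\<bar> < e \<and> x + (e/2) *\<^sub>R i \<in> half_plane"
      using assms(2) by (auto simp: half_plane_def Basis_vec_def axis_def)
    then show "\<exists>d. 0 < \<bar>d\<bar> \<and> \<bar>d\<bar> < e \<and> x + d *\<^sub>R i \<in> half_plane" by blast
  qed
  then show ?thesis by simp
qed

lemma at_within_half_plane:
  assumes "openin (top_of_set half_plane) W" "x \<in> W"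
  shows "at x within W = at x within half_plane"
proof -
  obtain T where "open T" "W = T \<inter> half_plane"
    using assms(1) by (metis Int_commute openin_open)
  then show ?thesis
    using assms(2) by (intro at_within_nhd[of x T]) auto
qed

text \<open>Functions on a surface are controlled only on the domain of a chart, so derivatives must be
  insensitive to changes outside a relatively open set.\<close>

lemma has_derivative_half_plane_cong:
  assumes "openin (top_of_set half_plane) W" "x \<in> W" "\<And>y. y \<in> W \<Longrightarrow> f y = g y"
    and "(g has_derivative g') (at x within half_plane)"
  shows "(f has_derivative g') (at x within half_plane)"
proof -
  have "(g has_derivative g') (at x within W)"
    using assms by (simp add: at_within_half_plane)
  then have "(f has_derivative g') (at x within W)"
    using has_derivative_transform[of x W f g g'] assms(2,3) by simp
  then show ?thesis using assms by (simp add: at_within_half_plane)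
qed

lemma Dhp_cong_eqI:
  assumes "openin (top_of_set half_plane) W" "x \<in> W" "\<And>y. y \<in> W \<Longrightarrow> f y = g y"
    and "(g has_derivative g') (at x within half_plane)"
  shows "Dhp f x = g'"
proof (rule Dhp_eqI[OF has_derivative_half_plane_cong[OF assms]])
  show "x \<in> half_plane" using assms(1,2) openin_subset by fastforce
qed

text \<open>Smoothness on the whole plane, in a form that is stable under algebraic operations. The
  explicit charts extend across the boundary line, so their smoothness on the half-plane follows
  by restriction.\<close>

primrec C_plane :: "nat \<Rightarrow> (real^2 \<Rightarrow> 'b::real_normed_vector) \<Rightarrow> bool" where
  "C_plane 0 f \<longleftrightarrow> continuous_on UNIV f"
| "C_plane (Suc k) f \<longleftrightarrow> (\<exists>f1 f2. C_plane k f1 \<and> C_plane k f2 \<and>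
     (\<forall>x. (f has_derivative (\<lambda>v. v $ 1 *\<^sub>R f1 x + v $ 2 *\<^sub>R f2 x)) (at x)))"

lemma C_plane_SucI:
  assumes "C_plane k f1" "C_plane k f2"
    and "\<And>x. (f has_derivative (\<lambda>v. v $ 1 *\<^sub>R f1 x + v $ 2 *\<^sub>R f2 x)) (at x)"
  shows "C_plane (Suc k) f"
  using assms by auto

lemma C_plane_continuous: "C_plane k f \<Longrightarrow> continuous_on UNIV f"
proof (cases k)
  case (Suc m)
  assume "C_plane k f"
  then have "\<forall>x. \<exists>f'. (f has_derivative f') (at x)" using Suc by auto
  then show ?thesis
    by (auto intro!: continuous_at_imp_continuous_on dest: has_derivative_continuous)
qed simp

lemma C_plane_Suc_weaken: "C_plane (Suc k) f \<Longrightarrow> C_plane k f"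
proof (induction k arbitrary: f)
  case 0
  then show ?case using C_plane_continuous by fastforce
next
  case (Suc k)
  from Suc.prems obtain f1 f2 where f: "C_plane (Suc k) f1" "C_plane (Suc k) f2"
    and d: "\<And>x. (f has_derivative (\<lambda>v. v $ 1 *\<^sub>R f1 x + v $ 2 *\<^sub>R f2 x)) (at x)"
    unfolding C_plane.simps(2)[of "Suc k"] by blast
  show ?case by (rule C_plane_SucI[OF Suc.IH[OF f(1)] Suc.IH[OF f(2)] d])
qed

lemma C_plane_const: "C_plane k (\<lambda>x. a)"
proof (induction k arbitrary: a)
  case (Suc k)
  show ?case
    by (rule C_plane_SucI[OF Suc.IH[of 0] Suc.IH[of 0]]) (auto intro!: derivative_eq_intros)
qed simp

lemma has_derivative_coord: "((\<lambda>x::real^2. x $ i) has_derivative (\<lambda>v. v $ i)) (at x within S)"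
  by (rule bounded_linear.has_derivative[OF bounded_linear_vec_nth has_derivative_ident])

lemma C_plane_coord: "C_plane k (\<lambda>x. x $ i)"
proof (cases k)
  case 0
  then show ?thesis by (auto intro!: continuous_intros)
next
  case (Suc m)
  have "i = 1 \<or> i = 2" using exhaust_2 by blast
  then show ?thesis
    unfolding Suc
    by (intro C_plane_SucI[where ?f1.0="\<lambda>x. if i = 1 then 1 else 0"
        and ?f2.0="\<lambda>x. if i = 2 then 1 else 0"] C_plane_const)
      (auto intro!: has_derivative_eq_rhs[OF has_derivative_coord])
qed

lemma C_plane_add:
  "C_plane k f \<Longrightarrow> C_plane k g \<Longrightarrow> C_plane k (\<lambda>x. f x + g x)"
proof (induction k arbitrary: f g)
  case 0
  then show ?case by (auto intro!: continuous_intros)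
next
  case (Suc k)
  from Suc.prems obtain f1 f2 g1 g2 where c: "C_plane k f1" "C_plane k f2" "C_plane k g1" "C_plane k g2"
    and d: "\<And>x. (f has_derivative (\<lambda>v. v $ 1 *\<^sub>R f1 x + v $ 2 *\<^sub>R f2 x)) (at x)"
      "\<And>x. (g has_derivative (\<lambda>v. v $ 1 *\<^sub>R g1 x + v $ 2 *\<^sub>R g2 x)) (at x)"
    by auto
  show ?case
    by (rule C_plane_SucI[OF Suc.IH[OF c(1,3)] Suc.IH[OF c(2,4)]])
      (rule has_derivative_eq_rhs[OF has_derivative_add[OF d]], auto simp: algebra_simps)
qed

lemma C_plane_scaleR:
  fixes f :: "real^2 \<Rightarrow> real"
  shows "C_plane k f \<Longrightarrow> C_plane k g \<Longrightarrow> C_plane k (\<lambda>x. f x *\<^sub>R g x)"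
proof (induction k arbitrary: f g)
  case 0
  then show ?case by (auto intro!: continuous_intros)
next
  case (Suc k)
  from Suc.prems obtain f1 f2 g1 g2 where c: "C_plane k f1" "C_plane k f2" "C_plane k g1" "C_plane k g2"
    and d: "\<And>x. (f has_derivative (\<lambda>v. v $ 1 *\<^sub>R f1 x + v $ 2 *\<^sub>R f2 x)) (at x)"
      "\<And>x. (g has_derivative (\<lambda>v. v $ 1 *\<^sub>R g1 x + v $ 2 *\<^sub>R g2 x)) (at x)"
    by auto
  have fg: "C_plane k f" "C_plane k g" using Suc.prems C_plane_Suc_weaken by blast+
  show ?case
    by (rule C_plane_SucI[OF C_plane_add[OF Suc.IH[OF c(1) fg(2)] Suc.IH[OF fg(1) c(3)]]
         C_plane_add[OF Suc.IH[OF c(2) fg(2)] Suc.IH[OF fg(1) c(4)]]])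
      (rule has_derivative_eq_rhs[OF has_derivative_scaleR[OF d]], auto simp: algebra_simps)
qed

lemma C_plane_mult:
  fixes f g :: "real^2 \<Rightarrow> real"
  shows "C_plane k f \<Longrightarrow> C_plane k g \<Longrightarrow> C_plane k (\<lambda>x. f x * g x)"
  using C_plane_scaleR[of k f g] by simp

lemma C_plane_minus:
  fixes f :: "real^2 \<Rightarrow> real"
  shows "C_plane k f \<Longrightarrow> C_plane k (\<lambda>x. - f x)"
  using C_plane_mult[OF C_plane_const[of k "-1"], of f] by simp

lemma C_plane_diff:
  fixes f g :: "real^2 \<Rightarrow> real"
  shows "C_plane k f \<Longrightarrow> C_plane k g \<Longrightarrow> C_plane k (\<lambda>x. f x - g x)"
  using C_plane_add[OF _ C_plane_minus, of k f g] by simp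

lemma C_plane_inverse:
  fixes f :: "real^2 \<Rightarrow> real"
  assumes nz: "\<And>x. f x \<noteq> 0"
  shows "C_plane k f \<Longrightarrow> C_plane k (\<lambda>x. inverse (f x))"
proof (induction k)
  case 0
  then show ?case using nz by (auto intro!: continuous_intros)
next
  case (Suc k)
  from Suc.prems obtain f1 f2 where c: "C_plane k f1" "C_plane k f2"
    and d: "\<And>x. (f has_derivative (\<lambda>v. v $ 1 *\<^sub>R f1 x + v $ 2 *\<^sub>R f2 x)) (at x)"
    by auto
  have i: "C_plane k (\<lambda>x. inverse (f x))" using Suc C_plane_Suc_weaken by blast
  note ii = C_plane_minus[OF C_plane_mult[OF i i]]
  show ?case
    by (rule C_plane_SucI[OF C_plane_mult[OF c(1) ii] C_plane_mult[OF c(2) ii]])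
      (rule has_derivative_eq_rhs[OF Deriv.has_derivative_inverse[OF nz d]], auto simp: algebra_simps)
qed

lemma C_plane_divide:
  fixes f g :: "real^2 \<Rightarrow> real"
  shows "(\<And>x. g x \<noteq> 0) \<Longrightarrow> C_plane k f \<Longrightarrow> C_plane k g \<Longrightarrow> C_plane k (\<lambda>x. f x / g x)"
  using C_plane_mult[OF _ C_plane_inverse, of k f g] by (simp add: divide_inverse)

lemma C_plane_sqrt:
  fixes f :: "real^2 \<Rightarrow> real"
  assumes pos: "\<And>x. f x > 0"
  shows "C_plane k f \<Longrightarrow> C_plane k (\<lambda>x. sqrt (f x))"
proof (induction k)
  case 0
  then show ?case by (auto intro!: continuous_intros)
next
  case (Suc k)
  from Suc.prems obtain f1 f2 where c: "C_plane k f1" "C_plane k f2"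
    and d: "\<And>x. (f has_derivative (\<lambda>v. v $ 1 *\<^sub>R f1 x + v $ 2 *\<^sub>R f2 x)) (at x)"
    by auto
  have i: "C_plane k (\<lambda>x. sqrt (f x))" using Suc C_plane_Suc_weaken by blast
  have "2 * sqrt (f x) \<noteq> 0" for x using pos[of x] by simp
  note ii = C_plane_inverse[OF this C_plane_mult[OF C_plane_const i]]
  show ?case
    by (rule C_plane_SucI[OF C_plane_mult[OF c(1) ii] C_plane_mult[OF c(2) ii]])
      (rule has_derivative_eq_rhs[OF has_derivative_real_sqrt[OF pos d]], auto simp: algebra_simps)
qed

lemma C_plane_sin_cos:
  fixes f :: "real^2 \<Rightarrow> real"
  shows "C_plane k f \<Longrightarrow> C_plane k (\<lambda>x. sin (f x)) \<and> C_plane k (\<lambda>x. cos (f x))"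
proof (induction k)
  case 0
  then show ?case by (auto intro!: continuous_intros)
next
  case (Suc k)
  from Suc.prems obtain f1 f2 where c: "C_plane k f1" "C_plane k f2"
    and d: "\<And>x. (f has_derivative (\<lambda>v. v $ 1 *\<^sub>R f1 x + v $ 2 *\<^sub>R f2 x)) (at x)"
    by auto
  have i: "C_plane k (\<lambda>x. sin (f x))" "C_plane k (\<lambda>x. cos (f x))"
    using Suc C_plane_Suc_weaken by blast+
  note ii = C_plane_minus[OF i(1)]
  have "C_plane (Suc k) (\<lambda>x. sin (f x))"
    by (rule C_plane_SucI[OF C_plane_mult[OF c(1) i(2)] C_plane_mult[OF c(2) i(2)]])
      (rule has_derivative_eq_rhs[OF has_derivative_sin[OF d]], auto simp: algebra_simps)
  moreover have "C_plane (Suc k) (\<lambda>x. cos (f x))"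
    by (rule C_plane_SucI[OF C_plane_mult[OF c(1) ii] C_plane_mult[OF c(2) ii]])
      (rule has_derivative_eq_rhs[OF has_derivative_cos[OF d]], auto simp: algebra_simps)
  ultimately show ?case by blast
qed

lemma has_derivative_shift:
  fixes h :: "real \<Rightarrow> real"
  assumes "(h has_real_derivative h') (at (l - x $ 2))"
  shows "((\<lambda>x::real^2. h (l - x $ 2)) has_derivative (\<lambda>v. v $ 1 * 0 + v $ 2 * (- h'))) (at x within S)"
proof -
  have "((\<lambda>x::real^2. l - x $ 2) has_derivative (\<lambda>v. - v $ 2)) (at x within S)"
    by (rule has_derivative_eq_rhs[OF has_derivative_diff[OF has_derivative_const has_derivative_coord]]) simp
  from has_derivative_compose[OF this assms[unfolded has_field_derivative_def]]
  show ?thesis by (simp add: mult.commute)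
qed

text \<open>The longitude and the Jacobi field contain integrals; only their integrands are explicit.\<close>

lemma C_plane_primitive:
  fixes h h' :: "real \<Rightarrow> real"
  assumes "\<And>s. (h has_real_derivative h' s) (at s)"
    and "C_plane k (\<lambda>x. h' (l - x $ 2))"
  shows "C_plane k (\<lambda>x. h (l - x $ 2))"
proof -
  have "C_plane (Suc k) (\<lambda>x. h (l - x $ 2))"
    by (rule C_plane_SucI[OF C_plane_const[of k 0] C_plane_minus[OF assms(2)]])
      (use has_derivative_shift[OF assms(1)] in simp)
  then show ?thesis by (rule C_plane_Suc_weaken)
qed

text \<open>The iterated derivatives within the half-plane only see values on the half-plane, where they
  agree with those of the extension.\<close>

lemma C_plane_imp_Ck_on:
  assumes W: "openin (top_of_set half_plane) W"
  shows "C_plane k g \<Longrightarrow> (\<And>x. x \<in> W \<Longrightarrow> f x = g x) \<Longrightarrow> Ck_on k W f"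
proof (induction k arbitrary: f g)
  case 0
  then have "continuous_on W g" by (auto intro: continuous_on_subset)
  with 0(2) show ?case by (simp cong: continuous_on_cong)
next
  case (Suc k)
  from Suc.prems(1) obtain g1 g2 where c: "C_plane k g1" "C_plane k g2"
    and d: "\<And>x. (g has_derivative (\<lambda>v. v $ 1 *\<^sub>R g1 x + v $ 2 *\<^sub>R g2 x)) (at x)"
    by auto
  have D: "Dhp f x = (\<lambda>v. v $ 1 *\<^sub>R g1 x + v $ 2 *\<^sub>R g2 x)" if "x \<in> W" for x
    using W that Suc.prems(2) has_derivative_at_withinI[OF d] by (rule Dhp_cong_eqI)
  have "f differentiable_on W"
    unfolding differentiable_on_def
  proof
    fix x assume "x \<in> W"
    show "f differentiable at x within W"
      by (rule differentiableI, rule has_derivative_transform[OF \<open>x \<in> W\<close> Suc.prems(2)],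
          assumption, rule has_derivative_at_withinI[OF d])
  qed
  moreover have "Ck_on k W (pd 1 f)"
    by (rule Suc.IH[OF c(1)]) (auto simp: pd_def D axis_def)
  moreover have "Ck_on k W (pd 2 f)"
    by (rule Suc.IH[OF c(2)]) (auto simp: pd_def D axis_def)
  ultimately show ?case by (simp add: forall_2)
qed

lemma smooth_on_C_plane:
  assumes "openin (top_of_set half_plane) W"
    and "\<And>k. C_plane k g" "\<And>x. x \<in> W \<Longrightarrow> f x = g x"
  shows "smooth_on W f"
  using C_plane_imp_Ck_on[OF assms(1) assms(2) assms(3)] by (simp add: smooth_on_def)

section \<open>Charts of surfaces\<close>

text \<open>In the coordinates (angle of rotation, arc length) all the matrices involved are diagonal.\<close>

definition diag2 :: "real \<Rightarrow> real \<Rightarrow> real^2^2" where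
  "diag2 p q = (\<chi> i j. if i = j then (if i = 1 then p else q) else 0)"

lemma two_neq_one [simp]: "(2::2) \<noteq> 1" "(1::2) \<noteq> 2"
  by auto

lemma eq_diag2I:
  assumes "M $ 1 $ 1 = p" "M $ 1 $ 2 = 0" "M $ 2 $ 1 = 0" "M $ 2 $ 2 = q"
  shows "M = diag2 p q"
  using assms by (simp add: vec_eq_iff forall_2 diag2_def)

lemma diag2_mult: "diag2 p q ** diag2 p' q' = diag2 (p * p') (q * q')"
  by (rule eq_diag2I) (auto simp: matrix_matrix_mult_def sum_2 diag2_def)

lemma trace_diag2: "trace (diag2 p q) = p + q"
  by (simp add: trace_def sum_2 diag2_def)

lemma det_diag2: "det (diag2 p q) = p * q"
  by (simp add: det_2 diag2_def)

lemma matrix_inv_diag2: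
  assumes "p \<noteq> 0" "q \<noteq> 0"
  shows "matrix_inv (diag2 p q) = diag2 (1 / p) (1 / q)"
proof -
  have one: "mat 1 = diag2 1 1" by (simp add: vec_eq_iff forall_2 diag2_def mat_def)
  have r: "diag2 p q ** diag2 (1/p) (1/q) = mat 1" "diag2 (1/p) (1/q) ** diag2 p q = mat 1"
    using assms by (auto simp: diag2_mult one)
  have "matrix_inv (diag2 p q) ** diag2 p q = mat 1"
    unfolding matrix_inv_def by (rule someI2[where a="diag2 (1/p) (1/q)"]) (use r in auto)
  then have "matrix_inv (diag2 p q) ** (diag2 p q ** diag2 (1/p) (1/q)) = diag2 (1/p) (1/q)"
    by (simp add: matrix_mul_assoc matrix_mul_lid)
  then show ?thesis by (simp add: r matrix_mul_rid)
qed

lemma Dhp_chart: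
  assumes "surface_chart \<Sigma> W \<phi>" "x \<in> W"
  shows "(\<phi> has_derivative Dhp \<phi> x) (at x within W)"
proof -
  have "\<phi> differentiable_on W" "openin (top_of_set half_plane) W"
    using assms(1) unfolding surface_chart_def smooth_on_def by (metis Ck_on.simps(2), blast)
  then show ?thesis
    using assms(2) unfolding differentiable_on_def Dhp_def
    by (metis at_within_half_plane frechet_derivative_works)
qed

lemma chart_preimage_open:
  assumes \<phi>: "surface_chart \<Sigma> W \<phi>" and \<psi>: "surface_chart \<Sigma> V \<psi>"
  shows "openin (top_of_set half_plane) {z \<in> V. \<psi> z \<in> \<phi> ` W}"
proof -
  have c: "continuous_on V \<psi>" and sub: "\<psi> ` V \<subseteq> \<Sigma>"
    using \<psi> unfolding surface_chart_def homeomorphism_def by (auto dest: openin_imp_subset)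
  have "openin (top_of_set V) (V \<inter> \<psi> -` (\<phi> ` W))"
    by (rule continuous_openin_preimage[OF c, where T=\<Sigma>]) (use sub \<phi> in \<open>auto simp: surface_chart_def\<close>)
  moreover have "V \<inter> \<psi> -` (\<phi> ` W) = {z \<in> V. \<psi> z \<in> \<phi> ` W}" by auto
  ultimately show ?thesis
    using \<psi> openin_trans unfolding surface_chart_def by fastforce
qed

text \<open>The inverse of a chart is differentiable because the chart is an immersion and a
  homeomorphism. So one chart factors through the other by a differentiable transition map, and the
  chain rule compares the images of their derivatives.\<close>

lemma chart_range_subset:
  assumes \<phi>: "chart_at \<Sigma> p W \<phi> x" and \<psi>: "chart_at \<Sigma> p V \<psi> y"
  shows "range (Dhp \<psi> y) \<subseteq> range (Dhp \<phi> x)"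
proof -
  have c\<phi>: "surface_chart \<Sigma> W \<phi>" "x \<in> W" "\<phi> x = p"
    and c\<psi>: "surface_chart \<Sigma> V \<psi>" "y \<in> V" "\<psi> y = p"
    using assms by (auto simp: chart_at_def)
  obtain g where g: "homeomorphism W (\<phi> ` W) \<phi> g"
    using c\<phi>(1) by (auto simp: surface_chart_def)
  then have gc: "continuous_on (\<phi> ` W) g" and gl: "\<And>z. z \<in> W \<Longrightarrow> g (\<phi> z) = z"
    by (auto simp: homeomorphism_def)
  note D\<phi> = Dhp_chart[OF c\<phi>(1,2)]
  have "inj (Dhp \<phi> x)" "linear (Dhp \<phi> x)"
    using c\<phi> D\<phi> has_derivative_linear by (auto simp: surface_chart_def)
  then obtain g' where g': "linear g'" "g' \<circ> Dhp \<phi> x = id"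
    using linear_injective_left_inverse by blast
  have Dg: "(g has_derivative g') (at (\<phi> x) within \<phi> ` W)"
    by (rule has_derivative_inverse_within[OF D\<phi> _ c\<phi>(2) g' gl])
       (use gc c\<phi>(2) in \<open>auto simp: continuous_on_eq_continuous_within\<close>)
  define V' where "V' = {z \<in> V. \<psi> z \<in> \<phi> ` W}"
  have V': "openin (top_of_set half_plane) V'" "y \<in> V'"
    using chart_preimage_open[OF c\<phi>(1) c\<psi>(1)] c\<phi> c\<psi> by (auto simp: V'_def)
  have D\<psi>: "(\<psi> has_derivative Dhp \<psi> y) (at y within V')"
    using Dhp_chart[OF c\<psi>(1,2)] by (rule has_derivative_subset) (auto simp: V'_def)
  have "(g has_derivative g') (at (\<psi> y) within \<psi> ` V')"
    using Dg c\<phi>(3) c\<psi>(3) by (auto intro: has_derivative_subset simp: V'_def)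
  from diff_chain_within[OF D\<psi> this]
  have Dt: "((g \<circ> \<psi>) has_derivative (g' \<circ> Dhp \<psi> y)) (at y within V')" .
  have ty: "(g \<circ> \<psi>) y = x" using gl c\<phi> c\<psi> by auto
  have tW: "(g \<circ> \<psi>) ` V' \<subseteq> W" using gl by (auto simp: V'_def)
  have "(\<phi> has_derivative Dhp \<phi> x) (at ((g \<circ> \<psi>) y) within (g \<circ> \<psi>) ` V')"
    unfolding ty by (rule has_derivative_subset[OF D\<phi> tW])
  from diff_chain_within[OF Dt this]
  have "((\<phi> \<circ> (g \<circ> \<psi>)) has_derivative (Dhp \<phi> x \<circ> (g' \<circ> Dhp \<psi> y))) (at y within V')" .
  then have "((\<phi> \<circ> (g \<circ> \<psi>)) has_derivative (Dhp \<phi> x \<circ> (g' \<circ> Dhp \<psi> y))) (at y within half_plane)"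
    by (simp add: at_within_half_plane[OF V'])
  moreover have "\<psi> z = (\<phi> \<circ> (g \<circ> \<psi>)) z" if "z \<in> V'" for z
    using that gl by (auto simp: V'_def)
  ultimately have "Dhp \<psi> y = Dhp \<phi> x \<circ> (g' \<circ> Dhp \<psi> y)"
    by (intro Dhp_cong_eqI[OF V'])
  then show ?thesis by (metis (no_types, lifting) comp_apply image_subsetI rangeI)
qed

text \<open>Near such a point a transition map would send an open subset of the plane homeomorphically onto a
  subset of the half-plane containing a point of the boundary line. Invariance of domain forbids
  this.\<close>

lemma interior_not_surface_boundary:
  assumes \<phi>: "chart_at \<Sigma> p W \<phi> x" and pos: "0 < x $ 2"
  shows "p \<notin> surface_boundary \<Sigma>"
proof
  assume "p \<in> surface_boundary \<Sigma>"
  then obtain V \<psi> y where \<psi>: "chart_at \<Sigma> p V \<psi> y" and y0: "y $ 2 = 0"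
    by (auto simp: surface_boundary_def)
  have c\<phi>: "surface_chart \<Sigma> W \<phi>" "x \<in> W" "\<phi> x = p"
    and c\<psi>: "surface_chart \<Sigma> V \<psi>" "y \<in> V" "\<psi> y = p"
    using \<phi> \<psi> by (auto simp: chart_at_def)
  obtain h where h: "homeomorphism V (\<psi> ` V) \<psi> h"
    using c\<psi>(1) by (auto simp: surface_chart_def)
  obtain k where k: "homeomorphism W (\<phi> ` W) \<phi> k"
    using c\<phi>(1) by (auto simp: surface_chart_def)
  define U where "U = {z \<in> W. \<phi> z \<in> \<psi> ` V} \<inter> {z. 0 < z $ 2}"
  obtain T where T: "open T" "{z \<in> W. \<phi> z \<in> \<psi> ` V} = half_plane \<inter> T"
    using chart_preimage_open[OF c\<psi>(1) c\<phi>(1)] by (auto simp: openin_open)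
  have "U = T \<inter> {z. 0 < z $ 2}"
    unfolding U_def T(2) by (auto simp: half_plane_def)
  then have "open U" using T(1) by (simp add: open_Int open_halfspace_component_gt_cart)
  moreover have "continuous_on U (h \<circ> \<phi>)"
    using h k by (intro continuous_on_compose)
      (auto simp: U_def homeomorphism_def intro: continuous_on_subset)
  moreover have "inj_on (h \<circ> \<phi>) U"
    using h k by (intro inj_onI) (auto simp: U_def homeomorphism_def, metis)
  ultimately have "open ((h \<circ> \<phi>) ` U)" by (intro invariance_of_domain)
  moreover have "y \<in> (h \<circ> \<phi>) ` U"
  proof (rule image_eqI)
    show "y = (h \<circ> \<phi>) x" using h c\<phi> c\<psi> by (auto simp: homeomorphism_def)
    have "\<phi> x \<in> \<psi> ` V" using c\<phi> c\<psi> by (metis imageI)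
    then show "x \<in> U" using c\<phi> pos by (simp add: U_def)
  qed
  ultimately obtain e where e: "e > 0" "ball y e \<subseteq> (h \<circ> \<phi>) ` U"
    by (meson open_contains_ball)
  have "(h \<circ> \<phi>) ` U \<subseteq> V" using h by (auto simp: U_def homeomorphism_def)
  moreover have "V \<subseteq> half_plane"
    using c\<psi>(1) by (auto simp: surface_chart_def dest: openin_imp_subset)
  moreover have "y - (e/2) *\<^sub>R axis 2 1 \<in> ball y e"
    using e(1) by (simp add: dist_norm norm_axis_1)
  ultimately have "y - (e/2) *\<^sub>R axis 2 1 \<in> half_plane" using e(2) by blast
  then show False using e(1) y0 by (simp add: half_plane_def axis_def)
qed

section \<open>Killing fields of the sphere\<close>

text \<open>A Killing field has constant scalar product with the velocity of a geodesic: the derivative of the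
  product is \<open>\<langle>\<nabla>\<^sub>\<gamma>\<^sub>' Z, \<gamma>'\<rangle> - \<langle>Z, \<gamma>\<rangle>\<close>, and both terms vanish.\<close>

lemma killing_geodesic:
  assumes Z: "killing_field Z" and n: "norm p = 1" "norm w = 1" and o: "p \<bullet> w = 0"
  shows "Z (cos t *\<^sub>R p + sin t *\<^sub>R w) \<bullet> (cos t *\<^sub>R w - sin t *\<^sub>R p) = Z p \<bullet> w"
proof -
  define \<gamma> where "\<gamma> t = cos t *\<^sub>R p + sin t *\<^sub>R w" for t :: real
  define \<gamma>' where "\<gamma>' t = cos t *\<^sub>R w - sin t *\<^sub>R p" for t :: real
  have pp: "p \<bullet> p = 1" "w \<bullet> w = 1" "w \<bullet> p = 0" using n o by (simp_all add: dot_square_norm inner_commute)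
  have d1: "(\<gamma> has_vector_derivative \<gamma>' t) (at t)" for t
    unfolding \<gamma>_def \<gamma>'_def by (auto intro!: derivative_eq_intros simp: has_vector_derivative_def algebra_simps)
  have d2: "(\<gamma>' has_vector_derivative - \<gamma> t) (at t)" for t
    unfolding \<gamma>_def \<gamma>'_def by (auto intro!: derivative_eq_intros simp: has_vector_derivative_def algebra_simps)
  have "\<gamma> t \<bullet> \<gamma> t = cos t ^ 2 + sin t ^ 2" for t
    by (simp add: \<gamma>_def inner_simps pp o power2_eq_square)
  then have S: "\<gamma> t \<in> S3" for t by (simp add: S3_def norm_eq_1)
  have t: "\<gamma>' t \<bullet> \<gamma> t = 0" for t
    by (simp add: \<gamma>_def \<gamma>'_def inner_simps pp o)
  have "((\<lambda>t. Z (\<gamma> t) \<bullet> \<gamma>' t) has_real_derivative 0) (at t)" for t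
  proof -
    have mult0: "(\<lambda>h::real. 0) = (*) (0::real)" by auto
    obtain Z' where Z': "(Z has_derivative Z') (at (\<gamma> t) within S3)"
      and sk: "\<And>v w. v \<bullet> \<gamma> t = 0 \<Longrightarrow> w \<bullet> \<gamma> t = 0 \<Longrightarrow> Z' v \<bullet> w + Z' w \<bullet> v = 0"
      using Z S[of t] unfolding killing_field_def by blast
    have zt: "Z (\<gamma> t) \<bullet> \<gamma> t = 0" using Z S[of t] unfolding killing_field_def by blast
    have "(Z has_derivative Z') (at (\<gamma> t) within \<gamma> ` UNIV)"
      by (rule has_derivative_subset[OF Z']) (use S in auto)
    from diff_chain_within[OF d1[unfolded has_vector_derivative_def] this]
    have dZ: "((\<lambda>t. Z (\<gamma> t)) has_derivative (\<lambda>h. Z' (h *\<^sub>R \<gamma>' t))) (at t)"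
      by (simp add: o_def)
    have lin: "Z' (h *\<^sub>R \<gamma>' t) = h *\<^sub>R Z' (\<gamma>' t)" for h
      using Z' has_derivative_linear linear_cmul by blast
    have z0: "Z' (\<gamma>' t) \<bullet> \<gamma>' t = 0" using sk[OF t t] by simp
    have "((\<lambda>t. Z (\<gamma> t) \<bullet> \<gamma>' t) has_derivative (\<lambda>h. 0)) (at t)"
      by (rule has_derivative_eq_rhs[OF has_derivative_inner[OF dZ d2[unfolded has_vector_derivative_def]]])
         (auto simp: lin z0 zt)
    then show ?thesis by (simp add: has_field_derivative_def mult0)
  qed
  then have "(\<lambda>t. Z (\<gamma> t) \<bullet> \<gamma>' t) t = (\<lambda>t. Z (\<gamma> t) \<bullet> \<gamma>' t) 0"
    by (intro DERIV_isconst_all) blast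
  then show ?thesis by (simp add: \<gamma>_def \<gamma>'_def)
qed

text \<open>Compare the two ends of the great circle arc from \<open>p\<close> to \<open>q\<close>, where the velocities are
  multiples of \<open>q - cos L p\<close> and \<open>cos L q - p\<close>. The identity makes \<open>Z\<close> the restriction of a skew
  linear map.\<close>

lemma killing_skew:
  assumes Z: "killing_field Z" and pq: "p \<in> S3" "q \<in> S3"
  shows "Z p \<bullet> q = - (Z q \<bullet> p)"
proof (cases "\<bar>p \<bullet> q\<bar> = 1")
  case True
  have pp: "p \<bullet> p = 1" "q \<bullet> q = 1" using pq by (auto simp: S3_def dot_square_norm)
  have "q = p \<or> q = - p"
  proof (cases "p \<bullet> q = 1")
    case True
    then have "(p - q) \<bullet> (p - q) = 0" by (simp add: inner_simps pp inner_commute)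
    then show ?thesis by simp
  next
    case False
    then have "p \<bullet> q = -1" using \<open>\<bar>p \<bullet> q\<bar> = 1\<close> by linarith
    then have "(p + q) \<bullet> (p + q) = 0" by (simp add: inner_simps pp inner_commute)
    then have "p + q = 0" by (simp only: inner_eq_zero_iff)
    then show ?thesis by (simp add: eq_neg_iff_add_eq_0 add.commute)
  qed
  moreover have "Z p \<bullet> p = 0" "Z q \<bullet> q = 0" using Z pq unfolding killing_field_def by auto
  ultimately show ?thesis by auto
next
  case False
  have pp: "p \<bullet> p = 1" "q \<bullet> q = 1" using pq by (auto simp: S3_def dot_square_norm)
  have "\<bar>p \<bullet> q\<bar> \<le> 1"
    using Cauchy_Schwarz_ineq2[of p q] pq by (simp add: S3_def)
  then have lt: "-1 < p \<bullet> q" "p \<bullet> q < 1" using False by linarith+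
  define L where "L = arccos (p \<bullet> q)"
  have cL: "cos L = p \<bullet> q" and sL: "sin L > 0"
    using lt arccos_lt_bounded[OF lt] by (auto simp: L_def cos_arccos sin_gt_zero)
  define w where "w = (1 / sin L) *\<^sub>R (q - cos L *\<^sub>R p)"
  have q: "q = cos L *\<^sub>R p + sin L *\<^sub>R w" using sL by (simp add: w_def)
  have "(q - cos L *\<^sub>R p) \<bullet> (q - cos L *\<^sub>R p) = 1 - (cos L)^2"
    by (simp add: inner_simps pp inner_commute cL power2_eq_square)
  then have ww: "w \<bullet> w = 1"
    using sL sin_cos_squared_add[of L] by (simp add: w_def power2_eq_square)
  have pw: "p \<bullet> w = 0" by (simp add: w_def inner_simps pp cL)
  have 1: "Z q \<bullet> (cos L *\<^sub>R w - sin L *\<^sub>R p) = Z p \<bullet> w"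
    unfolding q by (rule killing_geodesic[OF Z _ _ pw]) (use pp ww in \<open>auto simp: norm_eq_1\<close>)
  have 2: "cos L *\<^sub>R w - sin L *\<^sub>R p = (1 / sin L) *\<^sub>R (cos L *\<^sub>R q - p)"
  proof -
    have "sin L *\<^sub>R (cos L *\<^sub>R w - sin L *\<^sub>R p) = cos L *\<^sub>R (sin L *\<^sub>R w) - (sin L)^2 *\<^sub>R p"
      by (simp add: algebra_simps power2_eq_square)
    also have "sin L *\<^sub>R w = q - cos L *\<^sub>R p" using q by simp
    also have "cos L *\<^sub>R (q - cos L *\<^sub>R p) - (sin L)^2 *\<^sub>R p = cos L *\<^sub>R q - ((cos L)^2 + (sin L)^2) *\<^sub>R p"
      by (simp only: scaleR_diff_right scaleR_scaleR scaleR_add_left power2_eq_square diff_diff_eq)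
    also have "\<dots> = cos L *\<^sub>R q - p" by (simp only: sin_cos_squared_add2 scaleR_one)
    finally have *: "sin L *\<^sub>R (cos L *\<^sub>R w - sin L *\<^sub>R p) = cos L *\<^sub>R q - p" .
    show ?thesis unfolding *[symmetric] using sL by simp
  qed
  have "Z q \<bullet> q = 0" "Z p \<bullet> p = 0" using Z pq unfolding killing_field_def by auto
  then have "- (Z q \<bullet> p) / sin L = Z p \<bullet> q / sin L"
    using 1[unfolded 2] by (simp add: w_def inner_simps)
  then show ?thesis using sL by (simp add: divide_simps)
qed

section \<open>Rotational annuli with free boundary\<close>

definition pt :: "real \<Rightarrow> real \<Rightarrow> real^2" where
  "pt x y = (\<chi> i. if i = 1 then x else y)"

lemma pt_nth [simp]: "pt x y $ 1 = x" "pt x y $ 2 = y"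
  by (simp_all add: pt_def)

lemma pt_eq_iff: "z = pt x y \<longleftrightarrow> z $ 1 = x \<and> z $ 2 = y"
  by (simp add: vec_eq_iff forall_2)

lemma continuous_on_pt:
  "continuous_on A f \<Longrightarrow> continuous_on A g \<Longrightarrow> continuous_on A (\<lambda>z. pt (f z) (g z))"
  unfolding pt_def
proof (rule continuous_on_vec_lambda)
  fix i :: 2
  assume "continuous_on A f" "continuous_on A g"
  then show "continuous_on A (\<lambda>x. if i = 1 then f x else g x)" by (cases "i = 1") simp_all
qed

lemma pt_sphere: "z \<in> sphere 0 1 \<longleftrightarrow> (z $ 1)^2 + (z $ 2)^2 = 1" for z :: "real^2"
  by (simp add: norm_vec_def L2_set_def sum_2)

text \<open>What the geometry needs from a profile curve. Here \<open>(a, b)\<close> is the position in the plane that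
  contains the axis, \<open>R\<close> the radius of the parallels, \<open>P = R'\<close>, and \<open>c\<close> the conserved flux. The
  formulas for the derivatives of \<open>a\<close>, \<open>b\<close>, \<open>P\<close> and the first integral say that \<open>s\<close> is arc length and
  that the rotational surface is minimal; the equation for \<open>f\<close> is the Jacobi equation for functions of
  \<open>s\<close>, since \<open>|A|\<^sup>2 = 2 c\<^sup>2 / R\<^sup>4\<close>. The three conditions in \<open>free_boundary\<close> make the geodesic tangent to the profile at
  \<open>s = l\<close> pass through \<open>e1\<close>.\<close>

locale free_boundary_annulus =
  fixes e1 e2 e3 e4 :: "real^4" and c l r :: real and R P a b f f1 :: "real \<Rightarrow> real"
  assumes frame: "e1 \<bullet> e1 = 1" "e2 \<bullet> e2 = 1" "e3 \<bullet> e3 = 1" "e4 \<bullet> e4 = 1"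
      "e1 \<bullet> e2 = 0" "e1 \<bullet> e3 = 0" "e1 \<bullet> e4 = 0" "e2 \<bullet> e3 = 0" "e2 \<bullet> e4 = 0" "e3 \<bullet> e4 = 0"
    and l_pos: "0 < l" and R_pos: "\<And>s. 0 < R s" and R_less: "\<And>s. R s < 1"
    and dR: "\<And>s. (R has_real_derivative P s) (at s)"
    and dP: "\<And>s. (P has_real_derivative - R s + c^2 / R s ^ 3) (at s)"
    and da: "\<And>s. (a has_real_derivative - (R s * P s * a s + c / R s * b s) / (1 - (R s)^2)) (at s)"
    and db: "\<And>s. (b has_real_derivative (c / R s * a s - R s * P s * b s) / (1 - (R s)^2)) (at s)"
    and circle: "\<And>s. (a s)^2 + (b s)^2 = 1 - (R s)^2"
    and first_integral: "\<And>s. (R s * P s)^2 = (R s)^2 * (1 - (R s)^2) - c^2"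
    and df: "\<And>s. (f has_real_derivative f1 s) (at s)"
    and df1: "\<And>s. (f1 has_real_derivative - (P s / R s) * f1 s - (2 * c^2 / R s ^ 4 + 2) * f s) (at s)"
    and parity: "\<And>s. R (- s) = R s" "\<And>s. P (- s) = - P s" "\<And>s. a (- s) = a s"
      "\<And>s. b (- s) = - b s" "\<And>s. f (- s) = f s"
    and smooth: "\<And>k. C_plane k (\<lambda>x. R (l - x $ 2))" "\<And>k. C_plane k (\<lambda>x. a (l - x $ 2))"
      "\<And>k. C_plane k (\<lambda>x. b (l - x $ 2))" "\<And>k. C_plane k (\<lambda>x. f (l - x $ 2))"
    and injective: "inj_on (\<lambda>s. (a s, b s)) {-l..l}"
    and r_bounds: "0 < r" "r < pi"
    and inside: "\<And>s. \<bar>s\<bar> \<le> l \<Longrightarrow> cos r \<le> a s"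
    and free_boundary: "a l = cos r" "P l = cot r * R l" "c * sin r = R l * b l"
    and robin: "f1 l = cot r * f l"
    and f_0: "f 0 \<noteq> 0"
begin

lemma frame_swap: "e2 \<bullet> e1 = 0" "e3 \<bullet> e1 = 0" "e4 \<bullet> e1 = 0" "e3 \<bullet> e2 = 0" "e4 \<bullet> e2 = 0" "e4 \<bullet> e3 = 0"
  using frame by (simp_all add: inner_commute)

definition vec4 :: "real \<Rightarrow> real \<Rightarrow> real \<Rightarrow> real \<Rightarrow> real^4" where
  "vec4 x y z w = x *\<^sub>R e1 + y *\<^sub>R e2 + z *\<^sub>R e3 + w *\<^sub>R e4"

lemma inner_vec4: "vec4 x y z w \<bullet> vec4 x' y' z' w' = x * x' + y * y' + z * z' + w * w'"
  by (simp add: vec4_def inner_simps frame frame_swap)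

lemma vec4_inject: "vec4 x y z w = vec4 x' y' z' w' \<longleftrightarrow> x = x' \<and> y = y' \<and> z = z' \<and> w = w'"
proof
  assume eq: "vec4 x y z w = vec4 x' y' z' w'"
  have "vec4 x y z w \<bullet> u = vec4 x' y' z' w' \<bullet> u" for u using eq by simp
  from this[of "vec4 1 0 0 0"] this[of "vec4 0 1 0 0"] this[of "vec4 0 0 1 0"] this[of "vec4 0 0 0 1"]
  show "x = x' \<and> y = y' \<and> z = z' \<and> w = w'" by (simp add: inner_vec4)
qed simp

lemma continuous_on_vec4:
  assumes "continuous_on A x" "continuous_on A y" "continuous_on A z" "continuous_on A w"
  shows "continuous_on A (\<lambda>p. vec4 (x p) (y p) (z p) (w p))"
  unfolding vec4_def using assms by (intro continuous_intros)

lemma has_derivative_vec4: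
  assumes "(x has_derivative (\<lambda>v. v $ 1 * x1 + v $ 2 * x2)) F" "(y has_derivative (\<lambda>v. v $ 1 * y1 + v $ 2 * y2)) F"
    "(z has_derivative (\<lambda>v. v $ 1 * z1 + v $ 2 * z2)) F" "(w has_derivative (\<lambda>v. v $ 1 * w1 + v $ 2 * w2)) F"
  shows "((\<lambda>p. vec4 (x p) (y p) (z p) (w p)) has_derivative
    (\<lambda>v::real^2. v $ 1 *\<^sub>R vec4 x1 y1 z1 w1 + v $ 2 *\<^sub>R vec4 x2 y2 z2 w2)) F"
  unfolding vec4_def
  by (rule has_derivative_eq_rhs[OF has_derivative_add[OF has_derivative_add[OF has_derivative_add[OF
        has_derivative_scaleR_left[OF assms(1)] has_derivative_scaleR_left[OF assms(2)]]
        has_derivative_scaleR_left[OF assms(3)]] has_derivative_scaleR_left[OF assms(4)]]])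
     (auto simp: algebra_simps)

lemma C_plane_vec4:
  assumes "C_plane k x" "C_plane k y" "C_plane k z" "C_plane k w"
  shows "C_plane k (\<lambda>p. vec4 (x p) (y p) (z p) (w p))"
  unfolding vec4_def by (intro C_plane_add C_plane_scaleR C_plane_const assms)

text \<open>In the plane with orthonormal basis \<open>e1\<close>, \<open>e2\<close>: velocity \<open>(a1, b1)\<close> and acceleration \<open>(a2, b2)\<close> of the
  profile, and the component \<open>(F1, F2)\<close> of its unit normal.\<close>

definition "a1 s = - (R s * P s * a s + c / R s * b s) / (1 - (R s)^2)"
definition "b1 s = (c / R s * a s - R s * P s * b s) / (1 - (R s)^2)"
definition "a2 s = - (P s / R s) * a1 s - 2 * a s"
definition "b2 s = - (P s / R s) * b1 s - 2 * b s"
definition "F1 s = (P s * b s - c * a s) / (1 - (R s)^2)"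
definition "F2 s = - (P s * a s + c * b s) / (1 - (R s)^2)"

lemma R_nz: "R s \<noteq> 0" and R2_less: "0 < 1 - (R s)^2"
  using R_pos[of s] R_less[of s] by (auto simp: abs_square_less_1)

lemma P_sq: "(P s)^2 = 1 - (R s)^2 - c^2 / (R s)^2"
proof -
  have "(R s)^2 * (P s)^2 = (R s)^2 * (1 - (R s)^2) - c^2" using first_integral by (simp add: power_mult_distrib)
  also have "\<dots> = (R s)^2 * (1 - (R s)^2 - c^2 / (R s)^2)" using R_nz by (simp add: field_simps)
  finally show ?thesis using R_nz by simp
qed

lemma tangent_unit: "(a1 s)^2 + (b1 s)^2 + (P s)^2 = 1"
proof -
  define X where "X = 1 - (R s)^2"
  have X: "X > 0" using R2_less by (simp add: X_def)
  have "(a1 s)^2 + (b1 s)^2 = (((R s * P s)^2 + (c / R s)^2) * ((a s)^2 + (b s)^2)) / X^2"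
    unfolding a1_def b1_def X_def[symmetric] power_divide add_divide_distrib[symmetric]
    by (rule arg_cong2[where f="(/)"]) (simp_all add: power2_eq_square algebra_simps)
  also have "\<dots> = ((R s * P s)^2 + (c / R s)^2) / X"
    unfolding circle X_def[symmetric] using X by (simp add: power2_eq_square)
  also have "(R s * P s)^2 + (c / R s)^2 = X * ((R s)^2 + c^2 / (R s)^2)"
    unfolding first_integral using R_nz[of s] by (simp add: X_def field_simps power2_eq_square)
  finally show ?thesis using X P_sq[of s] by simp
qed

lemma normal_unit: "(F1 s)^2 + (F2 s)^2 + (c / R s)^2 = 1"
proof -
  define X where "X = 1 - (R s)^2"
  have X: "X > 0" using R2_less by (simp add: X_def)
  have "(F1 s)^2 + (F2 s)^2 = (((P s)^2 + c^2) * ((a s)^2 + (b s)^2)) / X^2"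
    unfolding F1_def F2_def X_def[symmetric] power_divide add_divide_distrib[symmetric]
    by (rule arg_cong2[where f="(/)"]) (simp_all add: power2_eq_square algebra_simps)
  also have "\<dots> = ((P s)^2 + c^2) / X"
    unfolding circle X_def[symmetric] using X by (simp add: power2_eq_square)
  also have "(P s)^2 + c^2 = X * (1 - c^2 / (R s)^2)"
    unfolding P_sq using R_nz[of s] by (simp add: X_def field_simps power2_eq_square)
  finally show ?thesis using X by (simp add: power_divide)
qed

lemma normal_position: "F1 s * a s + F2 s * b s = - c"
proof -
  define X where "X = 1 - (R s)^2"
  have X: "X > 0" using R2_less by (simp add: X_def)
  have "F1 s * a s + F2 s * b s = - c * ((a s)^2 + (b s)^2) / X"
    unfolding F1_def F2_def X_def[symmetric] times_divide_eq_left add_divide_distrib[symmetric]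
    by (rule arg_cong2[where f="(/)"]) (simp_all add: power2_eq_square algebra_simps)
  then show ?thesis unfolding circle X_def[symmetric] using X by simp
qed

lemma normal_tangent: "F1 s * a1 s + F2 s * b1 s = - (P s * c / R s)"
proof -
  define X where "X = 1 - (R s)^2"
  have X: "X > 0" using R2_less by (simp add: X_def)
  have "F1 s * a1 s + F2 s * b1 s = ((c * R s * P s - P s * c / R s) * ((a s)^2 + (b s)^2)) / (X * X)"
    unfolding F1_def F2_def a1_def b1_def X_def[symmetric] times_divide_times_eq add_divide_distrib[symmetric]
    by (rule arg_cong2[where f="(/)"]) (simp_all add: power2_eq_square algebra_simps)
  also have "c * R s * P s - P s * c / R s = - (P s * c / R s) * X"
    using R_nz[of s] by (simp add: X_def field_simps power2_eq_square)
  finally show ?thesis unfolding circle X_def[symmetric] using X by simp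
qed

lemma position_unit: "(a s)^2 + (b s)^2 + (R s)^2 = 1"
  using circle[of s] by simp

lemma DERIV_a: "(a has_real_derivative a1 s) (at s)" and DERIV_b: "(b has_real_derivative b1 s) (at s)"
  using da db by (simp_all add: a1_def b1_def)

text \<open>Coordinate functions of a minimal surface in the sphere satisfy \<open>\<Delta> x = -2 x\<close>, which for
  functions of arc length reads \<open>x'' + (P / R) x' + 2 x = 0\<close>. The system is invariant under the
  quarter turn \<open>(a, b) \<mapsto> (b, -a)\<close>, so one computation serves both coordinates.\<close>

lemma DERIV_plane_coordinate:
  fixes p q :: "real \<Rightarrow> real"
  assumes dp: "\<And>s. (p has_real_derivative p1 s) (at s)" and dq: "\<And>s. (q has_real_derivative q1 s) (at s)"
    and p1: "\<And>s. p1 s = - (R s * P s * p s + c / R s * q s) / (1 - (R s)^2)"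
    and q1: "\<And>s. q1 s = (c / R s * p s - R s * P s * q s) / (1 - (R s)^2)"
  shows "(p1 has_real_derivative - (P s / R s) * p1 s - 2 * p s) (at s)"
proof -
  define X where "X = 1 - (R s)^2"
  have X: "X > 0" using R2_less by (simp add: X_def)
  define N where "N = - (P s * P s * p s + R s * (- R s + c^2 / R s ^ 3) * p s + R s * P s * p1 s
      + (- c * P s / (R s)^2 * q s + c / R s * q1 s))"
  have num: "((\<lambda>s. - (R s * P s * p s + c / R s * q s)) has_real_derivative N) (at s)"
  proof -
    have cR: "((\<lambda>s. c / R s) has_real_derivative - c * P s / (R s)^2) (at s)"
      using R_nz[of s] by (auto intro!: derivative_eq_intros dR simp: power2_eq_square)
    show ?thesis
      by (rule DERIV_cong[OF DERIV_minus[OF DERIV_add[OF DERIV_mult[OF DERIV_mult[OF dR dP] dp] DERIV_mult[OF cR dq]]]])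
         (simp add: N_def algebra_simps)
  qed
  have den: "((\<lambda>s. 1 - (R s)^2) has_real_derivative - (2 * R s * P s)) (at s)"
    by (auto intro!: derivative_eq_intros dR)
  have "(p1 has_real_derivative (N * X - (- (R s * P s * p s + c / R s * q s)) * (- (2 * R s * P s))) / (X * X)) (at s)"
    unfolding p1[abs_def] X_def by (rule DERIV_divide[OF num den]) (use X in \<open>simp add: X_def\<close>)
  moreover have "(N * X - (- (R s * P s * p s + c / R s * q s)) * (- (2 * R s * P s))) / (X * X)
      = - (P s / R s) * p1 s - 2 * p s"
  proof -
    have nump: "- (R s * P s * p s + c / R s * q s) = X * p1 s" and numq: "c / R s * p s - R s * P s * q s = X * q1 s"
      using X unfolding p1 q1 X_def[symmetric] by simp_all
    have cq: "c * q s = R s * (- X * p1 s - R s * P s * p s)"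
      using nump R_nz[of s] by (simp add: field_simps)
    have cq1: "c * (X * q1 s) = c^2 / R s * p s - R s * P s * (c * q s)"
      unfolding numq[symmetric] by (simp add: power2_eq_square algebra_simps)
    have 1: "N = - (P s * P s * p s + (- (R s)\<^sup>2 + c^2 / (R s)^2) * p s + R s * P s * p1 s
        - P s / (R s)^2 * (c * q s) + (c * q1 s) / R s)"
      using R_nz[of s] by (simp add: N_def field_simps power2_eq_square eval_nat_numeral)
    have 2: "N = - (P s * P s * p s + (- (R s)\<^sup>2 + c^2 / (R s)^2) * p s + R s * P s * p1 s
        + P s / R s * (X * p1 s + R s * P s * p s) + (c * q1 s) / R s)"
      unfolding 1 cq using R_nz[of s] by (simp add: field_simps power2_eq_square)
    have "(c * q1 s) * X = c^2 / R s * p s + (R s * R s) * P s * (X * p1 s + R s * P s * p s)"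
      using cq1 unfolding cq by (simp add: algebra_simps)
    then have 3: "(c * q1 s) / R s * X = c^2 / (R s)^2 * p s + R s * P s * (X * p1 s + R s * P s * p s)"
      using R_nz[of s] by (simp add: field_simps power2_eq_square)
    have PP: "P s * P s = X - c^2 / (R s)^2" using P_sq[of s] by (simp add: X_def power2_eq_square)
    have "N * X = - (X * (P s * P s * p s + (- (R s)\<^sup>2 + c^2 / (R s)^2) * p s + R s * P s * p1 s
        + P s / R s * (X * p1 s) + P s * P s * p s) + (c^2 / (R s)^2 * p s + R s * P s * (X * p1 s) + (R s)^2 * (P s * P s) * p s))"
      unfolding 2 using 3 R_nz[of s] by (simp add: algebra_simps power2_eq_square)
    moreover have "(- (R s * P s * p s + c / R s * q s)) * (- (2 * R s * P s)) = - 2 * R s * P s * X * p1 s"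
      unfolding nump by simp
    ultimately have "N * X - (- (R s * P s * p s + c / R s * q s)) * (- (2 * R s * P s))
       = - (X * (2 * (X - c^2 / (R s)^2) * p s + (- (R s)\<^sup>2 + c^2 / (R s)^2) * p s + P s / R s * (X * p1 s))
           + (c^2 / (R s)^2 * p s + (R s)^2 * (X - c^2 / (R s)^2) * p s))"
      unfolding PP by (simp add: algebra_simps)
    also have "c^2 / (R s)^2 * p s + (R s)^2 * (X - c^2 / (R s)^2) * p s = X * (c^2 / (R s)^2 * p s + (R s)^2 * p s)"
      using R_nz[of s] by (simp add: X_def field_simps power2_eq_square)
    also have "- (X * (2 * (X - c^2 / (R s)^2) * p s + (- (R s)\<^sup>2 + c^2 / (R s)^2) * p s + P s / R s * (X * p1 s))
        + X * (c^2 / (R s)^2 * p s + (R s)^2 * p s)) = X * X * (- (P s / R s) * p1 s - 2 * p s)"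
      by (simp add: algebra_simps)
    finally show ?thesis using X by simp
  qed
  ultimately show ?thesis by simp
qed

lemma DERIV_a1: "(a1 has_real_derivative a2 s) (at s)"
  unfolding a2_def by (rule DERIV_plane_coordinate[OF DERIV_a DERIV_b a1_def b1_def])

lemma DERIV_b1: "(b1 has_real_derivative b2 s) (at s)"
proof -
  have d: "((\<lambda>s. - a s) has_real_derivative - a1 s) (at s)" for s
    by (rule DERIV_minus[OF DERIV_a])
  have 1: "b1 s = - (R s * P s * b s + c / R s * (- a s)) / (1 - (R s)^2)" for s
    unfolding b1_def by (rule arg_cong2[where f="(/)"]) simp_all
  have 2: "- a1 s = (c / R s * b s - R s * P s * (- a s)) / (1 - (R s)^2)" for s
    unfolding a1_def minus_divide_left by (rule arg_cong2[where f="(/)"]) simp_all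
  show ?thesis
    unfolding b2_def by (rule DERIV_plane_coordinate[OF DERIV_b d 1 2])
qed

text \<open>The curvature of the profile in the direction of the normal. It is the opposite of the
  curvature of the parallel, which is why the surface is minimal.\<close>

lemma normal_acceleration: "F1 s * a2 s + F2 s * b2 s + c / R s * (- R s + c^2 / R s ^ 3) = c / (R s)^2"
proof -
  have "F1 s * a2 s + F2 s * b2 s = - (P s / R s) * (F1 s * a1 s + F2 s * b1 s) - 2 * (F1 s * a s + F2 s * b s)"
    by (simp add: a2_def b2_def algebra_simps)
  also have "\<dots> = (P s)^2 * c / (R s)^2 + 2 * c"
    unfolding normal_tangent normal_position by (simp add: power2_eq_square)
  finally show ?thesis
    unfolding P_sq using R_nz[of s] by (simp add: field_simps power2_eq_square eval_nat_numeral)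
qed

text \<open>With these values the tangent of the profile at \<open>l\<close> is \<open>cot r p - p\<^sub>0 / sin r\<close>, the gradient of the
  distance from \<open>p\<^sub>0 = e1\<close>.\<close>

lemma boundary_slopes: "a1 l = - sin r" "b1 l = cot r * b l"
proof -
  have s: "sin r > 0" using r_bounds sin_gt_zero by blast
  have b: "c / R l = b l / sin r" using free_boundary(3) R_nz[of l] s by (simp add: field_simps)
  have bl: "(b l)^2 = (sin r)^2 - (R l)^2" using circle[of l] by (simp add: free_boundary(1) sin_squared_eq)
  have X: "1 - (R l)^2 > 0" by (rule R2_less)
  have "R l * P l * a l + c / R l * b l = ((R l)^2 * (cos r)^2 + (b l)^2) / sin r"
    unfolding b free_boundary(1,2) cot_def using s by (simp add: field_simps power2_eq_square)
  also have "(R l)^2 * (cos r)^2 + (b l)^2 = (sin r)^2 * (1 - (R l)^2)"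
    unfolding bl cos_squared_eq by (simp add: algebra_simps)
  finally have "R l * P l * a l + c / R l * b l = sin r * (1 - (R l)^2)"
    using s by (simp add: power2_eq_square)
  then show "a1 l = - sin r" using X by (simp add: a1_def)
  have "c / R l * a l - R l * P l * b l = cot r * b l * (1 - (R l)^2)"
    unfolding b free_boundary(1,2) cot_def using s by (simp add: field_simps power2_eq_square)
  then show "b1 l = cot r * b l" using X by (simp add: b1_def)
qed

lemma P_0: "P 0 = 0" and b_0: "b 0 = 0"
  using parity(2)[of 0] parity(4)[of 0] by auto

section \<open>The surface swept out by the profile\<close>

text \<open>The surface as the image of a compact cylinder. Compactness yields a continuous inverse for
  free, which replaces explicit formulas with inverse trigonometric functions.\<close>

definition cyl :: "(real^2) \<times> real \<Rightarrow> real^4" where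
  "cyl q = vec4 (a (snd q)) (b (snd q)) (R (snd q) * fst q $ 1) (R (snd q) * fst q $ 2)"

definition cyl_dom :: "((real^2) \<times> real) set" where
  "cyl_dom = sphere 0 1 \<times> {-l..l}"

definition \<Sigma> :: "(real^4) set" where
  "\<Sigma> = cyl ` cyl_dom"

lemma continuous_profile:
  "continuous_on A R" "continuous_on A P" "continuous_on A a" "continuous_on A b" "continuous_on A f"
  using DERIV_isCont[OF dR] DERIV_isCont[OF dP] DERIV_isCont[OF DERIV_a] DERIV_isCont[OF DERIV_b] DERIV_isCont[OF df]
  by (simp_all add: continuous_at_imp_continuous_on)

lemma continuous_profile_compose:
  assumes "continuous_on A g"
  shows "continuous_on A (\<lambda>x. R (g x))" "continuous_on A (\<lambda>x. P (g x))"
    "continuous_on A (\<lambda>x. a (g x))" "continuous_on A (\<lambda>x. b (g x))" "continuous_on A (\<lambda>x. f (g x))"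
  using continuous_on_compose2[OF continuous_profile(1)[of UNIV] assms] continuous_on_compose2[OF continuous_profile(2)[of UNIV] assms]
    continuous_on_compose2[OF continuous_profile(3)[of UNIV] assms] continuous_on_compose2[OF continuous_profile(4)[of UNIV] assms]
    continuous_on_compose2[OF continuous_profile(5)[of UNIV] assms]
  by auto

lemma cyl_in_S3:
  assumes "fst q \<in> sphere 0 1"
  shows "cyl q \<bullet> cyl q = 1"
proof -
  have "cyl q \<bullet> cyl q = (a (snd q))^2 + (b (snd q))^2 + (R (snd q))^2 * ((fst q $ 1)^2 + (fst q $ 2)^2)"
    unfolding cyl_def inner_vec4 by (simp add: power2_eq_square algebra_simps)
  then show ?thesis using iffD1[OF pt_sphere assms] position_unit[of "snd q"] by simp
qed

lemma continuous_on_cyl: "continuous_on A cyl"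
  unfolding cyl_def[abs_def]
  by (intro continuous_on_vec4 continuous_profile_compose continuous_intros)

lemma inj_on_cyl: "inj_on cyl cyl_dom"
proof (rule inj_onI)
  fix p q assume pq: "p \<in> cyl_dom" "q \<in> cyl_dom" "cyl p = cyl q"
  then have "(a (snd p), b (snd p)) = (a (snd q), b (snd q))"
    by (simp add: cyl_def vec4_inject)
  moreover have "snd p \<in> {-l..l}" "snd q \<in> {-l..l}" using pq by (auto simp: cyl_dom_def)
  ultimately have s: "snd p = snd q" by (rule inj_onD[OF injective])
  then have "fst p $ 1 = fst q $ 1" "fst p $ 2 = fst q $ 2"
    using pq(3) R_nz[of "snd q"] by (simp_all add: cyl_def vec4_inject)
  then show "p = q" using s by (simp add: prod_eq_iff vec_eq_iff forall_2)
qed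

definition coords :: "real^4 \<Rightarrow> (real^2) \<times> real" where
  "coords = inv_into cyl_dom cyl"

lemma coords_cyl: "q \<in> cyl_dom \<Longrightarrow> coords (cyl q) = q"
  by (simp add: coords_def inj_on_cyl)

lemma compact_cyl_dom: "compact cyl_dom"
  by (simp add: cyl_dom_def compact_Times)

lemma cyl_homeomorphism: "homeomorphism cyl_dom \<Sigma> cyl coords"
proof -
  obtain g where g: "homeomorphism cyl_dom \<Sigma> cyl g"
    using homeomorphism_compact[OF compact_cyl_dom continuous_on_cyl _ inj_on_cyl] by (auto simp: \<Sigma>_def)
  have "g p = coords p" if "p \<in> \<Sigma>" for p
    using that g coords_cyl by (auto simp: \<Sigma>_def homeomorphism_def)
  then show ?thesis by (intro homeomorphism_cong[OF g]) auto
qed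

lemma coords_in: "p \<in> \<Sigma> \<Longrightarrow> coords p \<in> cyl_dom" and cyl_coords: "p \<in> \<Sigma> \<Longrightarrow> cyl (coords p) = p"
  and continuous_on_coords: "continuous_on \<Sigma> coords"
  using cyl_homeomorphism by (auto simp: homeomorphism_def)

lemma compact_\<Sigma>: "compact \<Sigma>"
  unfolding \<Sigma>_def by (intro compact_continuous_image continuous_on_cyl compact_cyl_dom)

lemma \<Sigma>_S3: "p \<in> \<Sigma> \<Longrightarrow> p \<bullet> p = 1"
  by (auto simp: \<Sigma>_def cyl_dom_def intro!: cyl_in_S3)

lemma \<Sigma>_homeomorphic: "\<Sigma> homeomorphic ((sphere 0 1 :: (real^2) set) \<times> {0..1::real})"
proof -
  define g where "g q = cyl (fst q, l * (2 * snd q - 1))" for q :: "(real^2) \<times> real"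
  have im: "(\<lambda>q. (fst q, l * (2 * snd q - 1))) ` (sphere 0 1 \<times> {0..1}) = cyl_dom"
  proof -
    have 1: "l * (2 * t - 1) \<in> {-l..l}" if "t \<in> {0..1}" for t
      using mult_left_mono[of "-1" "2 * t - 1" l] mult_left_mono[of "2 * t - 1" 1 l] that l_pos by simp
    have 2: "s \<in> (\<lambda>t. l * (2 * t - 1)) ` {0..1}" if "s \<in> {-l..l}" for s
    proof (rule image_eqI)
      show "s = l * (2 * ((s / l + 1) / 2) - 1)" using l_pos by (simp add: field_simps)
      show "(s / l + 1) / 2 \<in> {0..1}" using that l_pos by (simp add: field_simps)
    qed
    have eq: "(\<lambda>t. l * (2 * t - 1)) ` {0..1} = {-l..l}" using 1 2 by blast
    have "(\<lambda>q. (fst q, h (snd q))) ` (S \<times> I) = S \<times> h ` I"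
      for h :: "real \<Rightarrow> real" and S :: "(real^2) set" and I by force
    from this[of "\<lambda>t. l * (2 * t - 1)" "sphere 0 1" "{0..1}"] show ?thesis
      unfolding eq cyl_dom_def .
  qed
  have "\<exists>h. homeomorphism (sphere 0 1 \<times> {0..1}) \<Sigma> g h"
  proof (rule homeomorphism_compact)
    show "continuous_on (sphere 0 1 \<times> {0..1}) g"
      unfolding g_def by (intro continuous_on_compose2[OF continuous_on_cyl[of UNIV]] continuous_intros) auto
    show "g ` (sphere 0 1 \<times> {0..1}) = \<Sigma>"
      unfolding \<Sigma>_def im[symmetric] image_image g_def ..
    show "inj_on g (sphere 0 1 \<times> {0..1})"
    proof (rule inj_onI)
      fix p q assume pq: "p \<in> sphere 0 1 \<times> {0..1}" "q \<in> sphere 0 1 \<times> {0..1}" "g p = g q"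
      then have "(fst p, l * (2 * snd p - 1)) = (fst q, l * (2 * snd q - 1))"
        by (intro inj_onD[OF inj_on_cyl]) (use im in \<open>auto simp: g_def\<close>)
      then show "p = q" using l_pos by (auto simp: prod_eq_iff)
    qed
  qed (auto intro: compact_Times)
  then obtain h where h: "homeomorphism (sphere 0 1 \<times> {0..1}) \<Sigma> g h" ..
  have "((sphere 0 1 :: (real^2) set) \<times> {0..1::real}) homeomorphic \<Sigma>"
    unfolding homeomorphic_def by (rule exI[of _ g], rule exI[of _ h], rule h)
  then show ?thesis by (rule homeomorphic_sym[THEN iffD1])
qed

section \<open>Charts of the surface\<close>

text \<open>Charts that start at the boundary: \<open>sg = 1\<close> at the end \<open>s = l\<close> and \<open>sg = -1\<close> at the end \<open>s = -l\<close>,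
  with the coordinate \<open>x $ 2\<close> measuring the distance from that end. By parity of the profile the
  sign only enters the coefficient of \<open>e2\<close>. The angle \<open>t0\<close> is the centre of the half turn that
  the chart covers.\<close>

definition chart :: "real \<Rightarrow> real \<Rightarrow> real^2 \<Rightarrow> real^4" where
  "chart sg t0 x = vec4 (a (l - x $ 2)) (sg * b (l - x $ 2))
     (R (l - x $ 2) * cos (t0 + x $ 1)) (R (l - x $ 2) * sin (t0 + x $ 1))"

text \<open>The two partial derivatives of a chart.\<close>

definition chart1 :: "real \<Rightarrow> real^2 \<Rightarrow> real^4" where
  "chart1 t0 x = vec4 0 0 (- (R (l - x $ 2) * sin (t0 + x $ 1))) (R (l - x $ 2) * cos (t0 + x $ 1))"

definition chart2 :: "real \<Rightarrow> real \<Rightarrow> real^2 \<Rightarrow> real^4" where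
  "chart2 sg t0 x = vec4 (- a1 (l - x $ 2)) (- (sg * b1 (l - x $ 2)))
     (- (P (l - x $ 2) * cos (t0 + x $ 1))) (- (P (l - x $ 2) * sin (t0 + x $ 1)))"

definition W :: "(real^2) set" where
  "W = {x. - pi / 2 < x $ 1 \<and> x $ 1 < pi / 2 \<and> 0 \<le> x $ 2 \<and> x $ 2 < 2 * l}"

lemma openin_W: "openin (top_of_set half_plane) W"
proof -
  have "W = half_plane \<inter> ({x. - pi / 2 < x $ 1} \<inter> {x. x $ 1 < pi / 2} \<inter> {x. x $ 2 < 2 * l})"
    by (auto simp: W_def half_plane_def)
  then show ?thesis
    by (simp only: openin_open_Int open_Int open_halfspace_component_gt_cart open_halfspace_component_lt_cart)
qed

lemma W_half_plane: "W \<subseteq> half_plane"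
  by (auto simp: W_def half_plane_def)

lemma openin_half_plane: "openin (top_of_set half_plane) half_plane"
  by simp

lemma pd_eqI:
  assumes "x \<in> half_plane" "openin (top_of_set half_plane) V" "x \<in> V" "\<And>y. y \<in> V \<Longrightarrow> g y = h y"
    and "(h has_derivative (\<lambda>v. v $ 1 *\<^sub>R h1 + v $ 2 *\<^sub>R h2)) (at x within half_plane)"
  shows "pd 1 g x = h1" "pd 2 g x = h2"
  using Dhp_cong_eqI[OF assms(2-5)] by (simp_all add: pd_def axis_def)

lemma trig_coord:
  "((\<lambda>x::real^2. cos (t0 + x $ 1)) has_derivative (\<lambda>v. v $ 1 * - sin (t0 + x $ 1) + v $ 2 * 0)) (at x within S)"
  "((\<lambda>x::real^2. sin (t0 + x $ 1)) has_derivative (\<lambda>v. v $ 1 * cos (t0 + x $ 1) + v $ 2 * 0)) (at x within S)"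
  by (auto intro!: derivative_eq_intros has_derivative_coord)

lemma product_coord:
  fixes h :: "real \<Rightarrow> real"
  assumes "\<And>s. (h has_real_derivative h' s) (at s)"
    and "(g has_derivative (\<lambda>v. v $ 1 * g1 + v $ 2 * 0)) (at x within S)"
  shows "((\<lambda>x::real^2. h (l - x $ 2) * g x) has_derivative
    (\<lambda>v. v $ 1 * (h (l - x $ 2) * g1) + v $ 2 * (- (h' (l - x $ 2) * g x)))) (at x within S)"
  by (rule has_derivative_eq_rhs[OF has_derivative_mult[OF has_derivative_shift[OF assms(1)] assms(2)]])
     (auto simp: algebra_simps)

lemma has_derivative_minus_coord:
  fixes g :: "real^2 \<Rightarrow> real"
  assumes "(g has_derivative (\<lambda>v. v $ 1 * g1 + v $ 2 * g2)) F"
  shows "((\<lambda>x. - g x) has_derivative (\<lambda>v. v $ 1 * (- g1) + v $ 2 * (- g2))) F"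
  by (rule has_derivative_eq_rhs[OF has_derivative_minus[OF assms]]) auto

lemma has_derivative_cmult_coord:
  fixes g :: "real^2 \<Rightarrow> real"
  assumes "(g has_derivative (\<lambda>v. v $ 1 * g1 + v $ 2 * g2)) F"
  shows "((\<lambda>x. k * g x) has_derivative (\<lambda>v. v $ 1 * (k * g1) + v $ 2 * (k * g2))) F"
  by (rule has_derivative_eq_rhs[OF has_derivative_mult_right[OF assms]]) (auto simp: algebra_simps)

lemma has_derivative_zero_coord:
  "((\<lambda>x::real^2. 0::real) has_derivative (\<lambda>v. v $ 1 * 0 + v $ 2 * 0)) F"
  by simp

lemma has_derivative_chart:
  "(chart sg t0 has_derivative (\<lambda>v. v $ 1 *\<^sub>R chart1 t0 x + v $ 2 *\<^sub>R chart2 sg t0 x)) (at x within S)"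
proof -
  have "(chart sg t0 has_derivative (\<lambda>v. v $ 1 *\<^sub>R vec4 0 (sg * 0) (R (l - x $ 2) * - sin (t0 + x $ 1)) (R (l - x $ 2) * cos (t0 + x $ 1))
      + v $ 2 *\<^sub>R vec4 (- a1 (l - x $ 2)) (sg * (- b1 (l - x $ 2))) (- (P (l - x $ 2) * cos (t0 + x $ 1)))
        (- (P (l - x $ 2) * sin (t0 + x $ 1))))) (at x within S)"
    unfolding chart_def[abs_def]
    by (intro has_derivative_vec4 has_derivative_cmult_coord has_derivative_shift product_coord trig_coord
        DERIV_a DERIV_b dR)
  then show ?thesis by (simp add: chart1_def chart2_def)
qed

lemma has_derivative_chart1:
  "(chart1 t0 has_derivative (\<lambda>v. v $ 1 *\<^sub>R vec4 0 0 (- (R (l - x $ 2) * cos (t0 + x $ 1))) (- (R (l - x $ 2) * sin (t0 + x $ 1)))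
    + v $ 2 *\<^sub>R vec4 0 0 (P (l - x $ 2) * sin (t0 + x $ 1)) (- (P (l - x $ 2) * cos (t0 + x $ 1))))) (at x within S)"
proof -
  have "(chart1 t0 has_derivative (\<lambda>v. v $ 1 *\<^sub>R vec4 0 0 (- (R (l - x $ 2) * cos (t0 + x $ 1))) (R (l - x $ 2) * - sin (t0 + x $ 1))
    + v $ 2 *\<^sub>R vec4 0 0 (- (- (P (l - x $ 2) * sin (t0 + x $ 1)))) (- (P (l - x $ 2) * cos (t0 + x $ 1))))) (at x within S)"
    unfolding chart1_def[abs_def]
    by (intro has_derivative_vec4 has_derivative_minus_coord has_derivative_zero_coord product_coord trig_coord dR)
  then show ?thesis by simp
qed

lemma has_derivative_chart2:
  "(chart2 sg t0 has_derivative (\<lambda>v. v $ 1 *\<^sub>R vec4 0 0 (P (l - x $ 2) * sin (t0 + x $ 1)) (- (P (l - x $ 2) * cos (t0 + x $ 1)))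
    + v $ 2 *\<^sub>R vec4 (a2 (l - x $ 2)) (sg * b2 (l - x $ 2))
       ((- R (l - x $ 2) + c^2 / R (l - x $ 2) ^ 3) * cos (t0 + x $ 1))
       ((- R (l - x $ 2) + c^2 / R (l - x $ 2) ^ 3) * sin (t0 + x $ 1)))) (at x within S)"
proof -
  have "(chart2 sg t0 has_derivative (\<lambda>v. v $ 1 *\<^sub>R vec4 (- 0) (- (sg * 0)) (- (P (l - x $ 2) * (- sin (t0 + x $ 1)))) (- (P (l - x $ 2) * cos (t0 + x $ 1)))
    + v $ 2 *\<^sub>R vec4 (- (- a2 (l - x $ 2))) (- (sg * (- b2 (l - x $ 2))))
       (- (- ((- R (l - x $ 2) + c^2 / R (l - x $ 2) ^ 3) * cos (t0 + x $ 1))))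
       (- (- ((- R (l - x $ 2) + c^2 / R (l - x $ 2) ^ 3) * sin (t0 + x $ 1)))))) (at x within S)"
    unfolding chart2_def[abs_def]
    by (intro has_derivative_vec4 has_derivative_minus_coord has_derivative_cmult_coord has_derivative_shift product_coord trig_coord
        DERIV_a1 DERIV_b1 dP)
  then show ?thesis by simp
qed

lemma Dhp_chart_eq:
  "x \<in> half_plane \<Longrightarrow> Dhp (chart sg t0) x = (\<lambda>v. v $ 1 *\<^sub>R chart1 t0 x + v $ 2 *\<^sub>R chart2 sg t0 x)"
  by (rule Dhp_eqI[OF has_derivative_chart])

lemma pd_chart:
  assumes "x \<in> half_plane"
  shows "pd 1 (chart sg t0) x = chart1 t0 x" "pd 2 (chart sg t0) x = chart2 sg t0 x"
  using Dhp_chart_eq[OF assms] by (simp_all add: pd_def axis_def)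

lemma pd_pd_chart:
  assumes x: "x \<in> half_plane"
  shows "pd 1 (pd 1 (chart sg t0)) x = vec4 0 0 (- (R (l - x $ 2) * cos (t0 + x $ 1))) (- (R (l - x $ 2) * sin (t0 + x $ 1)))"
    "pd 2 (pd 1 (chart sg t0)) x = vec4 0 0 (P (l - x $ 2) * sin (t0 + x $ 1)) (- (P (l - x $ 2) * cos (t0 + x $ 1)))"
    "pd 1 (pd 2 (chart sg t0)) x = vec4 0 0 (P (l - x $ 2) * sin (t0 + x $ 1)) (- (P (l - x $ 2) * cos (t0 + x $ 1)))"
    "pd 2 (pd 2 (chart sg t0)) x = vec4 (a2 (l - x $ 2)) (sg * b2 (l - x $ 2))
       ((- R (l - x $ 2) + c^2 / R (l - x $ 2) ^ 3) * cos (t0 + x $ 1))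
       ((- R (l - x $ 2) + c^2 / R (l - x $ 2) ^ 3) * sin (t0 + x $ 1))"
  using pd_eqI[OF x openin_half_plane x pd_chart(1) has_derivative_chart1]
    pd_eqI[OF x openin_half_plane x pd_chart(2) has_derivative_chart2] by auto

lemma chart_inner:
  assumes sg: "sg^2 = 1"
  shows "chart1 t0 x \<bullet> chart1 t0 x = (R (l - x $ 2))^2" "chart1 t0 x \<bullet> chart2 sg t0 x = 0"
    "chart2 sg t0 x \<bullet> chart2 sg t0 x = 1"
proof -
  let ?t = "l - x $ 2" and ?C = "cos (t0 + x $ 1)" and ?S = "sin (t0 + x $ 1)"
  have "chart1 t0 x \<bullet> chart1 t0 x = (R ?t)^2 * (?S^2 + ?C^2)"
    unfolding chart1_def inner_vec4 power2_eq_square by (simp only: ring_distribs) simp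
  then show "chart1 t0 x \<bullet> chart1 t0 x = (R ?t)^2" by simp
  show "chart1 t0 x \<bullet> chart2 sg t0 x = 0"
    unfolding chart1_def chart2_def inner_vec4 by simp
  have "chart2 sg t0 x \<bullet> chart2 sg t0 x = (a1 ?t)^2 + sg^2 * (b1 ?t)^2 + (P ?t)^2 * (?C^2 + ?S^2)"
    unfolding chart2_def inner_vec4 power2_eq_square by (simp only: ring_distribs) simp
  then show "chart2 sg t0 x \<bullet> chart2 sg t0 x = 1" using tangent_unit sg by simp
qed

lemma smooth_on_chart: "smooth_on W (chart sg t0)"
proof (rule smooth_on_C_plane[OF openin_W])
  have "C_plane k (\<lambda>x. t0 + x $ 1)" for k
    by (intro C_plane_add C_plane_const C_plane_coord)
  then show "C_plane k (chart sg t0)" for k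
    unfolding chart_def[abs_def]
    by (intro C_plane_vec4 C_plane_mult C_plane_const smooth)
      (use C_plane_sin_cos in blast)+
qed simp

lemma inj_Dhp_chart:
  assumes x: "x \<in> half_plane" and sg: "sg^2 = 1"
  shows "inj (Dhp (chart sg t0) x)"
proof -
  have "linear (Dhp (chart sg t0) x)"
    unfolding Dhp_chart_eq[OF x] by (rule has_derivative_linear[OF has_derivative_chart])
  moreover have "v = 0" if "Dhp (chart sg t0) x v = 0" for v
  proof -
    have "(v $ 1 *\<^sub>R chart1 t0 x + v $ 2 *\<^sub>R chart2 sg t0 x) \<bullet> chart1 t0 x = 0"
      "(v $ 1 *\<^sub>R chart1 t0 x + v $ 2 *\<^sub>R chart2 sg t0 x) \<bullet> chart2 sg t0 x = 0"
      using that by (simp_all add: Dhp_chart_eq[OF x])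
    then have "v $ 1 = 0" "v $ 2 = 0"
      using R_nz by (simp_all add: inner_add_left chart_inner[OF sg] inner_commute[of "chart2 sg t0 x"])
    then show "v = 0" by (simp add: vec_eq_iff forall_2)
  qed
  ultimately show ?thesis by (simp add: linear_injective_0)
qed

definition circ :: "real \<Rightarrow> real^2" where
  "circ t0 = pt (cos t0) (sin t0)"

lemma circ_sphere: "circ t0 \<in> sphere 0 1"
  unfolding pt_sphere circ_def by simp

lemma parity_sg:
  assumes "sg = 1 \<or> sg = -1"
  shows "R (sg * t) = R t" "P (sg * t) = sg * P t" "a (sg * t) = a t" "b (sg * t) = sg * b t" "f (sg * t) = f t"
    "F1 (sg * t) = F1 t" "F2 (sg * t) = sg * F2 t"
  using assms by (auto simp: parity F1_def F2_def)

lemma chart_eq_cyl: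
  assumes "sg = 1 \<or> sg = -1"
  shows "chart sg t0 x = cyl (circ (t0 + x $ 1), sg * (l - x $ 2))"
  using assms by (simp add: chart_def cyl_def circ_def parity_sg)

lemma coords_chart:
  assumes "sg = 1 \<or> sg = -1" "x \<in> W"
  shows "coords (chart sg t0 x) = (circ (t0 + x $ 1), sg * (l - x $ 2))" "chart sg t0 x \<in> \<Sigma>"
proof -
  have "(circ (t0 + x $ 1), sg * (l - x $ 2)) \<in> cyl_dom"
    using assms circ_sphere by (auto simp: cyl_dom_def W_def)
  then show "coords (chart sg t0 x) = (circ (t0 + x $ 1), sg * (l - x $ 2))" "chart sg t0 x \<in> \<Sigma>"
    unfolding chart_eq_cyl[OF assms(1)] by (simp_all add: coords_cyl \<Sigma>_def)
qed

text \<open>Position on the circle of rotation relative to the centre \<open>t0\<close> of a chart; the chart covers the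
  half circle on which the first of these coordinates is positive.\<close>

definition rot1 :: "real \<Rightarrow> real^4 \<Rightarrow> real" where
  "rot1 t0 p = fst (coords p) $ 1 * cos t0 + fst (coords p) $ 2 * sin t0"
definition rot2 :: "real \<Rightarrow> real^4 \<Rightarrow> real" where
  "rot2 t0 p = fst (coords p) $ 2 * cos t0 - fst (coords p) $ 1 * sin t0"

lemma rot_chart:
  assumes "sg = 1 \<or> sg = -1" "x \<in> W"
  shows "rot1 t0 (chart sg t0 x) = cos (x $ 1)" "rot2 t0 (chart sg t0 x) = sin (x $ 1)"
proof -
  have "cos (x $ 1) = cos ((t0 + x $ 1) - t0)" "sin (x $ 1) = sin ((t0 + x $ 1) - t0)" by simp_all
  then show "rot1 t0 (chart sg t0 x) = cos (x $ 1)" "rot2 t0 (chart sg t0 x) = sin (x $ 1)"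
    unfolding cos_diff sin_diff by (simp_all add: rot1_def rot2_def coords_chart[OF assms] circ_def)
qed

lemma continuous_on_rot: "continuous_on \<Sigma> (rot1 t0)" "continuous_on \<Sigma> (rot2 t0)"
  unfolding rot1_def[abs_def] rot2_def[abs_def]
  by (intro continuous_intros continuous_on_coords)+

lemma rot_sq:
  assumes "p \<in> \<Sigma>"
  shows "(rot1 t0 p)^2 + (rot2 t0 p)^2 = 1"
proof -
  let ?z = "fst (coords p)"
  have "?z \<in> sphere 0 1" using coords_in[OF assms] by (auto simp: cyl_dom_def)
  then have z: "(?z $ 1)^2 + (?z $ 2)^2 = 1" by (simp only: pt_sphere)
  have "(rot1 t0 p)^2 + (rot2 t0 p)^2 = ((?z $ 1)^2 + (?z $ 2)^2) * ((cos t0)^2 + (sin t0)^2)"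
    unfolding rot1_def rot2_def power2_eq_square by (simp only: ring_distribs left_diff_distrib right_diff_distrib) simp
  then show ?thesis using z by simp
qed

lemma rot_inverse:
  "fst (coords p) $ 1 = rot1 t0 p * cos t0 - rot2 t0 p * sin t0"
  "fst (coords p) $ 2 = rot1 t0 p * sin t0 + rot2 t0 p * cos t0"
proof -
  let ?z = "fst (coords p)"
  have "rot1 t0 p * cos t0 - rot2 t0 p * sin t0 = ?z $ 1 * ((cos t0)^2 + (sin t0)^2)"
    "rot1 t0 p * sin t0 + rot2 t0 p * cos t0 = ?z $ 2 * ((cos t0)^2 + (sin t0)^2)"
    unfolding rot1_def rot2_def power2_eq_square by (simp_all only: ring_distribs left_diff_distrib right_diff_distrib) simp_all
  then show "?z $ 1 = rot1 t0 p * cos t0 - rot2 t0 p * sin t0" "?z $ 2 = rot1 t0 p * sin t0 + rot2 t0 p * cos t0"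
    by simp_all
qed

lemma chart_image:
  assumes sg: "sg = 1 \<or> sg = -1"
  shows "chart sg t0 ` W = {p \<in> \<Sigma>. 0 < rot1 t0 p \<and> - l < sg * snd (coords p)}"
    and "homeomorphism W (chart sg t0 ` W) (chart sg t0) (\<lambda>p. pt (arcsin (rot2 t0 p)) (l - sg * snd (coords p)))"
proof -
  let ?h = "\<lambda>p. pt (arcsin (rot2 t0 p)) (l - sg * snd (coords p))"
  let ?I = "{p \<in> \<Sigma>. 0 < rot1 t0 p \<and> - l < sg * snd (coords p)}"
  have sg2: "sg * (sg * t) = t" for t using sg by auto
  have hc: "?h (chart sg t0 x) = x" if "x \<in> W" for x
    using that by (simp add: rot_chart[OF sg that] coords_chart[OF sg that] sg2 eq_commute[of _ x] pt_eq_iff arcsin_sin W_def)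
  have im: "chart sg t0 x \<in> ?I" if "x \<in> W" for x
    using that by (auto simp: rot_chart[OF sg that] coords_chart[OF sg that] sg2 W_def intro!: cos_gt_zero_pi)
  have ch: "?h p \<in> W \<and> chart sg t0 (?h p) = p" if p: "p \<in> ?I" for p
  proof -
    have pS: "p \<in> \<Sigma>" and r1: "0 < rot1 t0 p" and sl: "- l < sg * snd (coords p)" using p by auto
    have q: "coords p \<in> cyl_dom" using coords_in pS .
    have sq: "(rot1 t0 p)^2 + (rot2 t0 p)^2 = 1" using rot_sq pS .
    then have "(rot2 t0 p)^2 < 1" using r1 by (smt (verit) zero_less_power)
    then have r2: "-1 < rot2 t0 p" "rot2 t0 p < 1" by (auto simp: abs_square_less_1 abs_less_iff)
    have "cos (arcsin (rot2 t0 p)) = sqrt (1 - (rot2 t0 p)^2)" using r2 by (simp add: cos_arcsin)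
    also have "1 - (rot2 t0 p)^2 = (rot1 t0 p)^2" using sq by simp
    finally have cs: "cos (arcsin (rot2 t0 p)) = rot1 t0 p" "sin (arcsin (rot2 t0 p)) = rot2 t0 p"
      using r1 r2 by simp_all
    have "circ (t0 + arcsin (rot2 t0 p)) = fst (coords p)"
      unfolding circ_def eq_commute[of _ "fst (coords p)"] pt_eq_iff rot_inverse[of p t0] cos_add sin_add cs
      by (simp add: algebra_simps)
    then have "chart sg t0 (?h p) = cyl (coords p)"
      by (simp add: chart_eq_cyl[OF sg] sg2)
    moreover have "?h p \<in> W"
      using r2 arcsin_lt_bounded[OF r2] q sl sg by (auto simp: W_def cyl_dom_def)
    ultimately show ?thesis using cyl_coords[OF pS] by simp
  qed
  show I: "chart sg t0 ` W = ?I"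
  proof
    show "chart sg t0 ` W \<subseteq> ?I" using im by auto
    show "?I \<subseteq> chart sg t0 ` W"
    proof
      fix p assume "p \<in> ?I"
      from ch[OF this] show "p \<in> chart sg t0 ` W" by (metis imageI)
    qed
  qed
  have cont: "continuous_on W (chart sg t0)"
    by (rule differentiable_imp_continuous_on)
       (auto simp: differentiable_on_def differentiable_def intro: has_derivative_chart)
  have sub: "?I \<subseteq> \<Sigma>" by auto
  have "\<bar>rot2 t0 p\<bar> \<le> 1" if "p \<in> \<Sigma>" for p
    using rot_sq[OF that, of t0] by (simp add: abs_square_le_1[symmetric]) (smt (verit) zero_le_power2)
  then have conth: "continuous_on ?I ?h"
    by (intro continuous_on_pt continuous_on_arcsin continuous_intros
        continuous_on_subset[OF continuous_on_rot(2) sub] continuous_on_subset[OF continuous_on_coords sub])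
       (auto simp: abs_le_iff)
  show "homeomorphism W (chart sg t0 ` W) (chart sg t0) ?h"
    unfolding homeomorphism_def I
    using cont conth hc ch im I[symmetric] by (auto simp: image_iff)
qed

lemma surface_chart_chart:
  assumes sg: "sg = 1 \<or> sg = -1"
  shows "surface_chart \<Sigma> W (chart sg t0)"
proof -
  have sg2: "sg^2 = 1" using sg by auto
  have "openin (top_of_set \<Sigma>) (\<Sigma> \<inter> rot1 t0 -` {0<..})"
    "openin (top_of_set \<Sigma>) (\<Sigma> \<inter> (\<lambda>p. sg * snd (coords p)) -` {-l<..})"
    by (rule continuous_openin_preimage_gen, intro continuous_intros continuous_on_rot continuous_on_coords, simp)+
  then have "openin (top_of_set \<Sigma>) ((\<Sigma> \<inter> rot1 t0 -` {0<..}) \<inter> (\<Sigma> \<inter> (\<lambda>p. sg * snd (coords p)) -` {-l<..}))"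
    by (rule openin_Int)
  also have "(\<Sigma> \<inter> rot1 t0 -` {0<..}) \<inter> (\<Sigma> \<inter> (\<lambda>p. sg * snd (coords p)) -` {-l<..}) = chart sg t0 ` W"
    unfolding chart_image(1)[OF sg] by auto
  finally show ?thesis
    unfolding surface_chart_def
    using openin_W smooth_on_chart inj_Dhp_chart[OF _ sg2] W_half_plane chart_image(2)[OF sg] by blast
qed

lemma chart_at_chart:
  "sg = 1 \<or> sg = -1 \<Longrightarrow> x \<in> W \<Longrightarrow> chart_at \<Sigma> (chart sg t0 x) W (chart sg t0) x"
  by (simp add: chart_at_def surface_chart_chart)

text \<open>Every point lies in a chart that shows whether it is on one of the two boundary circles: the chart starts
  at the far end only for the circle \<open>s = -l\<close>.\<close>

lemma exists_chart:
  assumes "p \<in> \<Sigma>"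
  obtains sg t0 x where "sg = 1 \<or> sg = -1" "x \<in> W" "p = chart sg t0 x"
    "x $ 2 = 0 \<longleftrightarrow> \<bar>snd (coords p)\<bar> = l"
proof -
  define s where "s = snd (coords p)"
  have q: "coords p \<in> cyl_dom" using coords_in assms .
  then have "fst (coords p) \<in> sphere 0 1" and s: "- l \<le> s" "s \<le> l" by (auto simp: cyl_dom_def s_def)
  then have "(fst (coords p) $ 1)^2 + (fst (coords p) $ 2)^2 = 1" by (simp only: pt_sphere)
  then obtain t0 where t0: "fst (coords p) $ 1 = cos t0" "fst (coords p) $ 2 = sin t0"
    using sincos_total_2pi by metis
  \<comment> \<open>a chart with \<open>sg = 1\<close> omits only the circle \<open>s = -l\<close>\<close>
  define sg :: real where "sg = (if s = - l then -1 else 1)"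
  have sg: "sg = 1 \<or> sg = -1" by (simp add: sg_def)
  define x where "x = pt 0 (l - sg * s)"
  have "x \<in> W" using s l_pos by (auto simp: x_def W_def sg_def)
  moreover have "chart sg t0 x = cyl (coords p)"
    unfolding chart_eq_cyl[OF sg]
    by (rule arg_cong[where f=cyl]) (use sg in \<open>auto simp: x_def prod_eq_iff circ_def eq_commute[of _ "fst (coords p)"] pt_eq_iff t0 s_def\<close>)
  moreover have "x $ 2 = 0 \<longleftrightarrow> \<bar>snd (coords p)\<bar> = l"
    using s l_pos by (auto simp: x_def sg_def s_def)
  ultimately show thesis using that[OF sg] cyl_coords[OF assms] by metis
qed

section \<open>Minimality, free boundary and the Jacobi field\<close>

text \<open>The normal has to be a function on the surface, so it is written through the coordinates
  that \<open>coords\<close> recovers.\<close>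

definition nu :: "real^4 \<Rightarrow> real^4" where
  "nu p = (let z = fst (coords p); s = snd (coords p) in
     vec4 (F1 s) (F2 s) (c / R s * z $ 1) (c / R s * z $ 2))"

definition U :: "real^4 \<Rightarrow> real" where
  "U p = f (snd (coords p))"

lemma nu_chart:
  assumes "sg = 1 \<or> sg = -1" "x \<in> W"
  shows "nu (chart sg t0 x) = vec4 (F1 (l - x $ 2)) (sg * F2 (l - x $ 2))
    (c / R (l - x $ 2) * cos (t0 + x $ 1)) (c / R (l - x $ 2) * sin (t0 + x $ 1))"
  by (simp add: nu_def coords_chart[OF assms] parity_sg[OF assms(1)] circ_def)

lemma U_chart:
  assumes "sg = 1 \<or> sg = -1" "x \<in> W"
  shows "U (chart sg t0 x) = f (l - x $ 2)"
  by (simp add: U_def coords_chart[OF assms] parity_sg[OF assms(1)])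

lemma nu_inner:
  assumes sg: "sg = 1 \<or> sg = -1" and x: "x \<in> W"
  shows "norm (nu (chart sg t0 x)) = 1" "nu (chart sg t0 x) \<bullet> chart sg t0 x = 0"
    "nu (chart sg t0 x) \<bullet> chart1 t0 x = 0" "nu (chart sg t0 x) \<bullet> chart2 sg t0 x = 0"
proof -
  let ?t = "l - x $ 2" and ?C = "cos (t0 + x $ 1)" and ?S = "sin (t0 + x $ 1)"
  have sg2: "sg * sg = 1" using sg by auto
  have cs: "?C * ?C + ?S * ?S = 1" by simp
  have "nu (chart sg t0 x) \<bullet> nu (chart sg t0 x)
      = (F1 ?t)^2 + (sg * sg) * (F2 ?t)^2 + (c / R ?t)^2 * (?C * ?C + ?S * ?S)"
    unfolding nu_chart[OF sg x] inner_vec4 by (simp only: power2_eq_square ring_distribs mult_ac)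
  then show "norm (nu (chart sg t0 x)) = 1"
    unfolding sg2 cs using normal_unit[of ?t] by (simp add: norm_eq_1)
  have "nu (chart sg t0 x) \<bullet> chart sg t0 x
      = F1 ?t * a ?t + (sg * sg) * (F2 ?t * b ?t) + c / R ?t * R ?t * (?C * ?C + ?S * ?S)"
    unfolding nu_chart[OF sg x] unfolding chart_def inner_vec4 by (simp only: ring_distribs mult_ac)
  then show "nu (chart sg t0 x) \<bullet> chart sg t0 x = 0"
    unfolding sg2 cs using normal_position[of ?t] R_nz[of ?t] by simp
  show "nu (chart sg t0 x) \<bullet> chart1 t0 x = 0"
    unfolding nu_chart[OF sg x] chart1_def inner_vec4 by simp
  define K where "K = c / R ?t"
  have "nu (chart sg t0 x) \<bullet> chart2 sg t0 x
      = - (F1 ?t * a1 ?t + (sg * sg) * (F2 ?t * b1 ?t) + K * P ?t * (?C * ?C + ?S * ?S))"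
    unfolding nu_chart[OF sg x] chart2_def inner_vec4 K_def[symmetric] by (simp only: ring_distribs mult_ac) simp
  then show "nu (chart sg t0 x) \<bullet> chart2 sg t0 x = 0"
    unfolding sg2 cs K_def using normal_tangent[of ?t] by simp
qed

lemma first_form_chart:
  assumes sg: "sg = 1 \<or> sg = -1" and x: "x \<in> half_plane"
  shows "first_form (chart sg t0) x = diag2 ((R (l - x $ 2))^2) 1"
proof -
  have sg2: "sg^2 = 1" using sg by auto
  show ?thesis
    by (rule eq_diag2I) (simp_all add: first_form_def pd_chart[OF x] chart_inner[OF sg2] inner_commute[of "chart2 sg t0 x"])
qed

lemma second_form_chart:
  assumes sg: "sg = 1 \<or> sg = -1" and x: "x \<in> W"
  shows "second_form nu (chart sg t0) x = diag2 (- c) (c / (R (l - x $ 2))^2)"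
proof -
  let ?t = "l - x $ 2" and ?C = "cos (t0 + x $ 1)" and ?S = "sin (t0 + x $ 1)"
  have xh: "x \<in> half_plane" using x W_half_plane by auto
  have sg2: "sg * sg = 1" using sg by auto
  have cs: "?C * ?C + ?S * ?S = 1" by simp
  note nu = nu_chart[OF sg x] and pd = pd_pd_chart[OF xh]
  have 11: "pd 1 (pd 1 (chart sg t0)) x \<bullet> nu (chart sg t0 x) = - c"
  proof -
    have "pd 1 (pd 1 (chart sg t0)) x \<bullet> nu (chart sg t0 x) = - (R ?t * (c / R ?t) * (?C * ?C + ?S * ?S))"
      unfolding nu pd inner_vec4 by (simp only: ring_distribs mult_ac) simp
    then show ?thesis unfolding cs using R_nz[of ?t] by simp
  qed
  have 22: "pd 2 (pd 2 (chart sg t0)) x \<bullet> nu (chart sg t0 x) = c / (R ?t)^2"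
  proof -
    define k where "k = - R ?t + c^2 / R ?t ^ 3"
    have "pd 2 (pd 2 (chart sg t0)) x \<bullet> nu (chart sg t0 x)
       = F1 ?t * a2 ?t + (sg * sg) * (F2 ?t * b2 ?t) + c / R ?t * k * (?C * ?C + ?S * ?S)"
      unfolding nu pd inner_vec4 k_def[symmetric] by (simp only: ring_distribs mult_ac)
    then show ?thesis unfolding cs sg2 k_def using normal_acceleration[of ?t] by simp
  qed
  show ?thesis
    by (rule eq_diag2I) (simp_all add: second_form_def 11 22, simp_all add: nu pd inner_vec4)
qed

lemma shape_operator_chart:
  assumes sg: "sg = 1 \<or> sg = -1" and x: "x \<in> W"
  shows "shape_operator nu (chart sg t0) x = diag2 (- (c / (R (l - x $ 2))^2)) (c / (R (l - x $ 2))^2)"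
proof -
  have xh: "x \<in> half_plane" using x W_half_plane by auto
  have "(R (l - x $ 2))^2 \<noteq> 0" using R_nz by simp
  then show ?thesis
    by (simp add: shape_operator_def first_form_chart[OF sg xh] second_form_chart[OF sg x] matrix_inv_diag2 diag2_mult)
qed

lemma mean_curvature_chart:
  "sg = 1 \<or> sg = -1 \<Longrightarrow> x \<in> W \<Longrightarrow> mean_curvature nu (chart sg t0) x = 0"
  by (simp add: mean_curvature_def shape_operator_chart trace_diag2)

lemma norm_A_sq_chart:
  "sg = 1 \<or> sg = -1 \<Longrightarrow> x \<in> W \<Longrightarrow> norm_A_sq nu (chart sg t0) x = 2 * c^2 / R (l - x $ 2) ^ 4"
  by (simp add: norm_A_sq_def shape_operator_chart trace_diag2 diag2_mult power2_eq_square eval_nat_numeral)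

lemma has_derivative_shift_coord:
  assumes "\<And>s. (h has_real_derivative h' s) (at s)"
  shows "((\<lambda>x::real^2. h (l - x $ 2)) has_derivative
    (\<lambda>v. v $ 1 *\<^sub>R 0 + v $ 2 *\<^sub>R (- h' (l - x $ 2)))) (at x within S)"
  using has_derivative_shift[OF assms] by simp

lemma Dhp_U_chart:
  assumes sg: "sg = 1 \<or> sg = -1" and x: "x \<in> W"
  shows "Dhp (U \<circ> chart sg t0) x = (\<lambda>v. v $ 1 *\<^sub>R 0 + v $ 2 *\<^sub>R (- f1 (l - x $ 2)))"
  by (rule Dhp_cong_eqI[OF openin_W x _ has_derivative_shift_coord[OF df]]) (simp add: U_chart[OF sg])

text \<open>For a function \<open>f\<close> of arc length only the entry with both indices \<open>2\<close> contributes, and the Laplacian is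
  \<open>(R f')' / R\<close>.\<close>

lemma laplace_beltrami_chart:
  assumes sg: "sg = 1 \<or> sg = -1" and x: "x \<in> W"
  shows "laplace_beltrami (chart sg t0) (U \<circ> chart sg t0) x
    = - ((2 * c^2 / R (l - x $ 2) ^ 4 + 2) * f (l - x $ 2))"
proof -
  have xh: "x \<in> half_plane" using x W_half_plane by auto
  define G where "G i j y = sqrt (det (first_form (chart sg t0) y)) * matrix_inv (first_form (chart sg t0) y) $ i $ j
      * pd j (U \<circ> chart sg t0) y" for i j :: 2 and y
  have G: "G 1 1 y = 0" "G 1 2 y = 0" "G 2 1 y = 0" "G 2 2 y = - (R (l - y $ 2) * f1 (l - y $ 2))" if y: "y \<in> W" for y
  proof -
    have yh: "y \<in> half_plane" using y W_half_plane by auto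
    have R: "(R (l - y $ 2))^2 \<noteq> 0" "\<bar>R (l - y $ 2)\<bar> = R (l - y $ 2)"
      using R_pos[of "l - y $ 2"] by simp_all
    have inv: "matrix_inv (first_form (chart sg t0) y) = diag2 (1 / (R (l - y $ 2))^2) 1"
      by (simp only: first_form_chart[OF sg yh] matrix_inv_diag2[OF R(1) one_neq_zero] div_by_1)
    show "G 1 1 y = 0" "G 1 2 y = 0" "G 2 1 y = 0" "G 2 2 y = - (R (l - y $ 2) * f1 (l - y $ 2))"
      unfolding G_def inv
      by (simp_all add: pd_def Dhp_U_chart[OF sg y] axis_def diag2_def) (simp add: first_form_chart[OF sg yh] det_diag2 R(2))
  qed
  have d0: "((\<lambda>x::real^2. 0::real) has_derivative (\<lambda>v. v $ 1 *\<^sub>R 0 + v $ 2 *\<^sub>R 0)) (at x within half_plane)" by simp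
  note zero = pd_eqI[OF xh openin_W x _ d0]
  define D where "D s = P s * f1 s + (- (P s / R s) * f1 s - (2 * c^2 / R s ^ 4 + 2) * f s) * R s" for s
  have D: "D s = - (R s * ((2 * c^2 / R s ^ 4 + 2) * f s))" for s
    using R_nz[of s] by (simp add: D_def algebra_simps)
  have dRf: "((\<lambda>s. - (R s * f1 s)) has_real_derivative - D s) (at s)" for s
    unfolding D_def by (rule DERIV_minus[OF DERIV_mult[OF dR df1]])
  have "pd 2 (G 2 2) x = - (- D (l - x $ 2))"
    by (rule pd_eqI(2)[OF xh openin_W x _ has_derivative_shift_coord[OF dRf]]) (rule G(4))
  moreover have "pd 1 (G 1 1) x = 0" "pd 1 (G 1 2) x = 0" "pd 2 (G 2 1) x = 0"
    using zero(1)[of "G 1 1"] zero(1)[of "G 1 2"] zero(2)[of "G 2 1"] G by auto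
  moreover have "sqrt (det (first_form (chart sg t0) x)) = R (l - x $ 2)"
    using R_pos[of "l - x $ 2"] by (simp add: first_form_chart[OF sg xh] det_diag2)
  ultimately show ?thesis
    unfolding laplace_beltrami_def G_def[symmetric, abs_def] sum_2 using D R_nz[of "l - x $ 2"] by simp
qed

lemma smooth_surface_\<Sigma>: "smooth_surface \<Sigma>"
  unfolding smooth_surface_def by (metis exists_chart chart_at_chart)

lemma minimal_surface_\<Sigma>: "minimal_surface \<Sigma> nu"
  unfolding minimal_surface_def by (metis exists_chart chart_at_chart mean_curvature_chart)

lemma unit_normal_\<Sigma>: "unit_normal \<Sigma> nu"
  unfolding unit_normal_def
proof (intro conjI ballI)
  have R0: "R (snd (coords p)) \<noteq> 0" "1 - (R (snd (coords p)))^2 \<noteq> 0" for p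
    using R_nz R2_less[of "snd (coords p)"] by auto
  show "continuous_on \<Sigma> nu"
    unfolding nu_def[abs_def] Let_def F1_def F2_def
    by (intro continuous_on_vec4 continuous_intros continuous_profile_compose continuous_on_coords ballI R0)
  fix p assume "p \<in> \<Sigma>"
  then obtain sg t0 x where *: "sg = 1 \<or> sg = -1" "x \<in> W" "p = chart sg t0 x" by (metis exists_chart)
  have xh: "x \<in> half_plane" using * W_half_plane by auto
  note n = nu_inner[OF *(1,2), of t0]
  show "norm (nu p) = 1" "nu p \<bullet> p = 0" unfolding *(3) by (rule n)+
  fix v assume "v \<in> tangent_space \<Sigma> p"
  then have "v \<in> range (Dhp (chart sg t0) x)"
    unfolding tangent_space_def
    using chart_range_subset[OF chart_at_chart[OF *(1,2)]] *(3) by blast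
  then show "nu p \<bullet> v = 0"
    unfolding *(3) by (auto simp: Dhp_chart_eq[OF xh] inner_add_right n)
qed

lemma boundary_chart:
  assumes "p \<in> surface_boundary \<Sigma>"
  obtains sg t0 x where "sg = 1 \<or> sg = -1" "x \<in> W" "p = chart sg t0 x" "x $ 2 = 0"
proof -
  have "p \<in> \<Sigma>"
    using assms by (auto simp: surface_boundary_def chart_at_def surface_chart_def dest: openin_imp_subset)
  then obtain sg t0 x where *: "sg = 1 \<or> sg = -1" "x \<in> W" "p = chart sg t0 x" by (metis exists_chart)
  have "\<not> 0 < x $ 2"
    using interior_not_surface_boundary[OF chart_at_chart[OF *(1,2)], of t0] assms *(3) by auto
  then have "x $ 2 = 0" using *(2) by (auto simp: W_def)
  then show thesis using that * by blast
qed

lemma surface_boundary_nonempty: "surface_boundary \<Sigma> \<noteq> {}"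
proof -
  have "pt 0 0 \<in> W" using l_pos by (simp add: W_def)
  from chart_at_chart[OF _ this, of 1 0] show ?thesis
    unfolding surface_boundary_def by (auto intro!: exI)
qed

lemma inner_e1: "e1 \<bullet> vec4 x y z w = x"
  by (simp add: vec4_def inner_simps frame)

lemma geodesic_ball_\<Sigma>: "\<Sigma> \<subseteq> geodesic_ball e1 r"
proof
  fix p assume p: "p \<in> \<Sigma>"
  have S: "p \<in> S3" using \<Sigma>_S3[OF p] by (simp add: S3_def norm_eq_1)
  obtain q where q: "q \<in> cyl_dom" "p = cyl q" using p by (auto simp: \<Sigma>_def)
  have e: "e1 \<bullet> p = a (snd q)" by (simp add: q cyl_def inner_e1)
  have "cos r \<le> a (snd q)" using q(1) by (intro inside) (auto simp: cyl_dom_def)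
  moreover have "(a (snd q))^2 \<le> 1"
    using position_unit[of "snd q"] by (smt (verit) zero_le_power2)
  then have "\<bar>a (snd q)\<bar> \<le> 1" by (simp add: abs_square_le_1)
  ultimately have "arccos (a (snd q)) \<le> arccos (cos r)"
    by (intro arccos_le_mono[THEN iffD2]) (auto simp: abs_le_iff)
  then show "p \<in> geodesic_ball e1 r"
    using S r_bounds by (simp add: geodesic_ball_def S3_dist_def e arccos_cos)
qed

lemma boundary_values:
  assumes "x $ 2 = 0"
  shows "chart sg t0 x = vec4 (cos r) (sg * b l) (R l * cos (t0 + x $ 1)) (R l * sin (t0 + x $ 1))"
    "chart2 sg t0 x = vec4 (sin r) (- (sg * (cot r * b l))) (- (cot r * R l * cos (t0 + x $ 1))) (- (cot r * R l * sin (t0 + x $ 1)))"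
  using assms by (simp_all add: chart_def chart2_def free_boundary boundary_slopes)

lemma surface_boundary_sphere: "surface_boundary \<Sigma> \<subseteq> geodesic_sphere e1 r"
proof
  fix p assume "p \<in> surface_boundary \<Sigma>"
  then obtain sg t0 x where *: "sg = 1 \<or> sg = -1" "x \<in> W" "p = chart sg t0 x" "x $ 2 = 0" by (metis boundary_chart)
  have "p \<in> \<Sigma>" using coords_chart(2)[OF *(1,2)] *(3) by simp
  then have "p \<in> S3" using \<Sigma>_S3 by (simp add: S3_def norm_eq_1)
  then show "p \<in> geodesic_sphere e1 r"
    using r_bounds by (simp add: geodesic_sphere_def S3_dist_def *(3) boundary_values[OF *(4)] inner_e1 arccos_cos)
qed

lemma conormal_chart:
  assumes sg: "sg = 1 \<or> sg = -1" and x: "x \<in> W" "x $ 2 = 0"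
  shows "outward_conormal \<Sigma> (chart sg t0 x) (- chart2 sg t0 x)"
    and "Dhp (chart sg t0) x (- axis 2 1) = - chart2 sg t0 x"
proof -
  have xh: "x \<in> half_plane" using x W_half_plane by auto
  have sg2: "sg^2 = 1" using sg by auto
  show D: "Dhp (chart sg t0) x (- axis 2 1) = - chart2 sg t0 x"
    by (simp add: Dhp_chart_eq[OF xh] axis_def)
  show "outward_conormal \<Sigma> (chart sg t0 x) (- chart2 sg t0 x)"
    unfolding outward_conormal_def
  proof (intro exI conjI)
    show "chart_at \<Sigma> (chart sg t0 x) W (chart sg t0) x" by (rule chart_at_chart[OF sg x(1)])
    show "- chart2 sg t0 x \<in> range (Dhp (chart sg t0) x)" using D by (metis rangeI)
  qed (use x in \<open>simp_all add: pd_chart[OF xh] chart_inner[OF sg2] norm_eq_1 inner_commute[of "chart2 sg t0 x" "chart1 t0 x"]\<close>)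
qed

text \<open>The distance \<open>arccos \<langle>e1, q\<rangle>\<close> has the ambient gradient \<open>- e1 / sin r\<close>, which is not tangent to the
  sphere. Adding a multiple of \<open>\<langle>q, q\<rangle> - 1\<close>, which vanishes on the sphere, corrects this.\<close>

lemma S3_gradient_dist:
  assumes p: "p \<in> S3" "p \<bullet> e1 = cos r"
  shows "S3_gradient (S3_dist e1) p (cot r *\<^sub>R p - (1 / sin r) *\<^sub>R e1)"
proof -
  have s: "sin r > 0" using r_bounds sin_gt_zero by blast
  have pp: "p \<bullet> p = 1" using p by (simp add: S3_def dot_square_norm)
  have lt: "- 1 < cos r" "cos r < 1"
    using cos_monotone_0_pi[of r pi] cos_monotone_0_pi[of 0 r] r_bounds by auto
  have sq: "sqrt (1 - (cos r)^2) = sin r" using s by (simp add: sin_squared_eq[symmetric])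
  have "((\<lambda>q. arccos (e1 \<bullet> q)) has_derivative (\<lambda>v. (e1 \<bullet> v) * inverse (- sin r))) (at p within S3)"
  proof -
    have "(arccos has_real_derivative inverse (- sqrt (1 - (e1 \<bullet> p)^2))) (at (e1 \<bullet> p))"
      by (rule DERIV_arccos) (use p lt in \<open>auto simp: inner_commute\<close>)
    then have d: "(arccos has_derivative (*) (inverse (- sin r))) (at (e1 \<bullet> p))"
      using p(2) sq by (simp add: has_field_derivative_def inner_commute)
    have "((\<lambda>q. e1 \<bullet> q) has_derivative (\<lambda>v. e1 \<bullet> v)) (at p within S3)"
      by (auto intro!: derivative_eq_intros)
    from has_derivative_compose[OF this d] show ?thesis by (simp add: mult.commute)
  qed
  moreover have "((\<lambda>q. cot r / 2 * (q \<bullet> q - 1)) has_derivative (\<lambda>v. cot r * (p \<bullet> v))) (at p within S3)"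
    by (auto intro!: derivative_eq_intros simp: inner_commute)
  ultimately have "((\<lambda>q. arccos (e1 \<bullet> q) + cot r / 2 * (q \<bullet> q - 1)) has_derivative
      (\<lambda>v. (e1 \<bullet> v) * inverse (- sin r) + cot r * (p \<bullet> v))) (at p within S3)"
    by (rule has_derivative_add)
  then have D: "(S3_dist e1 has_derivative (\<lambda>v. (e1 \<bullet> v) * inverse (- sin r) + cot r * (p \<bullet> v))) (at p within S3)"
    by (rule has_derivative_transform[OF p(1), rotated])
       (simp add: S3_dist_def S3_def norm_eq_1)
  have eq: "(e1 \<bullet> v) * inverse (- sin r) + cot r * (p \<bullet> v) = (cot r *\<^sub>R p - (1 / sin r) *\<^sub>R e1) \<bullet> v" for v
    by (simp add: inner_diff_left divide_inverse)
  have "(cot r *\<^sub>R p - (1 / sin r) *\<^sub>R e1) \<bullet> p = 0"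
    using p(2) by (simp add: inner_diff_left pp inner_commute[of e1] cot_def)
  then show ?thesis
    unfolding S3_gradient_def using D unfolding eq by blast
qed

lemma conormal_gradient:
  assumes sg: "sg = 1 \<or> sg = -1" and x: "x \<in> W" "x $ 2 = 0"
  shows "S3_gradient (S3_dist e1) (chart sg t0 x) (- chart2 sg t0 x)"
proof -
  have s: "sin r > 0" using r_bounds sin_gt_zero by blast
  have "chart sg t0 x \<in> \<Sigma>" using coords_chart(2)[OF sg x(1)] .
  then have S: "chart sg t0 x \<in> S3" using \<Sigma>_S3 by (simp add: S3_def norm_eq_1)
  have "chart sg t0 x \<bullet> e1 = cos r"
    by (simp add: inner_commute boundary_values[OF x(2)] inner_e1)
  moreover have "cot r * cos r - 1 / sin r = - sin r"
    using s by (simp add: cot_def field_simps power2_eq_square[symmetric] sin_squared_eq)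
  then have "- chart2 sg t0 x = cot r *\<^sub>R chart sg t0 x - (1 / sin r) *\<^sub>R e1"
    unfolding boundary_values[OF x(2)] by (simp add: vec4_def algebra_simps) (simp add: scaleR_add_left[symmetric] scaleR_diff_left[symmetric])
  ultimately show ?thesis using S3_gradient_dist[OF S] by simp
qed

theorem embedded_annulus: "embedded_free_boundary_minimal_annulus e1 r \<Sigma> nu"
proof -
  have "\<exists>\<eta>. outward_conormal \<Sigma> p \<eta> \<and> S3_gradient (S3_dist e1) p \<eta>" if "p \<in> surface_boundary \<Sigma>" for p
    using boundary_chart[OF that] conormal_chart(1) conormal_gradient by metis
  then show ?thesis
    unfolding embedded_free_boundary_minimal_annulus_def free_boundary_minimal_surface_def
    using compact_\<Sigma> smooth_surface_\<Sigma> geodesic_ball_\<Sigma> unit_normal_\<Sigma> minimal_surface_\<Sigma>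
      surface_boundary_nonempty surface_boundary_sphere \<Sigma>_homeomorphic by blast
qed

theorem U_in_kernel: "U \<in> jacobi_robin_kernel \<Sigma> nu r"
  unfolding jacobi_robin_kernel_def
proof (intro CollectI conjI ballI)
  show "smooth_function \<Sigma> U"
    unfolding smooth_function_def
  proof
    fix p assume "p \<in> \<Sigma>"
    then obtain sg t0 x where *: "sg = 1 \<or> sg = -1" "x \<in> W" "p = chart sg t0 x" by (metis exists_chart)
    have "smooth_on W (U \<circ> chart sg t0)"
      by (rule smooth_on_C_plane[OF openin_W smooth(4)]) (simp add: U_chart[OF *(1)])
    then show "\<exists>W \<phi> x. chart_at \<Sigma> p W \<phi> x \<and> smooth_on W (U \<circ> \<phi>)"
      using chart_at_chart[OF *(1,2)] *(3) by blast
  qed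
next
  fix p assume "p \<in> \<Sigma>"
  then obtain sg t0 x where *: "sg = 1 \<or> sg = -1" "x \<in> W" "p = chart sg t0 x" by (metis exists_chart)
  have "laplace_beltrami (chart sg t0) (U \<circ> chart sg t0) x + (norm_A_sq nu (chart sg t0) x + 2) * U p = 0"
    unfolding *(3) laplace_beltrami_chart[OF *(1,2)] norm_A_sq_chart[OF *(1,2)] U_chart[OF *(1,2)] by (simp add: algebra_simps)
  then show "\<exists>W \<phi> x. chart_at \<Sigma> p W \<phi> x \<and> laplace_beltrami \<phi> (U \<circ> \<phi>) x + (norm_A_sq nu \<phi> x + 2) * U p = 0"
    using chart_at_chart[OF *(1,2)] *(3) by blast
next
  fix p assume "p \<in> surface_boundary \<Sigma>"
  then obtain sg t0 x where *: "sg = 1 \<or> sg = -1" "x \<in> W" "p = chart sg t0 x" "x $ 2 = 0" by (metis boundary_chart)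
  show "robin_condition \<Sigma> r U p"
    unfolding robin_condition_def
  proof (intro exI conjI)
    show "chart_at \<Sigma> p W (chart sg t0) x" unfolding *(3) by (rule chart_at_chart[OF *(1,2)])
    show "outward_conormal \<Sigma> p (- chart2 sg t0 x)" unfolding *(3) by (rule conormal_chart(1)[OF *(1,2,4)])
    show "Dhp (chart sg t0) x (- axis 2 1) = - chart2 sg t0 x" by (rule conormal_chart(2)[OF *(1,2,4)])
    show "Dhp (U \<circ> chart sg t0) x (- axis 2 1) - cot r * U p = 0"
      unfolding Dhp_U_chart[OF *(1,2)] *(3) U_chart[OF *(1,2)] by (simp add: axis_def *(4) robin)
  qed
qed

text \<open>On the parallel \<open>s = 0\<close> both the position and the normal lie in the plane spanned by \<open>e1\<close> and a unit
  vector \<open>\<omega>\<close> orthogonal to the plane of \<open>e1\<close> and \<open>e2\<close>. For skew \<open>Z\<close>, the value of \<open>\<langle>Z p, \<nu> p\<rangle>\<close> is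
  then a fixed multiple of \<open>\<langle>Z e1, \<omega>\<rangle>\<close>, which changes sign with \<open>\<omega>\<close>.\<close>

theorem U_not_killing_induced: "\<not> killing_induced e1 r \<Sigma> nu U"
proof
  assume "killing_induced e1 r \<Sigma> nu U"
  then obtain Z where Z: "killing_field Z" and eq: "\<And>p. p \<in> \<Sigma> \<Longrightarrow> U p = Z p \<bullet> nu p"
    unfolding killing_induced_def by blast
  have e13: "e1 \<in> S3" "e3 \<in> S3" using frame by (simp_all add: S3_def norm_eq_1)
  define k where "k = a 0 * (c / R 0) - R 0 * F1 0"
  have key: "f 0 = \<sigma> * k * (Z e1 \<bullet> e3)" if \<sigma>: "\<sigma> = 1 \<or> \<sigma> = -1" for \<sigma>
  proof -
    \<comment> \<open>the two opposite points \<open>\<phi> = 0\<close> and \<open>\<phi> = \<pi>\<close> of the parallel \<open>s = 0\<close>\<close>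
    define q where "q = (pt \<sigma> 0, 0::real)"
    have "pt \<sigma> 0 \<in> sphere 0 1" unfolding pt_sphere using \<sigma> by auto
    then have q: "q \<in> cyl_dom" using l_pos by (simp add: cyl_dom_def q_def)
    define p where "p = cyl q"
    have p: "p \<in> \<Sigma>" "coords p = q" using q by (simp_all add: p_def \<Sigma>_def coords_cyl)
    have p': "p = a 0 *\<^sub>R e1 + (\<sigma> * R 0) *\<^sub>R e3"
      by (simp add: p_def cyl_def q_def b_0 vec4_def mult.commute)
    have n': "nu p = F1 0 *\<^sub>R e1 + (\<sigma> * (c / R 0)) *\<^sub>R e3"
      by (simp add: nu_def Let_def p(2) q_def F2_def P_0 b_0 vec4_def mult.commute)
    have pS: "p \<in> S3" using \<Sigma>_S3[OF p(1)] by (simp add: S3_def norm_eq_1)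
    have nS: "nu p \<in> S3"
      using unit_normal_\<Sigma> p(1) by (simp add: unit_normal_def S3_def)
    have z0: "Z e1 \<bullet> e1 = 0" "Z e3 \<bullet> e3 = 0" using Z e13 by (auto simp: killing_field_def)
    have z31: "Z e3 \<bullet> e1 = - (Z e1 \<bullet> e3)" by (rule killing_skew[OF Z e13(2,1)])
    have "f 0 = Z p \<bullet> nu p" using eq[OF p(1)] by (simp add: U_def p(2) q_def)
    also have "\<dots> = F1 0 * (Z p \<bullet> e1) + (\<sigma> * (c / R 0)) * (Z p \<bullet> e3)"
      by (subst n') (simp add: inner_add_right)
    also have "Z p \<bullet> e1 = - (Z e1 \<bullet> p)" by (rule killing_skew[OF Z pS e13(1)])
    also have "Z p \<bullet> e3 = - (Z e3 \<bullet> p)" by (rule killing_skew[OF Z pS e13(2)])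
    also have "Z e1 \<bullet> p = \<sigma> * R 0 * (Z e1 \<bullet> e3)" by (subst p') (simp add: inner_add_right z0)
    also have "Z e3 \<bullet> p = - a 0 * (Z e1 \<bullet> e3)" by (subst p') (simp add: inner_add_right z0 z31)
    finally show ?thesis by (simp add: k_def algebra_simps)
  qed
  show False using key[of 1] key[of "-1"] f_0 by simp
qed

end

section \<open>The family of bulging rotational surfaces\<close>

text \<open>The conserved quantity \<open>c\<close>.\<close>

definition flux :: "real \<Rightarrow> real" where
  "flux B = sqrt (1 - B^2) / 2"

definition axial_radius :: "real \<Rightarrow> real \<Rightarrow> real" where
  "axial_radius B s = sqrt ((1 + B * cos (2 * s)) / 2)"

definition radius_deriv :: "real \<Rightarrow> real \<Rightarrow> real" where
  "radius_deriv B s = - B * sin (2 * s) / (2 * axial_radius B s)"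

text \<open>\<open>|w|\<^sup>2\<close> for \<open>w = 1 + B e\<^sup>2\<^sup>i\<^sup>s\<close>.\<close>

definition w_sq :: "real \<Rightarrow> real \<Rightarrow> real" where
  "w_sq B s = 1 + 2 * B * cos (2 * s) + B^2"

definition foot_rate :: "real \<Rightarrow> real \<Rightarrow> real" where
  "foot_rate B s = 4 * flux B * axial_radius B s / w_sq B s"

text \<open>The derivative of \<open>foot_rate\<close> in \<open>B\<close>.\<close>

definition foot_rate_B :: "real \<Rightarrow> real \<Rightarrow> real" where
  "foot_rate_B B s = (flux B * cos (2 * s) / axial_radius B s - B * axial_radius B s / flux B) / w_sq B s
     - 8 * flux B * axial_radius B s * (cos (2 * s) + B) / (w_sq B s)^2"

text \<open>The geodesic tangent to the profile at \<open>s\<close> meets the axis at the longitude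
  \<open>foot B s - pi / 2\<close> and at the antipodal point. In terms of this integral, rather than of the
  longitude of the profile, the free boundary condition is the level set \<open>foot B s = pi / 2\<close>.\<close>

definition foot :: "real \<Rightarrow> real \<Rightarrow> real" where
  "foot B s = (LBINT t=0..s. foot_rate B t)"

definition foot_B :: "real \<Rightarrow> real \<Rightarrow> real" where
  "foot_B B s = (LBINT t=0..s. foot_rate_B B t)"

text \<open>\<open>tan (arg w)\<close>, which equals \<open>- P / R\<close>. If the tangent geodesic at \<open>s\<close> passes through \<open>p\<^sub>0\<close>, then
  \<open>P = cot r R\<close> for the distance \<open>r\<close> from \<open>p\<^sub>0\<close>.\<close>

definition slope :: "real \<Rightarrow> real \<Rightarrow> real" where
  "slope B s = B * sin (2 * s) / (1 + B * cos (2 * s))"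

definition longitude :: "real \<Rightarrow> real \<Rightarrow> real" where
  "longitude B s = foot B s - arctan (radius_deriv B s / flux B)"

lemma radius_arg_pos:
  fixes B t :: real
  assumes "0 \<le> B" "B < 1"
  shows "0 < 1 + B * cos t" "0 < 1 - B * cos t"
proof -
  have "\<bar>B * cos t\<bar> \<le> B * 1"
    unfolding abs_mult using assms by (intro mult_mono) auto
  then show "0 < 1 + B * cos t" "0 < 1 - B * cos t" using assms by linarith+
qed

lemma flux_pos: "0 \<le> B \<Longrightarrow> B < 1 \<Longrightarrow> 0 < flux B"
  by (simp add: flux_def power_less_one_iff abs_square_less_1)

lemma flux_sq: "0 \<le> B \<Longrightarrow> B < 1 \<Longrightarrow> (flux B)^2 = (1 - B^2) / 4"
  by (simp add: flux_def power_divide abs_square_le_1)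

lemma axial_radius_pos: "0 \<le> B \<Longrightarrow> B < 1 \<Longrightarrow> 0 < axial_radius B s"
  using radius_arg_pos(1)[of B "2 * s"] by (simp add: axial_radius_def)

lemma axial_radius_sq: "0 \<le> B \<Longrightarrow> B < 1 \<Longrightarrow> (axial_radius B s)^2 = (1 + B * cos (2 * s)) / 2"
  using radius_arg_pos(1)[of B "2 * s"] by (simp add: axial_radius_def)

lemma axial_radius_less_1: "0 \<le> B \<Longrightarrow> B < 1 \<Longrightarrow> axial_radius B s < 1"
  using radius_arg_pos(2)[of B "2 * s"] by (simp add: axial_radius_def)

lemma w_sq_eq: "0 \<le> B \<Longrightarrow> B < 1 \<Longrightarrow> w_sq B s = 4 * ((axial_radius B s)^2 - (flux B)^2)"
  by (simp add: axial_radius_sq flux_sq w_sq_def field_simps)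

lemma w_sq_pos:
  assumes "0 \<le> B" "B < 1"
  shows "0 < w_sq B s"
proof -
  have "w_sq B s = (1 - B)^2 + 2 * B * (1 + cos (2 * s))"
    by (simp add: w_sq_def power2_eq_square algebra_simps)
  moreover have "0 < (1 - B)^2" using assms by simp
  moreover have "0 \<le> 2 * B * (1 + cos (2 * s))"
    using assms cos_ge_minus_one[of "2 * s"] by (intro mult_nonneg_nonneg) linarith+
  ultimately show ?thesis by linarith
qed

lemma flux_less_radius:
  assumes "0 \<le> B" "B < 1"
  shows "flux B < axial_radius B s"
proof (rule power2_less_imp_less)
  show "(flux B)^2 < (axial_radius B s)^2"
    using w_sq_pos[OF assms, of s] w_sq_eq[OF assms, of s] by simp
qed (use axial_radius_pos[OF assms, of s] in simp)

lemma radius_first_integral: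
  assumes "0 \<le> B" "B < 1"
  shows "(axial_radius B s * radius_deriv B s)^2
    = (axial_radius B s)^2 * (1 - (axial_radius B s)^2) - (flux B)^2"
proof -
  have "(axial_radius B s * radius_deriv B s)^2 = B^2 * (sin (2 * s))^2 / 4"
    using axial_radius_pos[OF assms, of s]
    by (simp add: radius_deriv_def power_mult_distrib power_divide)
  then show ?thesis
    unfolding axial_radius_sq[OF assms] flux_sq[OF assms] sin_squared_eq
    by (simp add: field_simps power2_eq_square)
qed

lemma DERIV_axial_radius:
  assumes "0 \<le> B" "B < 1"
  shows "(axial_radius B has_real_derivative radius_deriv B s) (at s)"
  unfolding axial_radius_def[abs_def] radius_deriv_def
  using radius_arg_pos(1)[OF assms, of "2 * s"]
  by (auto intro!: derivative_eq_intros simp: axial_radius_def field_simps)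

lemma DERIV_radius_deriv:
  assumes "0 \<le> B" "B < 1"
  shows "(radius_deriv B has_real_derivative
    (- axial_radius B s + (flux B)^2 / (axial_radius B s)^3)) (at s)"
proof -
  let ?R = "axial_radius B s" and ?P = "radius_deriv B s" and ?c = "flux B"
  have R: "?R > 0" using axial_radius_pos[OF assms] .
  have num: "((\<lambda>s. - B * sin (2 * s)) has_real_derivative - B * (cos (2 * s) * 2)) (at s)"
    by (auto intro!: derivative_eq_intros)
  have "(radius_deriv B has_real_derivative
      (- B * (cos (2 * s) * 2) * (2 * ?R) - - B * sin (2 * s) * (2 * ?P)) / (2 * ?R * (2 * ?R))) (at s)"
    using R by (subst radius_deriv_def[abs_def])
     (rule DERIV_divide[OF num DERIV_cmult[OF DERIV_axial_radius[OF assms]]], simp)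
  moreover have "B * sin (2 * s) = - 2 * ?R * ?P" "B * cos (2 * s) = 2 * ?R^2 - 1"
    using R by (simp_all add: radius_deriv_def axial_radius_sq[OF assms] field_simps)
  moreover have "- ((2 * ?R^2 - 1) * 2) * (2 * ?R) - - (- 2 * ?R * ?P) * (2 * ?P)
      = (- ?R + ?c^2 / ?R ^ 3) * (2 * ?R * (2 * ?R))"
  proof -
    have "?R * (- ((2 * ?R^2 - 1) * 2) * (2 * ?R) - - (- 2 * ?R * ?P) * (2 * ?P))
        = - 4 * ?R^2 * (2 * ?R^2 - 1) - 4 * (?R * ?P)^2"
      by (simp add: power2_eq_square algebra_simps)
    also have "\<dots> = - 4 * ?R^2 * (2 * ?R^2 - 1) - 4 * (?R^2 * (1 - ?R^2) - ?c^2)"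
      unfolding radius_first_integral[OF assms] ..
    also have "\<dots> = ?R * ((- ?R + ?c^2 / ?R ^ 3) * (2 * ?R * (2 * ?R)))"
      using R by (simp add: field_simps power2_eq_square power3_eq_cube)
    finally show ?thesis using R by simp
  qed
  ultimately show ?thesis
  proof (elim DERIV_cong, goal_cases)
    case 1
    have e: "- B * (cos (2 * s) * 2) = - ((2 * ?R^2 - 1) * 2)" "- B * sin (2 * s) = - (- 2 * ?R * ?P)"
      using 1(1,2) by simp_all
    have "(- ((2 * ?R^2 - 1) * 2) * (2 * ?R) - - (- 2 * ?R * ?P) * (2 * ?P)) / (2 * ?R * (2 * ?R))
      = - ?R + ?c^2 / ?R ^ 3"
      unfolding 1(3) using R by simp
    then show ?case unfolding e .
  qed
qed

lemma continuous_on_foot_rate: "continuous_on ({0..<1} \<times> UNIV) (\<lambda>(B, s). foot_rate B s)"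
proof -
  have "w_sq (fst x) (snd x) \<noteq> 0" if "x \<in> {0..<1} \<times> UNIV" for x
    using w_sq_pos[of "fst x" "snd x"] that by auto
  then show ?thesis
    unfolding foot_rate_def flux_def axial_radius_def w_sq_def split_beta
    by (intro continuous_intros) auto
qed

lemma continuous_on_foot_rate_B: "continuous_on ({0..<1} \<times> UNIV) (\<lambda>(B, s). foot_rate_B B s)"
proof -
  have "w_sq (fst x) (snd x) \<noteq> 0" "flux (fst x) \<noteq> 0" "axial_radius (fst x) (snd x) \<noteq> 0"
    if "x \<in> {0..<1} \<times> UNIV" for x
    using w_sq_pos[of "fst x" "snd x"] flux_pos[of "fst x"] axial_radius_pos[of "fst x" "snd x"] that
    by auto
  then show ?thesis
    unfolding foot_rate_B_def flux_def axial_radius_def w_sq_def split_beta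
    by (intro continuous_intros) auto
qed

lemma continuous_on_foot_rate_snd:
  assumes "0 \<le> B" "B < 1"
  shows "continuous_on A (foot_rate B)" "continuous_on A (foot_rate_B B)"
proof -
  have p: "continuous_on A (\<lambda>s. (B, s))" by (intro continuous_intros)
  have im: "(\<lambda>s. (B, s)) ` A \<subseteq> {0..<1} \<times> UNIV" using assms by auto
  show "continuous_on A (foot_rate B)"
    using continuous_on_compose2[OF continuous_on_foot_rate p im] by simp
  show "continuous_on A (foot_rate_B B)"
    using continuous_on_compose2[OF continuous_on_foot_rate_B p im] by simp
qed

lemma DERIV_interval_integral:
  fixes f :: "real \<Rightarrow> real"
  assumes "continuous_on UNIV f"
  shows "((\<lambda>s. LBINT t=0..s. f t) has_real_derivative f s) (at s)"
proof -
  define K where "K = \<bar>s\<bar> + 1"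
  have "((\<lambda>u. LBINT t=ereal 0..ereal u. f t) has_vector_derivative f s) (at s within {-K..K})"
    by (rule interval_integral_FTC2)
       (use continuous_on_subset[OF assms] in \<open>auto simp: K_def\<close>)
  moreover have "at s within {-K..K} = at s"
    by (rule at_within_interior) (auto simp: K_def)
  ultimately show ?thesis
    by (simp add: has_real_derivative_iff_has_vector_derivative zero_ereal_def)
qed

lemma DERIV_foot:
  assumes "0 \<le> B" "B < 1"
  shows "(foot B has_real_derivative foot_rate B s) (at s)"
    and "(foot_B B has_real_derivative foot_rate_B B s) (at s)"
  unfolding foot_def[abs_def] foot_B_def[abs_def]
  by (rule DERIV_interval_integral[OF continuous_on_foot_rate_snd(1)[OF assms]],
      rule DERIV_interval_integral[OF continuous_on_foot_rate_snd(2)[OF assms]])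

lemma foot_0 [simp]: "foot B 0 = 0" "foot_B B 0 = 0"
  by (simp_all add: foot_def foot_B_def zero_ereal_def)

lemma foot_eq_integral:
  assumes "0 \<le> B" "B < 1" "0 \<le> s"
  shows "foot B s = integral {0..s} (foot_rate B)" "foot_B B s = integral {0..s} (foot_rate_B B)"
proof -
  have "(foot_rate B has_integral (foot B s - foot B 0)) {0..s}"
    by (rule fundamental_theorem_of_calculus[OF assms(3)])
      (use DERIV_foot(1)[OF assms(1,2)] in
        \<open>auto simp: has_real_derivative_iff_has_vector_derivative[symmetric] intro: DERIV_subset\<close>)
  then show "foot B s = integral {0..s} (foot_rate B)" by (simp add: integral_unique)
  have "(foot_rate_B B has_integral (foot_B B s - foot_B B 0)) {0..s}"
    by (rule fundamental_theorem_of_calculus[OF assms(3)])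
      (use DERIV_foot(2)[OF assms(1,2)] in
        \<open>auto simp: has_real_derivative_iff_has_vector_derivative[symmetric] intro: DERIV_subset\<close>)
  then show "foot_B B s = integral {0..s} (foot_rate_B B)" by (simp add: integral_unique)
qed

text \<open>Rescaling to a fixed interval gives joint continuity in \<open>B\<close> and \<open>s\<close>.\<close>

lemma foot_eq_integral_unit:
  assumes "0 \<le> B" "B < 1"
  shows "foot B s = integral {0..1} (\<lambda>t. s * foot_rate B (s * t))"
proof -
  have "((\<lambda>t. s * foot_rate B (s * t)) has_integral (foot B (s * 1) - foot B (s * 0))) {0..1}"
  proof (rule fundamental_theorem_of_calculus)
    fix t :: real
    have "((\<lambda>t. foot B (s * t)) has_real_derivative foot_rate B (s * t) * s) (at t within {0..1})"
      by (rule DERIV_chain2[OF DERIV_foot(1)[OF assms]]) (auto intro!: derivative_eq_intros)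
    then show "((\<lambda>t. foot B (s * t)) has_vector_derivative s * foot_rate B (s * t)) (at t within {0..1})"
      by (simp add: has_real_derivative_iff_has_vector_derivative mult.commute)
  qed simp
  from integral_unique[OF this] show ?thesis by simp
qed

lemma continuous_on_foot: "continuous_on ({0..<1} \<times> UNIV) (\<lambda>(B, s). foot B s)"
proof -
  have "continuous_on (({0..<1} \<times> UNIV) \<times> cbox 0 1) (\<lambda>(p, t). snd p * foot_rate (fst p) (snd p * t))"
  proof -
    have g: "continuous_on (({0..<1::real} \<times> (UNIV::real set)) \<times> cbox 0 (1::real))
        (\<lambda>q. (fst (fst q), snd (fst q) * snd q))"
      by (intro continuous_intros)
    have "continuous_on (({0..<1} \<times> UNIV) \<times> cbox 0 1)
        (\<lambda>q. foot_rate (fst (fst q)) (snd (fst q) * snd q))"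
      using continuous_on_compose2[OF continuous_on_foot_rate g] by (force simp: split_beta)
    then show ?thesis
      unfolding split_beta by (intro continuous_intros)
  qed
  from integral_continuous_on_param[OF this]
  have "continuous_on ({0..<1} \<times> UNIV)
      (\<lambda>p. integral {0..1} (\<lambda>t. snd p * foot_rate (fst p) (snd p * t)))"
    by simp
  then show ?thesis
    by (rule continuous_on_eq) (auto simp: foot_eq_integral_unit)
qed

lemma DERIV_foot_rate_B:
  assumes "0 < B" "B < 1"
  shows "((\<lambda>B. foot_rate B s) has_real_derivative foot_rate_B B s) (at B)"
proof -
  have B: "0 \<le> B" using assms by simp
  note pos = flux_pos[OF B assms(2)] axial_radius_pos[OF B assms(2), of s] w_sq_pos[OF B assms(2), of s]
  have f: "(flux has_real_derivative - B / (4 * flux B)) (at B)"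
    unfolding flux_def[abs_def]
    using pos(1) by (auto intro!: derivative_eq_intros simp: flux_def field_simps)
  have r: "((\<lambda>B. axial_radius B s) has_real_derivative cos (2 * s) / (4 * axial_radius B s)) (at B)"
    unfolding axial_radius_def
    using pos(2) by (auto intro!: derivative_eq_intros simp: axial_radius_def field_simps)
  have d: "((\<lambda>B. w_sq B s) has_real_derivative 2 * (cos (2 * s) + B)) (at B)"
    unfolding w_sq_def by (auto intro!: derivative_eq_intros)
  have "((\<lambda>B. foot_rate B s) has_real_derivative
      ((4 * (- B / (4 * flux B)) * axial_radius B s + cos (2 * s) / (4 * axial_radius B s) * (4 * flux B)) * w_sq B s
       - 4 * flux B * axial_radius B s * (2 * (cos (2 * s) + B))) / (w_sq B s * w_sq B s)) (at B)"
    unfolding foot_rate_def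
    by (rule DERIV_divide[OF DERIV_mult[OF DERIV_cmult[OF f] r] d]) (use pos in simp)
  moreover have eq: "((4 * (- B / (4 * c)) * R + C / (4 * R) * (4 * c)) * D - 4 * c * R * (2 * (C + B))) / (D * D)
      = (c * C / R - B * R / c) / D - 8 * c * R * (C + B) / D^2"
    if "c \<noteq> 0" "R \<noteq> 0" "D \<noteq> 0" for c R C D :: real
  proof -
    have "4 * (- B / (4 * c)) * R + C / (4 * R) * (4 * c) = c * C / R - B * R / c"
      using that by (simp add: field_simps)
    moreover have "4 * c * R * (2 * (C + B)) = 8 * c * R * (C + B)" by simp
    ultimately show ?thesis
      by (simp only: diff_divide_distrib[of _ _ "D * D"] power2_eq_square) (use that in simp)
  qed
  ultimately show ?thesis
    unfolding foot_rate_B_def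
    using eq[OF less_imp_neq[OF pos(1), symmetric] less_imp_neq[OF pos(2), symmetric]
        less_imp_neq[OF pos(3), symmetric]] by simp
qed

text \<open>Differentiation under the integral sign.\<close>

lemma DERIV_foot_B:
  assumes B: "0 < B" "B < 1" and s: "0 \<le> s"
  shows "((\<lambda>B. foot B s) has_real_derivative foot_B B s) (at B)"
proof -
  have c: "continuous_on ({0<..<1} \<times> cbox 0 s) (\<lambda>(B, t). foot_rate_B B t)"
    by (rule continuous_on_subset[OF continuous_on_foot_rate_B]) auto
  have "((\<lambda>B. integral (cbox 0 s) (foot_rate B)) has_field_derivative integral (cbox 0 s) (foot_rate_B B))
      (at B within {0<..<1})"
  proof (rule leibniz_rule_field_derivative[OF _ _ c])
    show "((\<lambda>b. foot_rate b t) has_real_derivative foot_rate_B b t) (at b within {0<..<1})" if "b \<in> {0<..<1}" for b t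
      using that DERIV_foot_rate_B[of b t] by (auto intro: DERIV_subset)
    show "foot_rate b integrable_on cbox 0 s" if "b \<in> {0<..<1}" for b
      using that continuous_on_foot_rate_snd(1)[of b "{0..s}"] by (auto intro: integrable_continuous_real)
  qed (use B in auto)
  then have d: "((\<lambda>B. integral {0..s} (foot_rate B)) has_field_derivative integral {0..s} (foot_rate_B B)) (at B)"
    using B by (simp only: cbox_interval at_within_open[OF _ open_greaterThanLessThan] greaterThanLessThan_iff)
  have "((\<lambda>B. foot B s) has_field_derivative integral {0..s} (foot_rate_B B)) (at B)"
  proof (rule has_field_derivative_transform_within_open[OF d])
    show "integral {0..s} (foot_rate b) = foot b s" if "b \<in> {0<..<1}" for b
      using foot_eq_integral(1)[of b s] that s by simp
  qed (use B in auto)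
  then show ?thesis using foot_eq_integral(2)[of B s] B s by simp
qed

lemma has_derivative_foot:
  assumes B: "0 < B" "B < 1" and s: "0 < s"
  shows "((\<lambda>(B, s). foot B s) has_derivative (\<lambda>(x, y). x * foot_B B s + y * foot_rate B s)) (at (B, s))"
proof -
  let ?X = "{0<..<1::real}" and ?Y = "{0<..} :: real set"
  have "((\<lambda>(B, s). foot B s) has_derivative
      (\<lambda>(tx, ty). foot_B B s * tx + blinfun_apply (blinfun_scaleR_left (foot_rate B s)) ty)) (at (B, s) within ?X \<times> ?Y)"
  proof (rule has_derivative_partialsI)
    show "((\<lambda>x. foot x s) has_derivative (*) (foot_B B s)) (at B within ?X)"
      using DERIV_foot_B[OF B, of s] s
      by (auto simp: has_field_derivative_def intro: has_derivative_at_withinI)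
    show "((\<lambda>y. foot x y) has_derivative blinfun_apply (blinfun_scaleR_left (foot_rate x y))) (at y within ?Y)"
      if "x \<in> ?X" "y \<in> ?Y" for x y
      using DERIV_foot(1)[of x y] that
      by (auto simp: has_field_derivative_def mult.commute[of _ "foot_rate x y"] intro!: has_derivative_at_withinI)
    have "continuous_on (?X \<times> ?Y) (\<lambda>(B, s). foot_rate B s)"
      by (rule continuous_on_subset[OF continuous_on_foot_rate]) auto
    then have "continuous_on (?X \<times> ?Y) (\<lambda>p. blinfun_scaleR_left (case p of (B, s) \<Rightarrow> foot_rate B s))"
      by (rule bounded_linear.continuous_on[OF bounded_linear_blinfun_scaleR_left])
    then show "continuous (at (B, s) within ?X \<times> ?Y) (\<lambda>(x, y). blinfun_scaleR_left (foot_rate x y))"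
      using B s by (auto simp: continuous_on_eq_continuous_within case_prod_unfold)
  qed (use s in auto)
  moreover have "at (B, s) within ?X \<times> ?Y = at (B, s)"
    by (rule at_within_open) (use B s in \<open>auto intro: open_Times\<close>)
  ultimately show ?thesis
    by (simp add: split_beta mult.commute)
qed

lemma has_derivative_slope:
  assumes B: "0 < B" "B < 1"
  shows "((\<lambda>(B, s). slope B s) has_derivative
    (\<lambda>(x, y). (x * sin (2 * s) + y * (2 * B * (cos (2 * s) + B))) / (1 + B * cos (2 * s))^2)) (at (B, s))"
proof -
  define k where "k = 1 + B * cos (2 * s)"
  have k: "k > 0" using radius_arg_pos(1)[of B "2 * s"] B by (simp add: k_def)
  have num: "((\<lambda>p. fst p * sin (2 * snd p)) has_derivative
      (\<lambda>(x, y). x * sin (2 * s) + y * (2 * B * cos (2 * s)))) (at (B, s))"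
    by (auto intro!: derivative_eq_intros simp: split_beta)
  have den: "((\<lambda>p. 1 + fst p * cos (2 * snd p)) has_derivative
      (\<lambda>(x, y). x * cos (2 * s) - y * (2 * B * sin (2 * s)))) (at (B, s))"
    by (auto intro!: derivative_eq_intros simp: split_beta)
  have "((\<lambda>p. fst p * sin (2 * snd p) / (1 + fst p * cos (2 * snd p))) has_derivative
      (\<lambda>h. - (fst (B, s) * sin (2 * snd (B, s))) * (inverse (1 + fst (B, s) * cos (2 * snd (B, s)))
          * (case h of (x, y) \<Rightarrow> x * cos (2 * s) - y * (2 * B * sin (2 * s)))
          * inverse (1 + fst (B, s) * cos (2 * snd (B, s))))
        + (case h of (x, y) \<Rightarrow> x * sin (2 * s) + y * (2 * B * cos (2 * s))) / (1 + fst (B, s) * cos (2 * snd (B, s)))))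
      (at (B, s))"
    by (rule has_derivative_divide[OF num den]) (use k in \<open>simp add: k_def\<close>)
  then show ?thesis
    unfolding slope_def split_beta
  proof (rule has_derivative_eq_rhs, goal_cases)
    case 1
    have "- (B * sin (2 * s)) * (inverse k * (x * cos (2 * s) - y * (2 * B * sin (2 * s))) * inverse k)
        + (x * sin (2 * s) + y * (2 * B * cos (2 * s))) / k
      = (x * sin (2 * s) + y * (2 * B * (cos (2 * s) + B))) / k^2" for x y
    proof -
      have "- (B * sin (2 * s)) * (x * cos (2 * s) - y * (2 * B * sin (2 * s)))
          + (x * sin (2 * s) + y * (2 * B * cos (2 * s))) * k
        = x * sin (2 * s) + y * (2 * B * (cos (2 * s) + B * ((sin (2 * s))^2 + (cos (2 * s))^2)))"
        unfolding k_def by (simp add: algebra_simps power2_eq_square del: sin_cos_squared_add3)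
      moreover have "- a * (inverse k * u * inverse k) + w / k = (- a * u + w * k) / k^2" for a u w
        using k by (simp add: field_simps power2_eq_square)
      ultimately show ?thesis by simp
    qed
    then show ?case by (auto simp: k_def)
  qed
qed

text \<open>This identifies \<open>longitude\<close>, defined through \<open>foot\<close>, with the angle along a profile of flux \<open>c\<close>.\<close>

lemma DERIV_longitude:
  assumes "0 \<le> B" "B < 1"
  shows "(longitude B has_real_derivative flux B / (axial_radius B s * (1 - (axial_radius B s)^2))) (at s)"
proof -
  define R P c where "R = axial_radius B s" and "P = radius_deriv B s" and "c = flux B"
  have c: "c > 0" and R: "R > 0" "R < 1" "c < R"
    using flux_pos axial_radius_pos axial_radius_less_1 flux_less_radius assms
    by (auto simp: R_def c_def)
  have RP: "R^2 * P^2 = R^2 * (1 - R^2) - c^2"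
    using radius_first_integral[OF assms, of s] by (simp add: R_def P_def c_def power_mult_distrib)
  have R1: "1 - R^2 > 0" "R^2 - c^2 > 0"
    using R c by (auto simp: abs_square_less_1 power_strict_mono)
  have cP: "R^2 * (c^2 + P^2) = (1 - R^2) * (R^2 - c^2)"
    using RP by (simp add: algebra_simps)
  have "((\<lambda>s. arctan (radius_deriv B s / flux B)) has_real_derivative
      inverse (1 + (P / c)^2) * ((- R + c^2 / R ^ 3) / c)) (at s)"
    unfolding P_def R_def c_def
    by (rule DERIV_chain2[OF DERIV_arctan DERIV_cdivide[OF DERIV_radius_deriv[OF assms]]])
  then have "(longitude B has_real_derivative foot_rate B s - inverse (1 + (P / c)^2) * ((- R + c^2 / R ^ 3) / c)) (at s)"
    unfolding longitude_def[abs_def] by (rule DERIV_diff[OF DERIV_foot(1)[OF assms]])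
  moreover have "foot_rate B s = c * R / (R^2 - c^2)"
  proof -
    have "foot_rate B s = (4 * (c * R)) / (4 * (R^2 - c^2))"
      by (simp only: foot_rate_def w_sq_eq[OF assms] R_def c_def mult.assoc)
    also have "\<dots> = c * R / (R^2 - c^2)" by (rule mult_divide_mult_cancel_left) simp
    finally show ?thesis .
  qed
  moreover have "inverse (1 + (P / c)^2) * ((- R + c^2 / R ^ 3) / c) = (c / R) * (c^2 - R^4) / ((1 - R^2) * (R^2 - c^2))"
  proof -
    have "inverse (1 + (P / c)^2) = c^2 / (c^2 + P^2)"
      using c by (simp add: field_simps)
    also have "\<dots> = c^2 * R^2 / ((1 - R^2) * (R^2 - c^2))"
      unfolding cP[symmetric] using R by simp
    finally have i: "inverse (1 + (P / c)^2) = c^2 * R^2 / ((1 - R^2) * (R^2 - c^2))" .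
    have "c^2 * R^2 * ((- R + c^2 / R ^ 3) / c) = (c / R) * (c^2 - R^4)"
      using c R by (simp add: field_simps power2_eq_square eval_nat_numeral)
    then show ?thesis unfolding i times_divide_eq_left by simp
  qed
  moreover have "c * R / (R^2 - c^2) - (c / R) * (c^2 - R^4) / ((1 - R^2) * (R^2 - c^2)) = c / (R * (1 - R^2))"
  proof -
    define u v where "u = 1 - R^2" and "v = R^2 - c^2"
    have uv: "u > 0" "v > 0" using R1 by (simp_all add: u_def v_def)
    have v: "R * R * u - (c^2 - R^4) = v"
      by (simp add: u_def v_def algebra_simps power2_eq_square eval_nat_numeral)
    have "c * R / v - (c / R) * (c^2 - R^4) / (u * v) = c * (R * R * u - (c^2 - R^4)) / (R * u * v)"
      using uv R by (simp add: divide_simps) (simp add: algebra_simps)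
    then show ?thesis unfolding u_def[symmetric] v_def[symmetric] v using uv R by simp
  qed
  ultimately show ?thesis by (simp add: R_def c_def)
qed

lemma DERIV_arctan_tan:
  assumes k: "k > 0" and s: "cos s \<noteq> 0"
  shows "((\<lambda>s. arctan (k * tan s)) has_real_derivative k / ((cos s)^2 + k^2 * (sin s)^2)) (at s)"
proof -
  have p: "(cos s)^2 + k^2 * (sin s)^2 > 0" using s by (simp add: add_pos_nonneg)
  have "((\<lambda>s. arctan (k * tan s)) has_real_derivative
      inverse (1 + (k * tan s)^2) * (k * inverse ((cos s)^2))) (at s)"
    by (rule DERIV_chain2[OF DERIV_arctan DERIV_cmult[OF DERIV_tan[OF s]]])
  moreover have "1 + (k * tan s)^2 = ((cos s)^2 + k^2 * (sin s)^2) / (cos s)^2"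
    using s by (simp add: tan_def field_simps)
  ultimately show ?thesis using s p by (simp add: divide_simps)
qed

text \<open>The rate of the longitude is \<open>c / (1 - R\<^sup>2) + c / (R (1 + R))\<close>. The first term has the exact primitive
  \<open>arctan (k tan s)\<close>, bounded by \<open>\<pi>/2\<close>. The second is at most \<open>c / R \<le> m + (c / R)\<^sup>2 / (4 m)\<close>, and
  \<open>c / R\<^sup>2\<close> has the primitive \<open>arctan (tan s / k)\<close>. The choice \<open>m = sqrt c\<close> makes both errors of
  order \<open>sqrt c\<close>.\<close>

lemma longitude_bound:
  assumes B: "0 < B" "B < 1" and s: "0 \<le> s" "s < pi / 2"
  shows "longitude B s \<le> pi / 2 + 2 * sqrt (flux B)"
proof -
  define c where "c = flux B"
  \<comment> \<open>the ratio of the extreme radii, which turns \<open>tan s\<close> into the primitives of \<open>c / (1 - R\<^sup>2)\<close> and \<open>c / R\<^sup>2\<close>\<close>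
  define k where "k = sqrt ((1 + B) / (1 - B))"
  define m where "m = sqrt c"
  have c: "c > 0" using flux_pos B by (simp add: c_def)
  have m: "m > 0" "m * m = c" using c by (simp_all add: m_def)
  have k: "k > 0" using B by (simp add: k_def)
  have k2: "k^2 * (1 - B) = 1 + B" using B by (simp add: k_def)
  have kc: "k * (1 - B) = 2 * c"
  proof -
    have "(k * (1 - B))^2 = (1 + B) * (1 - B)"
      using k2 by (simp add: power_mult_distrib) (simp add: power2_eq_square)
    also have "\<dots> = (2 * c)^2" using flux_sq[of B] B by (simp add: c_def power_mult_distrib) (simp add: algebra_simps power2_eq_square)
    finally have "(k * (1 - B))^2 = (2 * c)^2" .
    then show ?thesis by (rule power2_eq_imp_eq) (use k B c in auto)
  qed
  define \<Lambda> where "\<Lambda> t = arctan (k * tan t) + m * t + c / (4 * m) * arctan ((1 / k) * tan t)" for t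
  have "\<Lambda> 0 - longitude B 0 \<le> \<Lambda> s - longitude B s"
  proof (rule DERIV_nonneg_imp_nondecreasing[OF s(1)])
    fix t assume t: "0 \<le> t" "t \<le> s"
    have ct: "cos t > 0" using t s by (intro cos_gt_zero_pi) auto
    define R where "R = axial_radius B t"
    have R: "R > 0" "R < 1" using axial_radius_pos axial_radius_less_1 B by (auto simp: R_def)
    have R2: "1 - R^2 > 0" using R by (simp add: abs_square_less_1)
    have c2: "cos (2 * t) = (cos t)^2 - (sin t)^2" by (simp add: cos_double)
    have one: "(cos t)^2 + (sin t)^2 = 1" by simp
    have RR: "2 * R^2 = (1 + B) * (cos t)^2 + (1 - B) * (sin t)^2"
      using one B axial_radius_sq[of B t] by (simp add: R_def c2) (simp add: algebra_simps)
    have QQ: "2 * (1 - R^2) = (1 - B) * (cos t)^2 + (1 + B) * (sin t)^2"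
      using one RR unfolding ring_distribs by linarith
    have d1: "k / ((cos t)^2 + k^2 * (sin t)^2) = c / (1 - R^2)"
    proof -
      have "(1 - B) * ((cos t)^2 + k^2 * (sin t)^2) = 2 * (1 - R^2)"
        unfolding QQ k2[symmetric] by (simp add: algebra_simps)
      then have "k / ((cos t)^2 + k^2 * (sin t)^2) = (k * (1 - B)) / (2 * (1 - R^2))"
        using B by (metis (no_types) diff_gt_0_iff_gt less_irrefl mult.commute mult_divide_mult_cancel_left)
      then show ?thesis unfolding kc mult_divide_mult_cancel_left_if by simp
    qed
    have d2: "(1 / k) / ((cos t)^2 + (1 / k)^2 * (sin t)^2) = c / R^2"
    proof -
      have "(1 - B) * k^2 * ((cos t)^2 + (1 / k)^2 * (sin t)^2) = 2 * R^2"
        unfolding RR k2[symmetric] using k by (simp add: algebra_simps power_divide)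
      moreover have "(1 / k) / X = (k * (1 - B)) / ((1 - B) * k^2 * X)" for X
        using k B by (simp add: power2_eq_square)
      ultimately show ?thesis by (simp add: kc)
    qed
    have "(\<Lambda> has_real_derivative c / (1 - R^2) + m * 1 + c / (4 * m) * (c / R^2)) (at t)"
      unfolding \<Lambda>_def[abs_def]
      using DERIV_arctan_tan[of k t] DERIV_arctan_tan[of "1 / k" t] k ct
      unfolding d1 d2 by (intro DERIV_add DERIV_cmult DERIV_ident) auto
    from DERIV_diff[OF this DERIV_longitude[of B t]] B
    have D: "((\<lambda>t. \<Lambda> t - longitude B t) has_real_derivative
        c / (1 - R^2) + m * 1 + c / (4 * m) * (c / R^2) - c / (R * (1 - R^2))) (at t)"
      by (simp add: R_def c_def)
    have "c / (R * (1 - R^2)) - c / (1 - R^2) = c / (R * (1 + R))"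
    proof -
      have "1 - R^2 = (1 - R) * (1 + R)" by (simp add: algebra_simps power2_eq_square)
      then have "c / (R * (1 - R^2)) - c / (1 - R^2) = (c * (1 - R)) / (R * ((1 - R) * (1 + R)))"
        using R by (simp add: divide_simps) (simp add: algebra_simps)
      then show ?thesis using R by simp
    qed
    also have "\<dots> \<le> c / R"
      using R c by (intro divide_left_mono) auto
    also have "\<dots> \<le> m + c / (4 * m) * (c / R^2)"
    proof -
      have "0 \<le> (2 * m - c / R)^2 / (4 * m)" using m by simp
      also have "\<dots> = m - c / R + c / (4 * m) * (c / R^2)"
        using m(1) R(1) by (simp add: power2_eq_square field_simps)
      finally show ?thesis by simp
    qed
    finally show "\<exists>y. ((\<lambda>t. \<Lambda> t - longitude B t) has_real_derivative y) (at t) \<and> y \<ge> 0"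
      using D by (intro exI conjI) auto
  qed
  moreover have "\<Lambda> 0 = 0" "longitude B 0 = 0"
    by (simp_all add: \<Lambda>_def longitude_def radius_deriv_def)
  ultimately have "longitude B s \<le> \<Lambda> s" by simp
  also have "\<Lambda> s \<le> pi / 2 + m * (pi / 2) + c / (4 * m) * (pi / 2)"
    unfolding \<Lambda>_def using m c s less_imp_le[OF arctan_ubound]
    by (intro add_mono mult_left_mono) auto
  also have "\<dots> = pi / 2 + (5 * pi / 8) * m"
    using m by (simp add: m(2)[symmetric] field_simps)
  also have "\<dots> \<le> pi / 2 + 2 * m"
    using m pi_less_4 pi_approx by (intro add_left_mono mult_right_mono) auto
  finally show ?thesis by (simp add: m_def c_def)
qed

lemma slope_eq:
  assumes "0 \<le> B" "B < 1"
  shows "slope B s = - radius_deriv B s / axial_radius B s"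
  using axial_radius_sq[OF assms, of s] axial_radius_pos[OF assms, of s]
  by (simp add: slope_def radius_deriv_def power2_eq_square field_simps)

text \<open>A solution of \<open>foot = \<pi>/2\<close> has longitude \<open>\<pi>/2 + arctan (- P / c)\<close>, so a longitude close to \<open>\<pi>/2\<close>
  leaves little room for the slope \<open>- P / R \<le> - P / c\<close>.\<close>

lemma slope_bound:
  assumes B: "0 < B" "B < 1" and s: "0 \<le> s" "s < pi / 2" and fb: "foot B s = pi / 2"
  shows "arctan (slope B s) \<le> 2 * sqrt (flux B)"
proof -
  have B0: "0 \<le> B" using B by simp
  have "sin (2 * s) \<ge> 0" using s by (intro sin_ge_zero) auto
  then have "- radius_deriv B s \<ge> 0"
    using B axial_radius_pos[OF B0 B(2), of s] by (simp add: radius_deriv_def)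
  then have "slope B s \<le> - radius_deriv B s / flux B"
    unfolding slope_eq[OF B0 B(2)]
    using flux_less_radius[OF B0 B(2), of s] flux_pos[OF B0 B(2)]
    by (intro divide_left_mono) (auto intro: mult_pos_pos less_trans)
  then have "arctan (slope B s) \<le> arctan (- radius_deriv B s / flux B)"
    by (simp add: arctan_le_iff)
  also have "\<dots> = longitude B s - pi / 2"
    by (simp add: longitude_def fb arctan_minus)
  finally show ?thesis using longitude_bound[OF B s] by linarith
qed

text \<open>For the Clifford torus \<open>foot 0 s = sqrt 2 s\<close>, which exceeds \<open>\<pi>/2\<close> at \<open>s = \<pi>/2\<close>. This persists for small
  \<open>B\<close>, and the intermediate value theorem applies.\<close>

lemma exists_bulge_solution: "\<exists>B s. 0 < B \<and> B < 1 \<and> 0 < s \<and> s < pi / 2 \<and> foot B s = pi / 2"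
proof -
  have "foot 0 (pi / 2) > pi / 2"
  proof -
    have "foot_rate 0 = (\<lambda>s. sqrt 2)"
      by (auto simp: foot_rate_def flux_def axial_radius_def w_sq_def real_sqrt_divide field_simps)
    then have "foot 0 (pi / 2) = sqrt 2 * (pi / 2)"
      using foot_eq_integral(1)[of 0 "pi / 2"] by simp
    moreover have "1 * (pi / 2) < sqrt 2 * (pi / 2)" by (intro mult_strict_right_mono) auto
    ultimately show ?thesis by simp
  qed
  moreover have "continuous_on {0..<1} (\<lambda>B. foot B (pi / 2))"
  proof -
    have "continuous_on {0..<1} (\<lambda>B. (B, pi / 2))" by (intro continuous_intros)
    from continuous_on_compose2[OF continuous_on_foot this] show ?thesis by force
  qed
  then have "((\<lambda>B. foot B (pi / 2)) \<longlongrightarrow> foot 0 (pi / 2)) (at 0 within {0..<1})"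
    by (simp add: continuous_on_def)
  ultimately have "\<forall>\<^sub>F B in at 0 within {0..<1}. foot B (pi / 2) > pi / 2"
    by (intro order_tendstoD(1))
  then obtain d where d: "d > 0" "\<And>B. B \<in> {0..<1} \<Longrightarrow> B \<noteq> 0 \<Longrightarrow> dist B 0 < d \<Longrightarrow> foot B (pi / 2) > pi / 2"
    by (auto simp: eventually_at)
  define B where "B = min (d / 2) (1 / 2)"
  have B: "0 < B" "B < 1" "foot B (pi / 2) > pi / 2"
    using d(1) d(2)[of B] by (auto simp: B_def)
  have "continuous_on {0..pi / 2} (foot B)"
    using DERIV_foot(1)[of B] B by (intro DERIV_continuous_on) (auto intro: DERIV_subset)
  then obtain s where s: "0 \<le> s" "s \<le> pi / 2" "foot B s = pi / 2"
    using IVT'[of "foot B" 0 "pi / 2" "pi / 2"] B by auto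
  moreover have "s \<noteq> 0" using s(3) by auto
  moreover have "s \<noteq> pi / 2" using s(3) B(3) by (metis less_irrefl)
  ultimately show ?thesis using B by (intro exI[of _ B] exI[of _ s]) auto
qed

lemma exists_small_flux:
  assumes "e > 0"
  shows "\<exists>b. 0 < b \<and> b < 1 \<and> (\<forall>B. b \<le> B \<and> B < 1 \<longrightarrow> 2 * sqrt (flux B) < e)"
proof -
  have "((\<lambda>B. 2 * sqrt (flux B)) \<longlongrightarrow> 2 * sqrt (flux 1)) (at_left 1)"
    unfolding flux_def by (intro tendsto_intros) simp_all
  then have "\<forall>\<^sub>F B in at_left 1. 2 * sqrt (flux B) < e"
    using assms by (auto simp: flux_def dest: order_tendstoD)
  then obtain b where b: "b < 1" "\<And>B. b < B \<Longrightarrow> B < 1 \<Longrightarrow> 2 * sqrt (flux B) < e"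
    by (auto simp: eventually_at_left_field)
  show ?thesis
    by (rule exI[of _ "(max b 0 + 1) / 2"]) (use b in \<open>auto intro!: b(2)\<close>)
qed

text \<open>The slope attains its maximum on the compact part \<open>B \<le> max b B0\<close> of the curve \<open>foot = \<pi>/2\<close>. The maximum is
  neither at \<open>B = 0\<close>, where the slope vanishes, nor at \<open>B \<ge> b\<close>, where it is
  smaller than at a known point. If the differentials of \<open>foot\<close> and the slope were independent there, the map
  \<open>(foot, slope)\<close> would be open at that point, and the slope could be increased along the curve.\<close>

theorem exists_critical_bulge:
  "\<exists>B s. 0 < B \<and> B < 1 \<and> 0 < s \<and> s < pi / 2 \<and> foot B s = pi / 2 \<and>
     foot_B B s * (2 * B * (cos (2 * s) + B)) = foot_rate B s * sin (2 * s)"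
proof -
  obtain B0 s0 where 0: "0 < B0" "B0 < 1" "0 < s0" "s0 < pi / 2" "foot B0 s0 = pi / 2"
    using exists_bulge_solution by blast
  have slope_pos: "0 < slope B s" if "0 < B" "B < 1" "0 < s" "s < pi / 2" for B s
    using that radius_arg_pos(1)[of B "2 * s"] by (auto simp: slope_def intro!: divide_pos_pos mult_pos_pos sin_gt_zero)
  \<comment> \<open>beyond \<open>b\<close> the slope is below its value at \<open>(B0, s0)\<close>\<close>
  obtain b where b: "\<And>B. b \<le> B \<Longrightarrow> B < 1 \<Longrightarrow> 2 * sqrt (flux B) < arctan (slope B0 s0)" "0 < b" "b < 1"
    using exists_small_flux[of "arctan (slope B0 s0)"] slope_pos[OF 0(1-4)]
    by (auto simp: zero_less_arctan_iff)
  define K where "K = ({0..max b B0} \<times> {0..pi / 2}) \<inter> {p \<in> {0..max b B0} \<times> {0..pi / 2}. (case p of (B, s) \<Rightarrow> foot B s) = pi / 2}"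
  have sub: "{0..max b B0} \<times> {0..pi / 2} \<subseteq> {0..<1} \<times> UNIV" using b 0 by auto
  have "compact K"
    unfolding K_def
    by (intro compact_Int_closed compact_Times compact_Icc continuous_closed_preimage_constant
        continuous_on_subset[OF continuous_on_foot sub] closed_Times closed_atLeastAtMost)
  moreover have "(B0, s0) \<in> K" using 0 by (auto simp: K_def)
  moreover have "continuous_on K (\<lambda>(B, s). slope B s)"
    unfolding slope_def split_beta
  proof (intro continuous_intros ballI)
    fix p assume "p \<in> K"
    then show "1 + fst p * cos (2 * snd p) \<noteq> 0"
      using radius_arg_pos(1)[of "fst p" "2 * snd p"] sub by (fastforce simp: K_def)
  qed
  ultimately obtain p where p: "p \<in> K" "\<And>q. q \<in> K \<Longrightarrow> (case q of (B, s) \<Rightarrow> slope B s) \<le> (case p of (B, s) \<Rightarrow> slope B s)"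
    using continuous_attains_sup[of K "\<lambda>(B, s). slope B s"] by blast
  obtain B s where ps: "p = (B, s)" by (cases p)
  have K: "0 \<le> B" "B \<le> max b B0" "0 \<le> s" "s \<le> pi / 2" "foot B s = pi / 2"
    using p(1) by (auto simp: K_def ps)
  have le: "slope B0 s0 \<le> slope B s" using p(2)[OF \<open>(B0, s0) \<in> K\<close>] by (simp add: ps)
  have pos: "0 < slope B s" using le slope_pos[OF 0(1-4)] by linarith
  have B1: "B < 1" using K(2) b 0 by auto
  have Bp: "0 < B" using K(1) pos by (cases "B = 0") (auto simp: slope_def)
  have sp: "0 < s" using K(3) pos by (cases "s = 0") (auto simp: slope_def)
  have sp2: "s < pi / 2" using K(4) pos by (cases "s = pi / 2") (auto simp: slope_def)
  have Bb: "B < b"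
  proof (rule ccontr)
    assume "\<not> B < b"
    then have "2 * sqrt (flux B) < arctan (slope B0 s0)" using b B1 by simp
    also have "\<dots> \<le> arctan (slope B s)" using le by (simp add: arctan_le_iff)
    also have "\<dots> \<le> 2 * sqrt (flux B)" by (rule slope_bound[OF Bp B1 K(3) sp2 K(5)])
    finally show False by simp
  qed
  define k where "k = (1 + B * cos (2 * s))^2"
  define f where "f = (\<lambda>p. (case p of (B, s) \<Rightarrow> foot B s, case p of (B, s) \<Rightarrow> slope B s))"
  define f' where "f' = (\<lambda>p. (case p of (x, y) \<Rightarrow> x * foot_B B s + y * foot_rate B s,
      case p of (x, y) \<Rightarrow> (x * sin (2 * s) + y * (2 * B * (cos (2 * s) + B))) / k))"
  have k: "k > 0" using radius_arg_pos(1)[OF K(1) B1, of "2 * s"] by (simp add: k_def)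
  have f': "(f has_derivative f') (at (B, s))"
    unfolding f_def f'_def k_def
    by (rule has_derivative_Pair[OF has_derivative_foot[OF Bp B1 sp] has_derivative_slope[OF Bp B1]])
  define \<Delta> where "\<Delta> = foot_B B s * (2 * B * (cos (2 * s) + B)) - foot_rate B s * sin (2 * s)"
  have "\<Delta> = 0"
  proof (rule ccontr)
    assume \<Delta>: "\<Delta> \<noteq> 0"
    \<comment> \<open>the inverse of \<open>f'\<close> by Cramer's rule; its determinant is \<open>\<Delta> / k\<close>\<close>
    define g where "g = (\<lambda>q::real\<times>real. ((2 * B * (cos (2 * s) + B) * fst q - foot_rate B s * k * snd q) / \<Delta>,
        (foot_B B s * k * snd q - sin (2 * s) * fst q) / \<Delta>))"
    have "f' (g q) = q" for q
    proof -
      have "(2 * B * (cos (2 * s) + B) * fst q - foot_rate B s * k * snd q) * foot_B B s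
          + (foot_B B s * k * snd q - sin (2 * s) * fst q) * foot_rate B s = \<Delta> * fst q"
        "(2 * B * (cos (2 * s) + B) * fst q - foot_rate B s * k * snd q) * sin (2 * s)
          + (foot_B B s * k * snd q - sin (2 * s) * fst q) * (2 * B * (cos (2 * s) + B)) = \<Delta> * (k * snd q)"
        by (simp_all add: \<Delta>_def algebra_simps)
      then show ?thesis
        using \<Delta> k by (simp add: f'_def g_def add_divide_distrib[symmetric] prod_eq_iff)
    qed
    then have fg: "f' \<circ> g = id" by auto
    have lin: "bounded_linear g"
      unfolding g_def divide_inverse by (auto intro!: bounded_linear_intros)
    define S where "S = {0<..<b} \<times> {0<..<pi / 2}"
    have "open S" by (simp add: S_def open_Times)
    have xS: "(B, s) \<in> S" using Bp Bb sp sp2 by (simp add: S_def)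
    have cf: "continuous_on S f"
      unfolding f_def
    proof (intro continuous_on_Pair)
      show "continuous_on S (\<lambda>(B, s). foot B s)"
        by (rule continuous_on_subset[OF continuous_on_foot]) (use b in \<open>auto simp: S_def\<close>)
      show "continuous_on S (\<lambda>(B, s). slope B s)"
        unfolding slope_def split_beta
      proof (intro continuous_intros ballI)
        fix p assume "p \<in> S"
        then show "1 + fst p * cos (2 * snd p) \<noteq> 0"
          using radius_arg_pos(1)[of "fst p" "2 * snd p"] b by (fastforce simp: S_def)
      qed
    qed
    have "f (B, s) \<in> interior (f ` S)"
      by (rule sussmann_open_mapping[OF \<open>open S\<close> cf xS f' lin fg]) (use xS \<open>open S\<close> in \<open>auto simp: interior_open\<close>)
    then obtain e where e: "e > 0" "ball (f (B, s)) e \<subseteq> f ` S"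
      by (auto simp: mem_interior)
    have "(foot B s, slope B s + e / 2) \<in> ball (f (B, s)) e"
      using e(1) by (simp add: f_def dist_Pair_Pair dist_real_def)
    then have "(foot B s, slope B s + e / 2) \<in> f ` S" using e(2) by blast
    then obtain B' s' where q: "(B', s') \<in> S" "foot B' s' = foot B s" "slope B' s' = slope B s + e / 2"
      by (auto simp: f_def)
    then have "(B', s') \<in> K" using K(5) by (auto simp: K_def S_def)
    from p(2)[OF this] show False using q e(1) by (simp add: ps)
  qed
  then show ?thesis
    using Bp B1 sp sp2 K(5) by (intro exI[of _ B] exI[of _ s]) (simp add: \<Delta>_def)
qed

section \<open>The Jacobi field of the family\<close>

lemma polynomial_foot_rate:
  fixes B C :: real
  shows "(C - 2 * B - 3 * B^2 * C) * (1 + 2 * B * C + B^2) - 4 * (1 - B^2) * (1 + B * C) * (C + B)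
    = (B^4 - 6 * B^2 - 3) * C + (2 * B ^ 3 - 6 * B) - 2 * B * (1 + B^2) * C^2"
  by algebra

text \<open>The Jacobi equation and the Robin condition for the variation field, after all denominators are cleared, are
  polynomial identities in \<open>B\<close> and \<open>C = cos (2 s)\<close>.\<close>

lemma polynomial_ode:
  fixes B C S :: real
  assumes S: "S^2 = 1 - C^2"
  defines "k \<equiv> 1 + B * C" and "D \<equiv> 1 + 2 * B * C + B^2" and "A \<equiv> (1 + B^2) * C + 2 * B"
    and "N \<equiv> (B^4 - 6 * B^2 - 3) * C + (2 * B ^ 3 - 6 * B) - 2 * B * (1 + B^2) * C^2"
    and "N' \<equiv> (B^4 - 6 * B^2 - 3) - 4 * B * (1 + B^2) * C"
  shows "- 4 * (1 - B^2)^2 * (C * D + 4 * B * S^2) * k^2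
      + N * D * (2 * B * C * k + 2 * B^2 * S^2 - (1 - B^2 - k^2)) + B * k * S^2 * (8 * B * N - 2 * N' * D)
    = - 2 * B * S^2 * (1 - B^2)^2 * k * D + B^2 * S^2 * N * D - (2 * (1 - B^2) + 2 * k^2) * A * D^2"
  unfolding S k_def D_def A_def N_def N'_def by algebra

lemma polynomial_robin:
  fixes B C :: real
  shows "- 2 * (1 - B^2)^2 * (1 + B * C) + B * ((B^4 - 6 * B^2 - 3) * C + (2 * B ^ 3 - 6 * B) - 2 * B * (1 + B^2) * C^2
      + ((1 + B^2) * C + 2 * B) * (1 + 2 * B * C + B^2)) = - 2 * (1 - B^2) * (1 + 2 * B * C + B^2)"
  by algebra

text \<open>Numerator of \<open>foot_rate_B\<close> over the common denominator \<open>4 c R |w|\<^sup>4\<close>.\<close>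

definition foot_rate_num :: "real \<Rightarrow> real \<Rightarrow> real" where
  "foot_rate_num B s = (B^4 - 6 * B^2 - 3) * cos (2 * s) + (2 * B ^ 3 - 6 * B) - 2 * B * (1 + B^2) * (cos (2 * s))^2"

definition jacobi_part :: "real \<Rightarrow> real \<Rightarrow> real" where
  "jacobi_part B s = ((1 + B^2) * cos (2 * s) + 2 * B) / (4 * flux B * w_sq B s)"

text \<open>The normal component \<open>R\<^sub>B \<theta>' - P \<theta>\<^sub>B\<close> of the variation in \<open>B\<close>, where subscripts are derivatives in \<open>B\<close>. By
  \<open>\<theta> = foot - arctan (P / c)\<close>, the terms free of the integral combine to \<open>jacobi_part\<close>.\<close>

definition jacobi :: "real \<Rightarrow> real \<Rightarrow> real" where
  "jacobi B s = jacobi_part B s - radius_deriv B s * foot_B B s"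

definition jacobi' :: "real \<Rightarrow> real \<Rightarrow> real" where
  "jacobi' B s = - sin (2 * s) * (1 - B^2)^2 / (2 * flux B * (w_sq B s)^2)
     + B * sin (2 * s) * foot_rate_num B s / (4 * flux B * (1 + B * cos (2 * s)) * (w_sq B s)^2)
     - (- axial_radius B s + (flux B)^2 / axial_radius B s ^ 3) * foot_B B s"

text \<open>Distance of a point of the profile from the origin within the plane that contains the axis.\<close>

definition polar_radius :: "real \<Rightarrow> real \<Rightarrow> real" where
  "polar_radius B s = sqrt (1 - (axial_radius B s)^2)"

lemma foot_rate_B_eq:
  assumes "0 \<le> B" "B < 1"
  shows "foot_rate_B B s = foot_rate_num B s / (4 * flux B * axial_radius B s * (w_sq B s)^2)"
proof -
  define c R D C where "c = flux B" and "R = axial_radius B s" and "D = w_sq B s" and "C = cos (2 * s)"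
  have pos: "c > 0" "R > 0" "D > 0"
    using flux_pos axial_radius_pos w_sq_pos assms by (auto simp: c_def R_def D_def)
  have c2: "4 * c^2 = 1 - B^2" and R2: "2 * R^2 = 1 + B * C"
    using flux_sq[OF assms] axial_radius_sq[OF assms, of s] by (simp_all add: c_def R_def C_def)
  have D: "D = 1 + 2 * B * C + B^2" by (simp add: D_def w_sq_def C_def)
  have "foot_rate_B B s = (c * C / R - B * R / c) / D - 8 * c * R * (C + B) / D^2"
    by (simp add: foot_rate_B_def c_def R_def D_def C_def)
  also have "\<dots> = ((4 * c^2 * C - 2 * B * (2 * R^2)) * D - 4 * (4 * c^2) * (2 * R^2) * (C + B)) / (4 * c * R * D^2)"
    using pos by (simp add: field_simps power2_eq_square)
  also have "(4 * c^2 * C - 2 * B * (2 * R^2)) * D - 4 * (4 * c^2) * (2 * R^2) * (C + B) = foot_rate_num B s"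
    unfolding c2 R2 foot_rate_num_def C_def[symmetric] polynomial_foot_rate[symmetric] D by algebra
  finally show ?thesis by (simp add: c_def R_def D_def)
qed

lemma DERIV_w_sq: "(w_sq B has_real_derivative - 4 * B * sin (2 * s)) (at s)"
  unfolding w_sq_def[abs_def] by (auto intro!: derivative_eq_intros)

lemma DERIV_jacobi_part:
  assumes "0 \<le> B" "B < 1"
  shows "(jacobi_part B has_real_derivative - sin (2 * s) * (1 - B^2)^2 / (2 * flux B * (w_sq B s)^2)) (at s)"
proof -
  define c D C S where "c = flux B" and "D = w_sq B s" and "C = cos (2 * s)" and "S = sin (2 * s)"
  have pos: "c > 0" "D > 0" using flux_pos w_sq_pos assms by (auto simp: c_def D_def)
  have D: "D = 1 + 2 * B * C + B^2" by (simp add: D_def w_sq_def C_def)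
  have num: "((\<lambda>s. (1 + B^2) * cos (2 * s) + 2 * B) has_real_derivative - 2 * (1 + B^2) * S) (at s)"
    unfolding S_def by (auto intro!: derivative_eq_intros simp: algebra_simps)
  have "(jacobi_part B has_real_derivative
      (- 2 * (1 + B^2) * S * (4 * c * D) - ((1 + B^2) * C + 2 * B) * (4 * c * (- 4 * B * S))) / ((4 * c * D) * (4 * c * D))) (at s)"
    unfolding jacobi_part_def[abs_def] c_def D_def C_def S_def
    by (rule DERIV_divide[OF num[unfolded S_def] DERIV_cmult[OF DERIV_w_sq]]) (use pos in \<open>simp add: c_def D_def\<close>)
  moreover have "- 2 * (1 + B^2) * S * (4 * c * D) - ((1 + B^2) * C + 2 * B) * (4 * c * (- 4 * B * S)) = - 8 * c * S * (1 - B^2)^2"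
    unfolding D by algebra
  moreover have "- 8 * c * S * (1 - B^2)^2 / ((4 * c * D) * (4 * c * D)) = - S * (1 - B^2)^2 / (2 * c * D^2)"
    using pos by (simp add: field_simps power2_eq_square)
  ultimately show ?thesis by (simp add: c_def D_def S_def)
qed

lemma radius_deriv_times_foot_rate_B:
  assumes "0 \<le> B" "B < 1"
  shows "radius_deriv B s * foot_rate_B B s = - (B * sin (2 * s) * foot_rate_num B s / (4 * flux B * (1 + B * cos (2 * s)) * (w_sq B s)^2))"
proof -
  define c R D k where "c = flux B" and "R = axial_radius B s" and "D = w_sq B s" and "k = 1 + B * cos (2 * s)"
  have pos: "c > 0" "R > 0" "D > 0"
    using flux_pos axial_radius_pos w_sq_pos assms by (auto simp: c_def R_def D_def)
  have k: "k = 2 * (R * R)" using axial_radius_sq[OF assms, of s] by (simp add: R_def k_def power2_eq_square)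
  show ?thesis
    unfolding foot_rate_B_eq[OF assms] radius_deriv_def c_def[symmetric] R_def[symmetric] D_def[symmetric] k_def[symmetric] k
    using pos by (simp add: field_simps)
qed

lemma DERIV_jacobi:
  assumes "0 \<le> B" "B < 1"
  shows "(jacobi B has_real_derivative jacobi' B s) (at s)"
proof -
  have "(jacobi B has_real_derivative - sin (2 * s) * (1 - B^2)^2 / (2 * flux B * (w_sq B s)^2)
     - ((- axial_radius B s + (flux B)^2 / axial_radius B s ^ 3) * foot_B B s + foot_rate_B B s * radius_deriv B s)) (at s)"
    unfolding jacobi_def[abs_def]
    by (rule DERIV_diff[OF DERIV_jacobi_part[OF assms] DERIV_mult[OF DERIV_radius_deriv[OF assms] DERIV_foot(2)[OF assms]]])
  then show ?thesis
    by (rule DERIV_cong)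
      (simp add: jacobi'_def mult.commute[of "foot_rate_B B s"] radius_deriv_times_foot_rate_B[OF assms])
qed

text \<open>The field \<open>P\<close> of translations along the axis is itself a Jacobi field, so the terms with the
  integral \<open>foot_B\<close> cancel. What remains is \<open>polynomial_ode\<close>.\<close>

lemma DERIV_jacobi':
  assumes "0 \<le> B" "B < 1"
  shows "(jacobi' B has_real_derivative
    - (radius_deriv B s / axial_radius B s) * jacobi' B s - (2 * (flux B)^2 / axial_radius B s ^ 4 + 2) * jacobi B s) (at s)"
proof -
  define c R P D C S k N N' H where "c = flux B" and "R = axial_radius B s" and "P = radius_deriv B s"
    and "D = w_sq B s" and "C = cos (2 * s)" and "S = sin (2 * s)" and "k = 1 + B * C"
    and "N = foot_rate_num B s" and "N' = (B^4 - 6 * B^2 - 3) - 4 * B * (1 + B^2) * C" and "H = foot_B B s"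
  note defs = c_def R_def P_def D_def C_def S_def k_def N_def H_def
  define A where "A = (1 + B^2) * C + 2 * B"
  have pos: "c > 0" "R > 0" "D > 0" "k > 0"
    using flux_pos axial_radius_pos w_sq_pos radius_arg_pos assms by (auto simp: defs)
  have k: "k = 2 * R^2" using axial_radius_sq[OF assms, of s] by (simp add: defs)
  have c2: "4 * c^2 = 1 - B^2" using flux_sq[OF assms] by (simp add: defs)
  have PR: "P / R = - B * S / k" using pos unfolding k by (simp add: P_def radius_deriv_def R_def[symmetric] S_def power2_eq_square)
  have dC: "((\<lambda>s. cos (2 * s)) has_real_derivative - 2 * S) (at s)"
    and dS: "((\<lambda>s. sin (2 * s)) has_real_derivative 2 * C) (at s)"
    by (auto intro!: derivative_eq_intros simp: defs)
  have dD: "(w_sq B has_real_derivative - 4 * B * S) (at s)" using DERIV_w_sq by (simp add: S_def)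
  have dk: "((\<lambda>s. 1 + B * cos (2 * s)) has_real_derivative - 2 * B * S) (at s)"
    by (rule DERIV_cong[OF DERIV_add[OF DERIV_const DERIV_cmult[OF dC]]]) simp
  have dN: "(foot_rate_num B has_real_derivative - 2 * S * N') (at s)"
    unfolding foot_rate_num_def[abs_def]
    by (rule DERIV_cong[OF DERIV_diff[OF DERIV_add[OF DERIV_cmult[OF dC] DERIV_const] DERIV_cmult[OF DERIV_power[OF dC]]]])
       (simp add: N'_def C_def algebra_simps)
  have d1: "((\<lambda>s. - sin (2 * s) * (1 - B^2)^2 / (2 * flux B * (w_sq B s)^2)) has_real_derivative
      - (1 - B^2)\<^sup>2 * (C * D + 4 * B * S^2) / (c * D ^ 3)) (at s)"
  proof -
    have "((\<lambda>s. - sin (2 * s) * (1 - B^2)^2 / (2 * flux B * (w_sq B s)^2)) has_real_derivative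
      (- (2 * C) * (1 - B^2)^2 * (2 * c * D^2) - (- S * (1 - B^2)^2) * (2 * c * (2 * D * (- 4 * B * S)))) / ((2 * c * D^2) * (2 * c * D^2))) (at s)"
      unfolding c_def D_def S_def
      by (rule DERIV_divide[OF DERIV_cmult_right[OF DERIV_minus[OF dS]]
            DERIV_cong[OF DERIV_cmult[OF DERIV_power[OF dD]]]])
         (use pos in \<open>simp_all add: defs\<close>)
    then show ?thesis
      by (rule DERIV_cong) (use pos in \<open>simp add: divide_simps\<close>, algebra)
  qed
  have d2: "((\<lambda>s. B * sin (2 * s) * foot_rate_num B s / (4 * flux B * (1 + B * cos (2 * s)) * (w_sq B s)^2)) has_real_derivative
      B * ((2 * C * N - 2 * S^2 * N') * (k * D) + S^2 * N * (2 * B * D + 8 * B * k)) / (4 * c * k^2 * D ^ 3)) (at s)"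
  proof -
    have num: "((\<lambda>s. B * sin (2 * s) * foot_rate_num B s) has_real_derivative B * (2 * C) * N + (- 2 * S * N') * (B * S)) (at s)"
      unfolding N_def S_def by (rule DERIV_mult[OF DERIV_cmult[OF dS] dN[unfolded S_def]])
    have den: "((\<lambda>s. 4 * flux B * (1 + B * cos (2 * s)) * (w_sq B s)^2) has_real_derivative
        4 * c * (- 2 * B * S) * D^2 + 2 * D * (- 4 * B * S) * (4 * c * k)) (at s)"
      by (rule DERIV_cong[OF DERIV_mult[OF DERIV_cmult[OF dk] DERIV_power[OF dD, of 2]]]) (simp add: defs)
    have "((\<lambda>s. B * sin (2 * s) * foot_rate_num B s / (4 * flux B * (1 + B * cos (2 * s)) * (w_sq B s)^2)) has_real_derivative
      ((B * (2 * C) * N + (- 2 * S * N') * (B * S)) * (4 * c * k * D^2)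
        - B * S * N * (4 * c * (- 2 * B * S) * D^2 + 2 * D * (- 4 * B * S) * (4 * c * k))) / ((4 * c * k * D^2) * (4 * c * k * D^2))) (at s)"
      using DERIV_divide[OF num den] pos by (simp add: defs)
    then show ?thesis
      by (rule DERIV_cong) (use pos in \<open>simp add: divide_simps\<close>, algebra)
  qed
  define P2 where "P2 = - P - 3 * c^2 * P / R ^ 4"
  have d3: "((\<lambda>s. - axial_radius B s + (flux B)^2 / axial_radius B s ^ 3) has_real_derivative P2) (at s)"
  proof -
    have "((\<lambda>s. - axial_radius B s + (flux B)^2 / axial_radius B s ^ 3) has_real_derivative
        - P + (0 * R ^ 3 - c^2 * (3 * R^2 * P)) / (R ^ 3 * R ^ 3)) (at s)"
      unfolding c_def R_def P_def
      by (rule DERIV_add[OF DERIV_minus[OF DERIV_axial_radius[OF assms]]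
            DERIV_divide[OF DERIV_const DERIV_cong[OF DERIV_power[OF DERIV_axial_radius[OF assms]]]]])
         (use pos in \<open>simp_all add: defs\<close>)
    then show ?thesis
      by (rule DERIV_cong) (use pos in \<open>simp add: P2_def field_simps eval_nat_numeral\<close>)
  qed
  define P1 where "P1 = - R + c^2 / R ^ 3"
  define u1 where "u1 = - S * (1 - B^2)^2 / (2 * c * D^2) + B * S * N / (4 * c * k * D^2)"
  define E where "E = - (1 - B^2)\<^sup>2 * (C * D + 4 * B * S^2) / (c * D ^ 3)
      + B * ((2 * C * N - 2 * S^2 * N') * (k * D) + S^2 * N * (2 * B * D + 8 * B * k)) / (4 * c * k^2 * D ^ 3)"
  have "(jacobi' B has_real_derivative E - (P2 * H + foot_rate_B B s * P1)) (at s)"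
    unfolding jacobi'_def[abs_def] E_def H_def P1_def R_def c_def
    by (rule DERIV_diff[OF DERIV_add[OF d1[unfolded c_def] d2[unfolded c_def]] DERIV_mult[OF d3 DERIV_foot(2)[OF assms]]])
  moreover have "E - (P2 * H + foot_rate_B B s * P1) = - (P / R) * (u1 - P1 * H) - (2 * c^2 / R ^ 4 + 2) * (A / (4 * c * D) - P * H)"
  proof -
    have PH: "P2 = - (P / R) * P1 - (2 * c^2 / R ^ 4 + 2) * P"
      using pos unfolding P2_def P1_def by (simp add: field_simps eval_nat_numeral)
    have c4: "2 * c^2 / R ^ 4 = 2 * (1 - B^2) / k^2"
      unfolding k c2[symmetric] using pos by (simp add: power_mult_distrib)
    have hP: "foot_rate_B B s * P1 = (1 - B^2 - k^2) * N / (4 * c * k^2 * D^2)"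
    proof -
      have "P1 / R = (1 - B^2 - k^2) / k^2"
        unfolding P1_def k c2[symmetric] using pos by (simp add: field_simps eval_nat_numeral)
      moreover have "foot_rate_B B s * P1 = (P1 / R) * (N / (4 * c * D^2))"
        unfolding foot_rate_B_eq[OF assms] by (simp add: defs mult_ac)
      ultimately show ?thesis by simp
    qed
    have S2: "S^2 = 1 - C^2" by (simp add: S_def C_def sin_squared_eq)
    have poly: "- 4 * (1 - B^2)^2 * (C * D + 4 * B * S^2) * k^2
      + N * D * (2 * B * C * k + 2 * B^2 * S^2 - (1 - B^2 - k^2)) + B * k * S^2 * (8 * B * N - 2 * N' * D)
    = - 2 * B * S^2 * (1 - B^2)^2 * k * D + B^2 * S^2 * N * D - (2 * (1 - B^2) + 2 * k^2) * A * D^2"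
      using polynomial_ode[OF S2, of B]
      by (simp only: k_def N_def N'_def A_def D_def foot_rate_num_def w_sq_def C_def)
    have "E - foot_rate_B B s * P1 = - (P / R) * u1 - (2 * c^2 / R ^ 4 + 2) * (A / (4 * c * D))"
    proof -
      have "E - foot_rate_B B s * P1 = (- 4 * (1 - B^2)^2 * (C * D + 4 * B * S^2) * k^2
        + N * D * (2 * B * C * k + 2 * B^2 * S^2 - (1 - B^2 - k^2)) + B * k * S^2 * (8 * B * N - 2 * N' * D)) / (4 * c * k^2 * D ^ 3)"
        unfolding E_def hP using pos by (simp add: divide_simps) algebra
      also have "\<dots> = - (P / R) * u1 - (2 * c^2 / R ^ 4 + 2) * (A / (4 * c * D))"
        unfolding poly PR c4 u1_def using pos by (simp add: divide_simps) algebra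
      finally show ?thesis .
    qed
    moreover have "e - ((- q * p1 - K * p) * h + x) = - q * (u - p1 * h) - K * (m - p * h)"
      if "e - x = - q * u - K * m" for e x q u K m p1 p h :: real
      using that by (simp add: algebra_simps)
    ultimately show ?thesis unfolding PH by blast
  qed
  moreover have "jacobi' B s = u1 - P1 * H" "jacobi B s = A / (4 * c * D) - P * H"
    by (simp_all add: jacobi'_def jacobi_def jacobi_part_def u1_def P1_def A_def defs)
  ultimately show ?thesis by (simp add: defs)
qed

text \<open>The coefficient of \<open>foot_B\<close> in the Robin defect is proportional to the derivative of the slope in \<open>s\<close>,
  and the other terms to \<open>foot_rate\<close> times its derivative in \<open>B\<close>. The hypothesis is the linear
  dependence of the differentials of \<open>foot\<close> and the slope.\<close>

lemma jacobi_robin: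
  assumes B: "0 \<le> B" "B < 1" and crit: "foot_B B s * (2 * B * (cos (2 * s) + B)) = foot_rate B s * sin (2 * s)"
  shows "jacobi' B s = radius_deriv B s / axial_radius B s * jacobi B s"
proof -
  define c R P D C S k N H where "c = flux B" and "R = axial_radius B s" and "P = radius_deriv B s"
    and "D = w_sq B s" and "C = cos (2 * s)" and "S = sin (2 * s)" and "k = 1 + B * C"
    and "N = foot_rate_num B s" and "H = foot_B B s"
  note defs = c_def R_def P_def D_def C_def S_def k_def N_def H_def
  define A where "A = (1 + B^2) * C + 2 * B"
  have pos: "c > 0" "R > 0" "D > 0" "k > 0"
    using flux_pos axial_radius_pos w_sq_pos radius_arg_pos B by (auto simp: defs)
  have k: "k = 2 * R^2" using axial_radius_sq[OF B, of s] by (simp add: defs)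
  have c2: "4 * c^2 = 1 - B^2" using flux_sq[OF B] by (simp add: defs)
  have PR: "P / R = - B * S / k" using pos unfolding k by (simp add: P_def radius_deriv_def R_def[symmetric] S_def power2_eq_square)
  have S2: "S^2 = 1 - C^2" by (simp add: S_def C_def sin_squared_eq)
  have poly: "- 2 * (1 - B^2)^2 * k + B * (N + A * D) = - 2 * (1 - B^2) * D"
    using polynomial_robin[of B C] by (simp only: k_def N_def A_def D_def foot_rate_num_def w_sq_def C_def)
  have HH: "H * (2 * B * (C + B)) = 4 * c * R * S / D"
    using crit by (simp add: foot_rate_def defs)
  have P1: "(- R + c^2 / R ^ 3) - P / R * P = - B * (C + B) / (2 * R ^ 3)"
  proof -
    have "R^2 * P^2 = R^2 * (1 - R^2) - c^2"
      using radius_first_integral[OF B, of s] by (simp add: defs power_mult_distrib)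
    then have "(- R + c^2 / R ^ 3) - P / R * P = (2 * c^2 - R^2) / R ^ 3"
      using pos by (simp add: field_simps) algebra
    also have "2 * c^2 - R^2 = (4 * c^2 - 2 * R^2) / 2" by simp
    also have "4 * c^2 - 2 * R^2 = - B * (C + B)"
      unfolding c2 k[symmetric] k_def by (simp add: algebra_simps power2_eq_square)
    finally show ?thesis by simp
  qed
  have "jacobi' B s - P / R * jacobi B s
     = (- S * (1 - B^2)^2 / (2 * c * D^2) + B * S * N / (4 * c * k * D^2) + B * S / k * (A / (4 * c * D)))
       - H * ((- R + c^2 / R ^ 3) - P / R * P)"
  proof -
    have j: "jacobi' B s = - S * (1 - B^2)^2 / (2 * c * D^2) + B * S * N / (4 * c * k * D^2) - (- R + c^2 / R ^ 3) * H"
      "jacobi B s = A / (4 * c * D) - P * H"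
      by (simp_all add: jacobi'_def jacobi_def jacobi_part_def A_def defs)
    have "u - p1 * h - q * (m - p * h) = (u - q * m) - h * (p1 - q * p)" for u p1 h q m p :: real
      by (simp add: algebra_simps)
    from this[of _ "- R + c^2 / R ^ 3" H "P / R" "A / (4 * c * D)" P] show ?thesis
      unfolding j PR by simp
  qed
  also have "- S * (1 - B^2)^2 / (2 * c * D^2) + B * S * N / (4 * c * k * D^2) + B * S / k * (A / (4 * c * D))
     = S * (- 2 * (1 - B^2)^2 * k + B * (N + A * D)) / (4 * c * k * D^2)"
    using pos by (simp add: divide_simps) algebra
  also have "\<dots> = - c * S / (R^2 * D)"
    unfolding poly unfolding c2[symmetric] k using pos by (simp add: field_simps power2_eq_square)
  also have "H * ((- R + c^2 / R ^ 3) - P / R * P) = - (H * (2 * B * (C + B))) / (4 * R ^ 3)"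
    unfolding P1 using pos by (simp add: field_simps)
  also have "\<dots> = - c * S / (R^2 * D)"
    unfolding HH using pos by (simp add: field_simps eval_nat_numeral)
  finally show ?thesis by (simp add: defs)
qed

lemma foot_odd:
  assumes "0 \<le> B" "B < 1"
  shows "foot B (- s) = - foot B s" "foot_B B (- s) = - foot_B B s"
proof -
  have odd: "h (- s) = - h s"
    if d: "\<And>s. (h has_real_derivative h' s) (at s)" and even: "\<And>s. h' (- s) = h' s" and 0: "h 0 = 0" for h h' :: "real \<Rightarrow> real"
  proof -
    have "((\<lambda>s. h (- s) + h s) has_real_derivative h' (- t) * (- 1) + h' t) (at t)" for t
      by (rule DERIV_add[OF DERIV_chain2[OF d] d]) (auto intro!: derivative_eq_intros)
    then have "(\<lambda>s. h (- s) + h s) s = (\<lambda>s. h (- s) + h s) 0"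
      by (intro DERIV_isconst_all) (simp add: even)
    then show ?thesis using 0 by simp
  qed
  show "foot B (- s) = - foot B s"
    by (rule odd[OF DERIV_foot(1)[OF assms]]) (simp_all add: foot_rate_def axial_radius_def w_sq_def)
  show "foot_B B (- s) = - foot_B B s"
    by (rule odd[OF DERIV_foot(2)[OF assms]]) (simp_all add: foot_rate_B_def axial_radius_def w_sq_def)
qed

lemma radius_parity: "axial_radius B (- s) = axial_radius B s" "radius_deriv B (- s) = - radius_deriv B s"
  "polar_radius B (- s) = polar_radius B s"
  by (simp_all add: axial_radius_def radius_deriv_def polar_radius_def)

lemma longitude_odd: "0 \<le> B \<Longrightarrow> B < 1 \<Longrightarrow> longitude B (- s) = - longitude B s"
  by (simp add: longitude_def foot_odd radius_parity arctan_minus)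

lemma jacobi_even: "0 \<le> B \<Longrightarrow> B < 1 \<Longrightarrow> jacobi B (- s) = jacobi B s"
  by (simp add: jacobi_def jacobi_part_def foot_odd radius_parity w_sq_def)

lemma polar_radius_pos:
  assumes "0 \<le> B" "B < 1"
  shows "0 < polar_radius B s" "(polar_radius B s)^2 = 1 - (axial_radius B s)^2"
  using axial_radius_pos[OF assms, of s] axial_radius_less_1[OF assms, of s]
  by (simp_all add: polar_radius_def abs_square_less_1 abs_square_le_1)

lemma DERIV_polar_radius:
  assumes "0 \<le> B" "B < 1"
  shows "(polar_radius B has_real_derivative - axial_radius B s * radius_deriv B s / polar_radius B s) (at s)"
proof -
  have "1 - (axial_radius B s)^2 > 0"
    using axial_radius_pos[OF assms, of s] axial_radius_less_1[OF assms, of s] by (simp add: abs_square_less_1)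
  then show ?thesis
    unfolding polar_radius_def[abs_def]
    by (auto intro!: derivative_eq_intros DERIV_axial_radius[OF assms] simp: polar_radius_def field_simps)
qed

lemma longitude_strict_mono:
  assumes "0 \<le> B" "B < 1"
  shows "strict_mono (longitude B)"
proof (rule strict_monoI)
  fix s t :: real assume "s < t"
  then show "longitude B s < longitude B t"
  proof (rule DERIV_pos_imp_increasing)
    fix x
    have "0 < flux B / (axial_radius B x * (1 - (axial_radius B x)^2))"
      using flux_pos[OF assms] axial_radius_pos[OF assms, of x] axial_radius_less_1[OF assms, of x]
      by (intro divide_pos_pos mult_pos_pos) (auto simp: abs_square_less_1)
    then show "\<exists>y. (longitude B has_real_derivative y) (at x) \<and> 0 < y"
      using DERIV_longitude[OF assms] by blast
  qed
qed

lemma DERIV_plane_profile: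
  assumes "0 \<le> B" "B < 1"
  defines "c \<equiv> flux B" and "R \<equiv> axial_radius B" and "P \<equiv> radius_deriv B"
    and "a \<equiv> \<lambda>s. polar_radius B s * cos (longitude B s)" and "b \<equiv> \<lambda>s. polar_radius B s * sin (longitude B s)"
  shows "(a has_real_derivative - (R s * P s * a s + c / R s * b s) / (1 - (R s)^2)) (at s)"
    and "(b has_real_derivative (c / R s * a s - R s * P s * b s) / (1 - (R s)^2)) (at s)"
proof -
  define Q where "Q = polar_radius B s"
  have Q: "Q > 0" "1 - (R s)^2 = Q * Q" using polar_radius_pos[OF assms(1,2)] by (simp_all add: Q_def R_def power2_eq_square)
  have R: "R s > 0" using axial_radius_pos[OF assms(1,2)] by (simp add: R_def)
  note dQ = DERIV_polar_radius[OF assms(1,2), folded R_def P_def, of s, folded Q_def]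
    and dA = DERIV_longitude[OF assms(1,2), folded R_def c_def, of s]
  have "(a has_real_derivative - R s * P s / Q * cos (longitude B s) + - sin (longitude B s) * (c / (R s * (1 - (R s)^2))) * Q) (at s)"
    unfolding a_def Q_def
    by (rule DERIV_mult[OF dQ[unfolded Q_def] DERIV_chain2[OF DERIV_cos dA]])
  then show "(a has_real_derivative - (R s * P s * a s + c / R s * b s) / (1 - (R s)^2)) (at s)"
    by (rule DERIV_cong) (unfold Q(2) a_def b_def Q_def[symmetric], use Q(1) R in \<open>simp add: field_simps\<close>)
  have "(b has_real_derivative - R s * P s / Q * sin (longitude B s) + cos (longitude B s) * (c / (R s * (1 - (R s)^2))) * Q) (at s)"
    unfolding b_def Q_def
    by (rule DERIV_mult[OF dQ[unfolded Q_def] DERIV_chain2[OF DERIV_sin dA]])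
  then show "(b has_real_derivative (c / R s * a s - R s * P s * b s) / (1 - (R s)^2)) (at s)"
    by (rule DERIV_cong) (unfold Q(2) a_def b_def Q_def[symmetric], use Q(1) R in \<open>simp add: field_simps\<close>)
qed

lemma sin_cos_arctan_divide:
  fixes x y :: real
  assumes "y > 0"
  shows "sin (arctan (x / y)) = x / sqrt (y^2 + x^2)" "cos (arctan (x / y)) = y / sqrt (y^2 + x^2)"
proof -
  have "1 + (x / y)^2 = (y^2 + x^2) / y^2" using assms by (simp add: field_simps)
  then have "sqrt (1 + (x / y)^2) = sqrt (y^2 + x^2) / y" using assms by (simp add: real_sqrt_divide)
  then show "sin (arctan (x / y)) = x / sqrt (y^2 + x^2)" "cos (arctan (x / y)) = y / sqrt (y^2 + x^2)"
    using assms by (simp_all add: sin_arctan cos_arctan)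
qed

lemma C_plane_profile:
  assumes "0 \<le> B" "B < 1"
  shows "C_plane k (\<lambda>x. axial_radius B (l - x $ 2))"
    and "C_plane k (\<lambda>x. polar_radius B (l - x $ 2) * cos (longitude B (l - x $ 2)))"
    and "C_plane k (\<lambda>x. polar_radius B (l - x $ 2) * sin (longitude B (l - x $ 2)))"
    and "C_plane k (\<lambda>x. jacobi B (l - x $ 2))"
proof -
  have t: "C_plane k (\<lambda>x. 2 * (l - x $ 2))" for k
    by (intro C_plane_mult C_plane_diff C_plane_const C_plane_coord)
  note sc = C_plane_sin_cos[OF t]
  have C: "C_plane k (\<lambda>x. cos (2 * (l - x $ 2)))" and S: "C_plane k (\<lambda>x. sin (2 * (l - x $ 2)))" for k
    using sc by blast+
  have "0 < (1 + B * cos t) / 2" for t using radius_arg_pos(1)[OF assms, of t] by simp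
  then have R: "C_plane k (\<lambda>x. axial_radius B (l - x $ 2))" for k
    unfolding axial_radius_def
    by (intro C_plane_sqrt C_plane_divide C_plane_add C_plane_mult C_plane_const C) simp_all
  have nz: "axial_radius B s \<noteq> 0" "w_sq B s \<noteq> 0" "flux B \<noteq> 0" "1 - (axial_radius B s)^2 > 0" for s
    using axial_radius_pos[OF assms, of s] axial_radius_less_1[OF assms, of s] w_sq_pos[OF assms, of s] flux_pos[OF assms]
    by (auto simp: abs_square_less_1)
  have RR: "C_plane k (\<lambda>x. 1 - (axial_radius B (l - x $ 2))^2)" for k
    unfolding power2_eq_square by (intro C_plane_diff C_plane_mult C_plane_const R)
  have Q: "C_plane k (\<lambda>x. polar_radius B (l - x $ 2))" for k
    unfolding polar_radius_def by (rule C_plane_sqrt[OF nz(4) RR])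
  have "C_plane k (\<lambda>x. longitude B (l - x $ 2))" for k
  proof (rule C_plane_primitive[OF DERIV_longitude[OF assms]])
    have "axial_radius B s * (1 - (axial_radius B s)^2) \<noteq> 0" for s using nz(1,4)[of s] by simp
    then show "C_plane k (\<lambda>x. flux B / (axial_radius B (l - x $ 2) * (1 - (axial_radius B (l - x $ 2))^2)))"
      by (intro C_plane_divide C_plane_mult C_plane_const R RR)
  qed
  note th = C_plane_sin_cos[OF this]
  have D: "C_plane k (\<lambda>x. w_sq B (l - x $ 2))" for k
    unfolding w_sq_def power2_eq_square by (intro C_plane_add C_plane_mult C_plane_const C)
  have "C_plane k (\<lambda>x. foot_B B (l - x $ 2))" for k
  proof (rule C_plane_primitive[OF DERIV_foot(2)[OF assms]])
    show "C_plane k (\<lambda>x. foot_rate_B B (l - x $ 2))"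
      unfolding foot_rate_B_def power2_eq_square
      by (intro C_plane_diff C_plane_divide C_plane_mult C_plane_add C_plane_const C R D nz) (use nz in simp)
  qed
  moreover have "C_plane k (\<lambda>x. jacobi_part B (l - x $ 2))" for k
    unfolding jacobi_part_def
    by (intro C_plane_divide C_plane_mult C_plane_add C_plane_const C D) (use nz in simp)
  moreover have "C_plane k (\<lambda>x. radius_deriv B (l - x $ 2))" for k
    unfolding radius_deriv_def
    by (intro C_plane_divide C_plane_mult C_plane_const S R) (use nz in simp)
  ultimately show "C_plane k (\<lambda>x. jacobi B (l - x $ 2))"
    unfolding jacobi_def by (intro C_plane_diff C_plane_mult)
  show "C_plane k (\<lambda>x. axial_radius B (l - x $ 2))" by (rule R)
  show "C_plane k (\<lambda>x. polar_radius B (l - x $ 2) * cos (longitude B (l - x $ 2)))"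
    "C_plane k (\<lambda>x. polar_radius B (l - x $ 2) * sin (longitude B (l - x $ 2)))"
    by (intro C_plane_mult Q conjunct1[OF th] conjunct2[OF th])+
qed

text \<open>The longitude increases and stays in \<open>(-\<pi>, \<pi>)\<close>, hence the profile is embedded. It stays in the ball: as long as
  \<open>|\<theta>| \<le> \<pi>/2\<close> it is in the hemisphere around \<open>p\<^sub>0\<close>, and afterwards both \<open>sqrt (1 - R\<^sup>2)\<close> and
  \<open>|cos \<theta>|\<close> grow, so the distance from \<open>p\<^sub>0\<close> increases up to the boundary.\<close>

lemma bulge_annulus:
  fixes e1 e2 e3 e4 :: "real^4"
  assumes frame: "e1 \<bullet> e1 = 1" "e2 \<bullet> e2 = 1" "e3 \<bullet> e3 = 1" "e4 \<bullet> e4 = 1"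
      "e1 \<bullet> e2 = 0" "e1 \<bullet> e3 = 0" "e1 \<bullet> e4 = 0" "e2 \<bullet> e3 = 0" "e2 \<bullet> e4 = 0" "e3 \<bullet> e4 = 0"
    and B: "0 < B" "B < 1" and l: "0 < l" "l < pi / 2" and fb: "foot B l = pi / 2"
    and crit: "foot_B B l * (2 * B * (cos (2 * l) + B)) = foot_rate B l * sin (2 * l)"
  shows "free_boundary_annulus e1 e2 e3 e4 (flux B) l (pi / 2 + arctan (slope B l)) (axial_radius B) (radius_deriv B)
    (\<lambda>s. polar_radius B s * cos (longitude B s)) (\<lambda>s. polar_radius B s * sin (longitude B s)) (jacobi B) (jacobi' B)"
proof -
  have B0: "0 \<le> B" using B by simp
  note B0 = B0 B(2)
  define c R P Q \<theta> r where "c = flux B" and "R = axial_radius B" and "P = radius_deriv B"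
    and "Q = polar_radius B" and "\<theta> = longitude B" and "r = pi / 2 + arctan (slope B l)"
  have c: "c > 0" using flux_pos[OF B0] by (simp add: c_def)
  have R: "R s > 0" "R s < 1" for s using axial_radius_pos[OF B0] axial_radius_less_1[OF B0] by (simp_all add: R_def)
  have Q: "Q s > 0" "(Q s)^2 = 1 - (R s)^2" for s using polar_radius_pos[OF B0] by (simp_all add: Q_def R_def)
  have mono: "strict_mono \<theta>" using longitude_strict_mono[OF B0] by (simp add: \<theta>_def)
  have th0: "\<theta> l = pi / 2 - arctan (P l / c)" by (simp add: \<theta>_def longitude_def fb P_def c_def)
  have thlt: "\<theta> l < pi" using arctan_lbound[of "P l / c"] by (simp add: th0)
  have first: "(R s * P s)^2 = (R s)^2 * (1 - (R s)^2) - c^2" for s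
    using radius_first_integral[OF B0] by (simp add: R_def P_def c_def)
  have slope: "slope B l = - P l / R l" using slope_eq[OF B0] by (simp add: P_def R_def)
  have "sin (2 * l) > 0" using l by (intro sin_gt_zero) auto
  then have Pl: "P l < 0" using B R[of l] by (simp add: P_def radius_deriv_def R_def divide_neg_pos)
  have sl: "slope B l > 0" unfolding slope using divide_neg_pos[OF Pl R(1)[of l]] by simp
  have r: "pi / 2 < r" "r < pi" using sl arctan_ubound[of "slope B l"] by (simp_all add: r_def)
  define h where "h = sqrt ((R l)^2 + (P l)^2)"
  have h: "h > 0" using R[of l] by (simp add: h_def add_pos_nonneg)
  have arc: "arctan (slope B l) = - arctan (P l / R l)" by (simp add: slope arctan_minus)
  have cr: "cos r = P l / h" "sin r = R l / h"
  proof -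
    have "r = pi / 2 - arctan (P l / R l)" by (simp add: r_def arc)
    then show "cos r = P l / h" "sin r = R l / h"
      by (simp_all only: cos_diff sin_diff sin_cos_arctan_divide[OF R(1)] h_def) simp_all
  qed
  have Qh: "sqrt (c^2 + (P l)^2) = Q l * h"
  proof (rule real_sqrt_unique)
    have "(R l)^2 * (c^2 + (P l)^2) = (R l)^2 * ((1 - (R l)^2) * ((R l)^2 + (P l)^2))"
      using first[of l] unfolding power_mult_distrib by algebra
    then have "c^2 + (P l)^2 = (Q l)^2 * ((R l)^2 + (P l)^2)" using R(1)[of l] by (simp add: Q(2))
    then show "(Q l * h)^2 = c^2 + (P l)^2" by (simp add: h_def power_mult_distrib)
  qed (use Q(1)[of l] h in simp)
  have th: "cos (\<theta> l) = P l / (Q l * h)" "sin (\<theta> l) = c / (Q l * h)"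
    by (simp_all add: th0 cos_diff sin_diff sin_cos_arctan_divide[OF c] Qh)
  have al: "Q l * cos (\<theta> l) = cos r" and bl: "Q l * sin (\<theta> l) = c / h"
    using Q(1)[of l] by (simp_all add: th cr)
  have cot: "cot r = P l / R l" using h R[of l] by (simp add: cot_def cr)
  have cr0: "cos r < 0" unfolding cr using Pl h by (simp add: divide_neg_pos)
  have odd: "\<theta> (- s) = - \<theta> s" for s using longitude_odd[OF B0] by (simp add: \<theta>_def)
  have range: "\<bar>\<theta> s\<bar> \<le> \<theta> l" if "\<bar>s\<bar> \<le> l" for s
  proof -
    have "\<theta> (- l) \<le> \<theta> s" "\<theta> s \<le> \<theta> l" using that by (simp_all add: strict_mono_less_eq[OF mono] abs_le_iff)
    then show ?thesis by (simp add: odd abs_le_iff)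
  qed
  show ?thesis
    unfolding c_def[symmetric] R_def[symmetric] P_def[symmetric] Q_def[symmetric] \<theta>_def[symmetric] r_def[symmetric]
  proof (unfold_locales)
    show "(R has_real_derivative P s) (at s)" for s
      using DERIV_axial_radius[OF B0] by (simp add: R_def P_def)
    show "(P has_real_derivative - R s + c^2 / R s ^ 3) (at s)" for s
      unfolding R_def P_def c_def by (rule DERIV_radius_deriv[OF B0])
    show "((\<lambda>s. Q s * cos (\<theta> s)) has_real_derivative
        - (R s * P s * (Q s * cos (\<theta> s)) + c / R s * (Q s * sin (\<theta> s))) / (1 - (R s)^2)) (at s)" for s
      unfolding R_def P_def c_def Q_def \<theta>_def by (rule DERIV_plane_profile(1)[OF B0])
    show "((\<lambda>s. Q s * sin (\<theta> s)) has_real_derivative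
        (c / R s * (Q s * cos (\<theta> s)) - R s * P s * (Q s * sin (\<theta> s))) / (1 - (R s)^2)) (at s)" for s
      unfolding R_def P_def c_def Q_def \<theta>_def by (rule DERIV_plane_profile(2)[OF B0])
    show "(Q s * cos (\<theta> s))^2 + (Q s * sin (\<theta> s))^2 = 1 - (R s)^2" for s
    proof -
      have "(Q s * cos (\<theta> s))^2 + (Q s * sin (\<theta> s))^2 = (Q s)^2 * ((cos (\<theta> s))^2 + (sin (\<theta> s))^2)"
        by (simp only: power_mult_distrib distrib_left)
      then show ?thesis by (simp add: Q(2))
    qed
    show "(jacobi B has_real_derivative jacobi' B s) (at s)" for s by (rule DERIV_jacobi[OF B0])
    show "(jacobi' B has_real_derivative - (P s / R s) * jacobi' B s - (2 * c^2 / R s ^ 4 + 2) * jacobi B s) (at s)" for s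
      unfolding R_def P_def c_def by (rule DERIV_jacobi'[OF B0])
    show "R (- s) = R s" "P (- s) = - P s" "jacobi B (- s) = jacobi B s"
      "Q (- s) * cos (\<theta> (- s)) = Q s * cos (\<theta> s)" "Q (- s) * sin (\<theta> (- s)) = - (Q s * sin (\<theta> s))" for s
      by (simp_all add: R_def P_def Q_def radius_parity odd jacobi_even[OF B0])
    show "C_plane k (\<lambda>x. R (l - x $ 2))" "C_plane k (\<lambda>x. Q (l - x $ 2) * cos (\<theta> (l - x $ 2)))"
      "C_plane k (\<lambda>x. Q (l - x $ 2) * sin (\<theta> (l - x $ 2)))" "C_plane k (\<lambda>x. jacobi B (l - x $ 2))" for k
      unfolding R_def Q_def \<theta>_def by (rule C_plane_profile[OF B0])+
    show "inj_on (\<lambda>s. (Q s * cos (\<theta> s), Q s * sin (\<theta> s))) {- l..l}"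
    proof (rule inj_onI)
      fix s t assume st: "s \<in> {-l..l}" "t \<in> {-l..l}"
        and "(Q s * cos (\<theta> s), Q s * sin (\<theta> s)) = (Q t * cos (\<theta> t), Q t * sin (\<theta> t))"
      then have eq: "Q s * cos (\<theta> s) = Q t * cos (\<theta> t)" "Q s * sin (\<theta> s) = Q t * sin (\<theta> t)" by auto
      have "(Q s)^2 * ((cos (\<theta> s))^2 + (sin (\<theta> s))^2) = (Q t)^2 * ((cos (\<theta> t))^2 + (sin (\<theta> t))^2)"
        using eq unfolding distrib_left power_mult_distrib[symmetric] by simp
      then have "Q s = Q t" using Q(1)[of s] Q(1)[of t] by (simp add: power2_eq_iff)
      then have cs: "cos (\<theta> s) = cos (\<theta> t)" "sin (\<theta> s) = sin (\<theta> t)" using eq Q(1)[of t] by auto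
      then have "cos (\<theta> s - \<theta> t) = (cos (\<theta> t))^2 + (sin (\<theta> t))^2"
        unfolding cos_diff cs by (simp only: power2_eq_square)
      then have "cos (\<theta> s - \<theta> t) = 1" by simp
      then obtain k :: int where k: "\<theta> s - \<theta> t = of_int k * (2 * pi)"
        using cos_one_2pi_int[of "\<theta> s - \<theta> t"] by (auto simp: mult.assoc)
      have "\<bar>\<theta> s - \<theta> t\<bar> < 2 * pi" using range[of s] range[of t] st thlt by (auto simp: abs_le_iff)
      then have "\<bar>real_of_int k\<bar> * (2 * pi) < 1 * (2 * pi)" unfolding k by (simp add: abs_mult)
      then have "\<bar>real_of_int k\<bar> < 1" by (rule mult_right_less_imp_less) simp
      then have "k = 0" by linarith
      then have "\<theta> s = \<theta> t" using k by simp
      then show "s = t" using strict_mono_eq[OF mono] by simp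
    qed
    show "cos r \<le> Q s * cos (\<theta> s)" if s: "\<bar>s\<bar> \<le> l" for s
    proof -
      have e: "Q s * cos (\<theta> s) = Q \<bar>s\<bar> * cos \<bar>\<theta> s\<bar>"
        by (simp add: Q_def abs_if radius_parity)
      show ?thesis
      proof (cases "\<bar>\<theta> s\<bar> \<le> pi / 2")
        case True
        then have "cos (\<theta> s) \<ge> 0" by (intro cos_ge_zero) auto
        then have "Q s * cos (\<theta> s) \<ge> 0" using Q(1)[of s] by simp
        then show ?thesis using cr0 by linarith
      next
        case False
        have "cos (\<theta> l) \<le> cos \<bar>\<theta> s\<bar>"
          using range[OF s] thlt by (intro cos_monotone_0_pi_le) auto
        moreover have cl: "cos (\<theta> l) \<le> 0" using al cr0 Q(1)[of l] by (metis less_imp_le mult_pos_pos not_le)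
        moreover have "Q \<bar>s\<bar> \<le> Q l"
        proof -
          have "cos (2 * l) \<le> cos (2 * \<bar>s\<bar>)" using s l by (intro cos_monotone_0_pi_le) auto
          then have "axial_radius B l \<le> axial_radius B \<bar>s\<bar>" using B by (simp add: axial_radius_def)
          then have "(axial_radius B l)^2 \<le> (axial_radius B \<bar>s\<bar>)^2"
            using axial_radius_pos[OF B0, of l] by (intro power_mono) auto
          then show ?thesis by (simp add: Q_def polar_radius_def)
        qed
        moreover have "Q l * cos (\<theta> l) \<le> Q \<bar>s\<bar> * cos (\<theta> l)"
          using \<open>Q \<bar>s\<bar> \<le> Q l\<close> cl by (rule mult_right_mono_neg)
        moreover have "Q \<bar>s\<bar> * cos (\<theta> l) \<le> Q \<bar>s\<bar> * cos \<bar>\<theta> s\<bar>"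
          using \<open>cos (\<theta> l) \<le> cos \<bar>\<theta> s\<bar>\<close> Q(1)[of "\<bar>s\<bar>"] by (intro mult_left_mono) auto
        ultimately show ?thesis unfolding e using al by linarith
      qed
    qed
    show "P l = cot r * R l" using cot R[of l] by simp
    show "c * sin r = R l * (Q l * sin (\<theta> l))" unfolding cr bl by simp
    show "jacobi' B l = cot r * jacobi B l"
      unfolding cot using jacobi_robin[OF B0 crit] by (simp add: P_def R_def)
    show "jacobi B 0 \<noteq> 0"
    proof -
      have "1 + B^2 + 2 * B > 0" using B by (simp add: add_pos_pos)
      then show ?thesis
        using flux_pos[OF B0] w_sq_pos[OF B0, of 0] by (simp add: jacobi_def jacobi_part_def)
    qed
    show "0 < r" using r pi_gt_zero by linarith
  qed (use frame l R r al first in auto)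
qed

lemma exists_orthonormal_frame:
  fixes p :: "real^4"
  assumes "norm p = 1"
  obtains e2 e3 e4 :: "real^4" where "e2 \<bullet> e2 = 1" "e3 \<bullet> e3 = 1" "e4 \<bullet> e4 = 1"
    "p \<bullet> e2 = 0" "p \<bullet> e3 = 0" "p \<bullet> e4 = 0" "e2 \<bullet> e3 = 0" "e2 \<bullet> e4 = 0" "e3 \<bullet> e4 = 0"
proof -
  have "norm (axis 1 1 :: real^4) = norm p" using assms by simp
  from orthogonal_transformation_exists[OF this] obtain g
    where g: "orthogonal_transformation g" "g (axis 1 1 :: real^4) = p" .
  from g(1) have i: "g v \<bullet> g w = v \<bullet> w" for v w by (simp add: orthogonal_transformation_def)
  have ne: "(1::4) \<noteq> 2" "(1::4) \<noteq> 3" "(1::4) \<noteq> 4" "(2::4) \<noteq> 3" "(2::4) \<noteq> 4" "(3::4) \<noteq> 4"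
    by auto
  have p: "p \<bullet> g w = axis 1 1 \<bullet> w" for w using i[of "axis 1 1" w] g(2) by simp
  show thesis
    by (rule that[of "g (axis 2 1)" "g (axis 3 1)" "g (axis 4 1)"]; simp only: i p inner_axis_axis ne if_False if_True; simp)
qed

theorem corollary5p16:
  fixes p0 :: "real^4"
  assumes "p0 \<in> S3"
  shows "(\<exists>\<rho> \<Sigma> \<nu>. pi / 2 < \<rho> \<and> \<rho> < pi \<and>
            embedded_free_boundary_minimal_annulus p0 \<rho> \<Sigma> \<nu> \<and>
            (\<exists>u\<in>jacobi_robin_kernel \<Sigma> \<nu> \<rho>. \<not> killing_induced p0 \<rho> \<Sigma> \<nu> u))
       \<and> \<not> (\<forall>r. 0 < r \<and> r < pi \<longrightarrow> all_jacobi_robin_fields_killing_induced p0 r)"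
proof -
  have n: "norm p0 = 1" "p0 \<bullet> p0 = 1" using assms by (simp_all add: S3_def norm_eq_1[symmetric])
  obtain e2 e3 e4 :: "real^4" where e: "e2 \<bullet> e2 = 1" "e3 \<bullet> e3 = 1" "e4 \<bullet> e4 = 1"
    "p0 \<bullet> e2 = 0" "p0 \<bullet> e3 = 0" "p0 \<bullet> e4 = 0" "e2 \<bullet> e3 = 0" "e2 \<bullet> e4 = 0" "e3 \<bullet> e4 = 0"
    using exists_orthonormal_frame[OF n(1)] by metis
  obtain B l where B: "0 < B" "B < 1" and l: "0 < l" "l < pi / 2" and fb: "foot B l = pi / 2"
    and crit: "foot_B B l * (2 * B * (cos (2 * l) + B)) = foot_rate B l * sin (2 * l)"
    using exists_critical_bulge by blast
  define \<rho> where "\<rho> = pi / 2 + arctan (slope B l)"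
  interpret free_boundary_annulus p0 e2 e3 e4 "flux B" l \<rho> "axial_radius B" "radius_deriv B"
    "\<lambda>s. polar_radius B s * cos (longitude B s)" "\<lambda>s. polar_radius B s * sin (longitude B s)" "jacobi B" "jacobi' B"
    unfolding \<rho>_def by (rule bulge_annulus[OF n(2) e B l fb crit])
  have "sin (2 * l) > 0" using l by (intro sin_gt_zero) auto
  then have "slope B l > 0" using B radius_arg_pos(1)[of B "2 * l"] by (simp add: slope_def)
  then have \<rho>: "pi / 2 < \<rho>" "0 < \<rho>" "\<rho> < pi"
    using arctan_ubound[of "slope B l"] pi_gt_zero by (simp_all add: \<rho>_def add_pos_pos)
  show ?thesis
  proof
    show "\<exists>\<rho> \<Sigma> \<nu>. pi / 2 < \<rho> \<and> \<rho> < pi \<and> embedded_free_boundary_minimal_annulus p0 \<rho> \<Sigma> \<nu> \<and>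
            (\<exists>u\<in>jacobi_robin_kernel \<Sigma> \<nu> \<rho>. \<not> killing_induced p0 \<rho> \<Sigma> \<nu> u)"
      using \<rho> embedded_annulus U_in_kernel U_not_killing_induced by blast
    show "\<not> (\<forall>r. 0 < r \<and> r < pi \<longrightarrow> all_jacobi_robin_fields_killing_induced p0 r)"
      using \<rho> embedded_annulus U_in_kernel U_not_killing_induced unfolding all_jacobi_robin_fields_killing_induced_def by blast
  qed
qed

end
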